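(* Let $\alpha>0$. (1) [Lower bound] There exist constants $c>0$ and $\tau_\alpha>0$, depending only on $\alpha$, such that for every $\tau\ge\tau_\alpha$, every integer $d\ge 1$, every loading vector $\eta\in\mathbb{R}^d$ with $|\eta_1|\ge\cdots\ge|\eta_d|>0$, every $\sigma>0$ and every integer $s\in[d]$, $$\inf_{\hat T}\ \sup_{\theta\in\Theta_s}\ \sup_{\mathcal P_\xi\in\mathcal G_{\alpha,\tau}^{\otimes}}\mathbb{E}_{\theta,\mathcal P_\xi}\big(\hat T-L(\theta)\big)^2\ \ge\ c\,\sigma^2\,\Phi_{\rm o}(s;\eta),$$ where the infimum is over all estimators. (2) [Upper bound] For every $\tau>0$ there exists a constant $C>0$, depending only on $(\alpha,\tau)$, such that for every integer $d\ge1$, every such $\eta$, every $\sigma>0$ and every integer $s\in[d]$, the estimator $$\hat L_s=\sum_{j\le j_1(s)}\eta_jy_j+\sum_{j>j_1(s)}\eta_jy_j\,\mathbf 1\{|\eta_jy_j|>\sigma\tau\lambda_o\}$$ satisfies $$\sup_{\theta\in\Theta_s}\ \sup_{\mathcal P_\xi\in\mathcal G_{\alpha,\tau}^{\otimes}}\mathbb{E}_{\theta,\mathcal P_\xi}\big(\hat L_s-L(\theta)\big)^2\ \le\ C\,\sigma^2\,\Phi_{\rm o}(s;\eta).$$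
   Context: Model: $[d]=\{1,\dots,d\}$; $\eta\in\mathbb{R}^d$ is a known fixed vector with $|\eta_1|\ge\cdots\ge|\eta_d|>0$; one observes $y_j=\theta_j+\sigma\xi_j$, $j\in[d]$, with $\theta\in\mathbb{R}^d$ unknown, $\sigma>0$ known, and $\xi=(\xi_1,\dots,\xi_d)$ with independent coordinates and joint law $\mathcal P_\xi$. $\mathbb{P}_{\theta,\mathcal P_\xi}$ is the law of $(y_1,\dots,y_d)$ and $\mathbb{E}_{\theta,\mathcal P_\xi}$ the expectation. $L(\theta)=\sum_{j=1}^d\eta_j\theta_j$ and $\Theta_s=\{\theta\in\mathbb{R}^d:\#\{j:\theta_j\ne0\}\le s\}$. An estimator is any measurable real-valued function of $(y_1,\dots,y_d)$ (it may depend on the known quantities $s,\eta,\sigma,\alpha,\tau$). Noise class: for $\alpha,\tau>0$, $\mathcal G_{\alpha,\tau}$ is the class of distributions on $\mathbb{R}$ of random variables $W$ that are symmetric around $0$, satisfy $\mathbb{E}(W^2)=1$, and $\mathbb{P}(|W|\ge t)\le 2\exp\{-2(t/\tau)^\alpha\}$ for all $t\ge0$. $\mathcal G_{\alpha,\tau}^{\otimes}=\{\otimes_{j=1}^dP_j:P_j\in\mathcal G_{\alpha,\tau}\}$. Rate: for real $s\in[1,d]$, $\beta=\beta(s;\eta,\alpha)\in\mathbb{R}$ is the unique solution of $$\frac{\sum_{j=1}^d|\eta_j|\exp(-\beta/|\eta_j|^\alpha)}{\sqrt{\sum_{j=1}^d\eta_j^2\exp(-\beta/|\eta_j|^\alpha)}}=\frac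 s2$$ (the left side is continuous and strictly decreasing in $\beta$, from $+\infty$ to $0$). With $\beta_+=\max(\beta,0)$, set $\lambda_o=\lambda_o(s;\eta,\alpha)=\beta_+^{1/\alpha}$, $$\nu=\sqrt{\sum_{j=1}^d\eta_j^2\exp\big(-(\lambda_o/|\eta_j|)^\alpha\big)},\qquad \Phi_{\rm o}(s;\eta)=(\lambda_os+\nu)^2,$$ and $j_1(s)=\max\{j\in[d]:|\eta_j|\ge\lambda_o\}$, with $j_1(s)=0$ if no such $j$ exists. *)

theory Defs
  imports "HOL-Probability.Probability"
begin

text \<open>
  The dimension \<open>d\<close> is quantified inside the statements, after the constants, so vectors in
  \<open>\<real>\<^sup>d\<close> are functions \<open>nat \<Rightarrow> real\<close> of which only the values on \<open>{1..d}\<close> are used; as elements of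
  the sample space and of the parameter set they are the functions extensional on \<open>{1..d}\<close>.
\<close>

definition loading_vector :: "nat \<Rightarrow> (nat \<Rightarrow> real) \<Rightarrow> bool" where
  "loading_vector d \<eta> \<longleftrightarrow>
     (\<forall>i\<in>{1..d}. \<forall>j\<in>{1..d}. i \<le> j \<longrightarrow> \<bar>\<eta> i\<bar> \<ge> \<bar>\<eta> j\<bar>) \<and> \<bar>\<eta> d\<bar> > 0"

abbreviation sample_space :: "nat \<Rightarrow> (nat \<Rightarrow> real) measure" where
  "sample_space d \<equiv> (\<Pi>\<^sub>M j\<in>{1..d}. borel)"

definition linear_functional :: "nat \<Rightarrow> (nat \<Rightarrow> real) \<Rightarrow> (nat \<Rightarrow> real) \<Rightarrow> real" where
  "linear_functional d \<eta> \<theta> = (\<Sum>j=1..d. \<eta> j * \<theta> j)"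

definition sparse_class :: "nat \<Rightarrow> nat \<Rightarrow> (nat \<Rightarrow> real) set" where
  "sparse_class d s = {\<theta> \<in> {1..d} \<rightarrow>\<^sub>E UNIV. card {j \<in> {1..d}. \<theta> j \<noteq> 0} \<le> s}"

definition noise_class :: "real \<Rightarrow> real \<Rightarrow> real measure set" where
  "noise_class \<alpha> \<tau> = {P. prob_space P \<and> sets P = sets borel
     \<and> distr P borel uminus = P
     \<and> integrable P (\<lambda>w. w\<^sup>2) \<and> (\<integral>w. w\<^sup>2 \<partial>P) = 1
     \<and> (\<forall>t\<ge>0. measure P {w. \<bar>w\<bar> \<ge> t} \<le> 2 * exp (- 2 * (t / \<tau>) powr \<alpha>))}"

definition product_noise_class :: "nat \<Rightarrow> real \<Rightarrow> real \<Rightarrow> (nat \<Rightarrow> real) measure set" where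
  "product_noise_class d \<alpha> \<tau> =
     {PiM {1..d} P | P. \<forall>j\<in>{1..d}. P j \<in> noise_class \<alpha> \<tau>}"

definition observation_law ::
    "nat \<Rightarrow> real \<Rightarrow> (nat \<Rightarrow> real) \<Rightarrow> (nat \<Rightarrow> real) measure \<Rightarrow> (nat \<Rightarrow> real) measure" where
  "observation_law d \<sigma> \<theta> Q =
     distr Q (sample_space d) (\<lambda>\<xi>. \<lambda>j\<in>{1..d}. \<theta> j + \<sigma> * \<xi> j)"

abbreviation estimators :: "nat \<Rightarrow> ((nat \<Rightarrow> real) \<Rightarrow> real) set" where
  "estimators d \<equiv> borel_measurable (sample_space d)"

text \<open>The risk takes values in \<open>[0,\<infinity>]\<close>, because it may be infinite for an arbitrary estimator.\<close>

definition risk ::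
    "nat \<Rightarrow> (nat \<Rightarrow> real) \<Rightarrow> real \<Rightarrow> ((nat \<Rightarrow> real) \<Rightarrow> real) \<Rightarrow> (nat \<Rightarrow> real)
       \<Rightarrow> (nat \<Rightarrow> real) measure \<Rightarrow> ennreal" where
  "risk d \<eta> \<sigma> T \<theta> Q =
     (\<integral>\<^sup>+ y. ennreal ((T y - linear_functional d \<eta> \<theta>)\<^sup>2) \<partial>observation_law d \<sigma> \<theta> Q)"

definition max_risk ::
    "nat \<Rightarrow> (nat \<Rightarrow> real) \<Rightarrow> real \<Rightarrow> real \<Rightarrow> real \<Rightarrow> nat \<Rightarrow> ((nat \<Rightarrow> real) \<Rightarrow> real) \<Rightarrow> ennreal" where
  "max_risk d \<eta> \<sigma> \<alpha> \<tau> s T =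
     (SUP \<theta>\<in>sparse_class d s. SUP Q\<in>product_noise_class d \<alpha> \<tau>. risk d \<eta> \<sigma> T \<theta> Q)"

definition beta_o :: "nat \<Rightarrow> (nat \<Rightarrow> real) \<Rightarrow> real \<Rightarrow> real \<Rightarrow> real" where
  "beta_o d \<eta> \<alpha> s = (THE b.
     (\<Sum>j=1..d. \<bar>\<eta> j\<bar> * exp (- b / \<bar>\<eta> j\<bar> powr \<alpha>))
       / sqrt (\<Sum>j=1..d. (\<eta> j)\<^sup>2 * exp (- b / \<bar>\<eta> j\<bar> powr \<alpha>)) = s / 2)"

definition lambda_o :: "nat \<Rightarrow> (nat \<Rightarrow> real) \<Rightarrow> real \<Rightarrow> real \<Rightarrow> real" where
  "lambda_o d \<eta> \<alpha> s = (max (beta_o d \<eta> \<alpha> s) 0) powr (1 / \<alpha>)"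

definition nu_o :: "nat \<Rightarrow> (nat \<Rightarrow> real) \<Rightarrow> real \<Rightarrow> real \<Rightarrow> real" where
  "nu_o d \<eta> \<alpha> s =
     sqrt (\<Sum>j=1..d. (\<eta> j)\<^sup>2 * exp (- ((lambda_o d \<eta> \<alpha> s / \<bar>\<eta> j\<bar>) powr \<alpha>)))"

definition Phi_o :: "nat \<Rightarrow> (nat \<Rightarrow> real) \<Rightarrow> real \<Rightarrow> real \<Rightarrow> real" where
  "Phi_o d \<eta> \<alpha> s = (lambda_o d \<eta> \<alpha> s * s + nu_o d \<eta> \<alpha> s)\<^sup>2"

definition j1 :: "nat \<Rightarrow> (nat \<Rightarrow> real) \<Rightarrow> real \<Rightarrow> real \<Rightarrow> nat" where
  "j1 d \<eta> \<alpha> s =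
     (if \<exists>j\<in>{1..d}. \<bar>\<eta> j\<bar> \<ge> lambda_o d \<eta> \<alpha> s
      then Max {j \<in> {1..d}. \<bar>\<eta> j\<bar> \<ge> lambda_o d \<eta> \<alpha> s} else 0)"

definition threshold_estimator ::
    "nat \<Rightarrow> (nat \<Rightarrow> real) \<Rightarrow> real \<Rightarrow> real \<Rightarrow> real \<Rightarrow> real \<Rightarrow> (nat \<Rightarrow> real) \<Rightarrow> real" where
  "threshold_estimator d \<eta> \<sigma> \<alpha> \<tau> s y =
     (\<Sum>j\<in>{1..j1 d \<eta> \<alpha> s}. \<eta> j * y j)
     + (\<Sum>j\<in>{j1 d \<eta> \<alpha> s<..d}.
          \<eta> j * y j * (if \<bar>\<eta> j * y j\<bar> > \<sigma> * \<tau> * lambda_o d \<eta> \<alpha> s then 1 else 0))"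

text \<open>The equation defining \<open>beta_o\<close> has exactly one solution, so its description is proper.\<close>

lemma beta_o_quotient_strict_antimono:
  fixes a w :: "nat \<Rightarrow> real"
  assumes fin: "finite I" and ne: "I \<noteq> {}"
    and a: "\<And>i. i \<in> I \<Longrightarrow> a i > 0" and w: "\<And>i. i \<in> I \<Longrightarrow> w i > 0"
    and mono: "\<And>i j. i \<in> I \<Longrightarrow> j \<in> I \<Longrightarrow> (a j - a i) * (1 / w j - 1 / w i) \<le> 0"
    and less: "b < b'"
  shows "(\<Sum>i\<in>I. a i * exp (- b' / w i))\<^sup>2 / (\<Sum>i\<in>I. (a i)\<^sup>2 * exp (- b' / w i))
       < (\<Sum>i\<in>I. a i * exp (- b / w i))\<^sup>2 / (\<Sum>i\<in>I. (a i)\<^sup>2 * exp (- b / w i))"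
proof (rule DERIV_neg_imp_decreasing[OF less])
  fix x :: real
  define e where "e i = exp (- x / w i)" for i
  have wn: "w i \<noteq> 0" if "i \<in> I" for i using w[OF that] by simp
  have e: "e i > 0" for i by (simp add: e_def)
  define N where "N = (\<Sum>i\<in>I. a i * e i)"
  define D where "D = (\<Sum>i\<in>I. (a i)\<^sup>2 * e i)"
  define N' where "N' = (\<Sum>i\<in>I. a i * e i / w i)"
  define D' where "D' = (\<Sum>i\<in>I. (a i)\<^sup>2 * e i / w i)"
  have pos: "N > 0" "D > 0" "N' > 0"
    unfolding N_def D_def N'_def using fin ne a w e
    by (intro sum_pos mult_pos_pos divide_pos_pos zero_less_power; simp)+
  have dN: "((\<lambda>b. \<Sum>i\<in>I. a i * exp (- b / w i)) has_real_derivative - N') (at x)"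
    unfolding N'_def sum_negf[symmetric]
    by (intro DERIV_sum) (auto intro!: derivative_eq_intros simp: e_def wn)
  have dD: "((\<lambda>b. \<Sum>i\<in>I. (a i)\<^sup>2 * exp (- b / w i)) has_real_derivative - D') (at x)"
    unfolding D'_def sum_negf[symmetric]
    by (intro DERIV_sum) (auto intro!: derivative_eq_intros simp: e_def wn)
  have Nx: "(\<Sum>i\<in>I. a i * exp (- x / w i)) = N" and Dx: "(\<Sum>i\<in>I. (a i)\<^sup>2 * exp (- x / w i)) = D"
    by (simp_all add: N_def D_def e_def)
  have "((\<lambda>b. (\<Sum>i\<in>I. a i * exp (- b / w i))\<^sup>2 / (\<Sum>i\<in>I. (a i)\<^sup>2 * exp (- b / w i)))
      has_real_derivative (2 * N * (- N') * D - N\<^sup>2 * (- D')) / (D * D)) (at x)"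
    using DERIV_divide[OF DERIV_power[OF dN, of 2] dD, unfolded Nx Dx] pos by (simp add: mult_ac)
  moreover have "(2 * N * (- N') * D - N\<^sup>2 * (- D')) / (D * D) < 0"
  proof -
    have ND: "N * D' = (\<Sum>i\<in>I. \<Sum>j\<in>I. a i * e i * ((a j)\<^sup>2 * e j / w j))"
      and N'D: "N' * D = (\<Sum>i\<in>I. \<Sum>j\<in>I. a i * e i / w i * ((a j)\<^sup>2 * e j))"
      by (simp_all add: N_def D_def N'_def D'_def sum_product)
    define S where "S = (\<Sum>i\<in>I. \<Sum>j\<in>I. a i * e i * ((a j)\<^sup>2 * e j) * (1 / w j - 1 / w i))"
    have 1: "N * D' - N' * D = S"
      unfolding ND N'D S_def by (simp add: sum_subtractf[symmetric] algebra_simps)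
    have "S = (\<Sum>i\<in>I. \<Sum>j\<in>I. a j * e j * ((a i)\<^sup>2 * e i) * (1 / w i - 1 / w j))"
      unfolding S_def by (rule sum.swap)
    then have "S + S = (\<Sum>i\<in>I. \<Sum>j\<in>I. a i * e i * ((a j)\<^sup>2 * e j) * (1 / w j - 1 / w i)
        + a j * e j * ((a i)\<^sup>2 * e i) * (1 / w i - 1 / w j))"
      by (simp add: S_def sum.distrib)
    also have "\<dots> = (\<Sum>i\<in>I. \<Sum>j\<in>I. a i * e i * a j * e j * ((a j - a i) * (1 / w j - 1 / w i)))"
      by (intro sum.cong refl) (simp add: algebra_simps power2_eq_square)
    also have "\<dots> \<le> 0"
      by (intro sum_nonpos mult_nonneg_nonpos[OF _ mono]) (auto intro!: mult_nonneg_nonneg less_imp_le[OF a] less_imp_le[OF e])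
    finally have "N * D' \<le> N' * D" using 1 by simp
    moreover have "N' * D > 0" using pos by simp
    ultimately have "N * D' - 2 * (N' * D) < 0" by linarith
    then have "N * (N * D' - 2 * (N' * D)) < 0"
      using pos by (intro mult_pos_neg)
    then have "2 * N * (- N') * D - N\<^sup>2 * (- D') < 0" by (simp add: algebra_simps power2_eq_square)
    then show ?thesis using pos by (intro divide_neg_pos) auto
  qed
  ultimately show "\<exists>y. ((\<lambda>b. (\<Sum>i\<in>I. a i * exp (- b / w i))\<^sup>2 / (\<Sum>i\<in>I. (a i)\<^sup>2 * exp (- b / w i)))
      has_real_derivative y) (at x) \<and> y < 0" by blast
qed

lemma beta_o_ex1:
  assumes load: "loading_vector d \<eta>" and d: "d \<ge> 1" and \<alpha>: "\<alpha> > 0" and s: "s > 0"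
  shows "\<exists>!b. (\<Sum>j=1..d. \<bar>\<eta> j\<bar> * exp (- b / \<bar>\<eta> j\<bar> powr \<alpha>))
     / sqrt (\<Sum>j=1..d. (\<eta> j)\<^sup>2 * exp (- b / \<bar>\<eta> j\<bar> powr \<alpha>)) = s / 2"
proof -
  define a where "a j = \<bar>\<eta> j\<bar>" for j
  define w where "w j = a j powr \<alpha>" for j
  define N where "N b = (\<Sum>j=1..d. a j * exp (- b / w j))" for b
  define D where "D b = (\<Sum>j=1..d. (a j)\<^sup>2 * exp (- b / w j))" for b
  define g where "g b = (N b)\<^sup>2 / D b" for b
  have a: "a j > 0" "a j \<le> a 1" if "j \<in> {1..d}" for j
    using load that d by (fastforce simp: loading_vector_def a_def)+
  have w: "w j > 0" "w j \<le> w 1" if "j \<in> {1..d}" for j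
    using a[OF that] \<alpha> by (auto simp: w_def intro!: powr_mono2)
  have wn: "w j \<noteq> 0" if "j \<in> {1..d}" for j using w(1)[OF that] by simp
  have w1: "w 1 > 0" using w d by auto
  have pos: "N b > 0" "D b > 0" for b
    unfolding N_def D_def using a d by (intro sum_pos mult_pos_pos zero_less_power; simp)+
  have mono: "(a j - a i) * (1 / w j - 1 / w i) \<le> 0" if "i \<in> {1..d}" "j \<in> {1..d}" for i j
  proof (cases "a i \<le> a j")
    case True
    then have "w i \<le> w j" using a that \<alpha> unfolding w_def by (intro powr_mono2) (auto intro: less_imp_le)
    then show ?thesis using True w that by (intro mult_nonneg_nonpos) (auto intro!: frac_le)
  next
    case False
    then have "w j \<le> w i" using a that \<alpha> unfolding w_def by (intro powr_mono2) (auto intro: less_imp_le)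
    then show ?thesis using False w that by (intro mult_nonpos_nonneg) (auto intro!: frac_le)
  qed
  have anti: "g b' < g b" if "b < b'" for b b'
    unfolding g_def N_def D_def using a w mono d that
    by (intro beta_o_quotient_strict_antimono) auto
  have iff: "(\<Sum>j=1..d. \<bar>\<eta> j\<bar> * exp (- b / \<bar>\<eta> j\<bar> powr \<alpha>))
     / sqrt (\<Sum>j=1..d. (\<eta> j)\<^sup>2 * exp (- b / \<bar>\<eta> j\<bar> powr \<alpha>)) = s / 2 \<longleftrightarrow> g b = s\<^sup>2 / 4" for b
  proof -
    have "(\<Sum>j=1..d. \<bar>\<eta> j\<bar> * exp (- b / \<bar>\<eta> j\<bar> powr \<alpha>))
       / sqrt (\<Sum>j=1..d. (\<eta> j)\<^sup>2 * exp (- b / \<bar>\<eta> j\<bar> powr \<alpha>)) = N b / sqrt (D b)"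
      by (simp add: N_def D_def w_def a_def)
    moreover have "g b = (N b / sqrt (D b))\<^sup>2"
      using pos[of b] by (simp add: g_def power_divide)
    moreover have "(N b / sqrt (D b))\<^sup>2 = (s / 2)\<^sup>2 \<longleftrightarrow> N b / sqrt (D b) = s / 2"
      using pos[of b] s by (intro power2_eq_iff_nonneg) auto
    ultimately show ?thesis by (simp add: power_divide)
  qed
  have "\<exists>b. g b = s\<^sup>2 / 4"
  proof -
    define b1 where "b1 = - (w 1 * max 0 (ln (s\<^sup>2 / 4)))"
    define b2 where "b2 = w 1 * max 0 (ln (4 * real d / s\<^sup>2))"
    have b: "b1 \<le> 0" "0 \<le> b2" using w1 by (auto simp: b1_def b2_def)
    have e1: "exp (- b1 / w 1) \<le> exp (- b1 / w j)" if "j \<in> {1..d}" for j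
      using frac_le[of "- b1" "- b1" "w j" "w 1"] b w[OF that] by simp
    have e2: "exp (- b2 / w j) \<le> exp (- b2 / w 1)" if "j \<in> {1..d}" for j
      using frac_le[of b2 b2 "w j" "w 1"] b w[OF that] by simp
    have "s\<^sup>2 / 4 \<le> exp (- b1 / w 1)"
    proof -
      have "s\<^sup>2 / 4 = exp (ln (s\<^sup>2 / 4))" using s by simp
      also have "\<dots> \<le> exp (- b1 / w 1)" using w1 by (simp only: exp_le_cancel_iff) (simp add: b1_def)
      finally show ?thesis .
    qed
    also have "\<dots> \<le> g b1"
    proof -
      have "exp (- b1 / w 1) * D b1 = (\<Sum>j=1..d. (a j)\<^sup>2 * exp (- b1 / w j) * exp (- b1 / w 1))"
        by (simp add: D_def sum_distrib_left mult_ac)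
      also have "\<dots> \<le> (\<Sum>j=1..d. (a j)\<^sup>2 * exp (- b1 / w j) * exp (- b1 / w j))"
        using e1 by (intro sum_mono mult_left_mono) auto
      also have "\<dots> = (\<Sum>j=1..d. (a j * exp (- b1 / w j)) * (a j * exp (- b1 / w j)))"
        by (intro sum.cong refl) (simp add: power2_eq_square mult_ac)
      also have "\<dots> \<le> (\<Sum>j=1..d. (a j * exp (- b1 / w j)) * N b1)"
        unfolding N_def using a
        by (intro sum_mono mult_left_mono member_le_sum) (auto intro: less_imp_le)
      also have "\<dots> = (N b1)\<^sup>2" by (simp add: N_def sum_distrib_right power2_eq_square)
      finally show ?thesis using pos[of b1] by (simp add: g_def pos_le_divide_eq)
    qed
    finally have lower: "s\<^sup>2 / 4 \<le> g b1" .
    have "g b2 \<le> real d * exp (- b2 / w 1)"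
    proof -
      have "(N b2)\<^sup>2 \<le> (\<Sum>j=1..d. (a j * exp (- b2 / w j))\<^sup>2) * (\<Sum>j=1..d. 1\<^sup>2)"
        using Cauchy_Schwarz_ineq_sum[of "\<lambda>j. a j * exp (- b2 / w j)" "\<lambda>_. 1" "{1..d}"]
        by (simp add: N_def)
      also have "\<dots> = real d * (\<Sum>j=1..d. (a j)\<^sup>2 * exp (- b2 / w j) * exp (- b2 / w j))"
        by (simp add: power2_eq_square mult_ac)
      also have "\<dots> \<le> real d * (\<Sum>j=1..d. (a j)\<^sup>2 * exp (- b2 / w j) * exp (- b2 / w 1))"
        using e2 by (intro sum_mono mult_left_mono) auto
      also have "\<dots> = real d * exp (- b2 / w 1) * D b2"
        by (simp add: D_def sum_distrib_left mult_ac)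
      finally show ?thesis using pos[of b2] by (simp add: g_def pos_divide_le_eq)
    qed
    also have "\<dots> \<le> real d * (s\<^sup>2 / (4 * real d))"
    proof -
      have "exp (- b2 / w 1) \<le> exp (- ln (4 * real d / s\<^sup>2))"
        using w1 by (simp only: exp_le_cancel_iff) (simp add: b2_def)
      also have "\<dots> = s\<^sup>2 / (4 * real d)" using s d by (simp add: exp_minus)
      finally show ?thesis by (intro mult_left_mono) auto
    qed
    also have "\<dots> = s\<^sup>2 / 4" using d by simp
    finally have upper: "g b2 \<le> s\<^sup>2 / 4" .
    have cont: "isCont g x" for x
    proof -
      have "isCont N x" "isCont D x"
        unfolding N_def D_def using wn by (auto intro!: continuous_intros)
      then show ?thesis unfolding g_def using pos(2)[of x]
        by (intro continuous_intros) auto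
    qed
    show ?thesis using IVT2[of g b2 "s\<^sup>2 / 4" b1] lower upper cont b by fastforce
  qed
  then obtain b where "g b = s\<^sup>2 / 4" by blast
  moreover have "b' = b''" if "g b' = s\<^sup>2 / 4" "g b'' = s\<^sup>2 / 4" for b' b''
    using anti[of b' b''] anti[of b'' b'] that by (cases b' b'' rule: linorder_cases) auto
  ultimately show ?thesis unfolding iff by blast
qed

lemma j1_le: "j1 d \<eta> \<alpha> s \<le> d"
proof (cases "\<exists>j\<in>{1..d}. \<bar>\<eta> j\<bar> \<ge> lambda_o d \<eta> \<alpha> s")
  case True
  then have "Max {j \<in> {1..d}. \<bar>\<eta> j\<bar> \<ge> lambda_o d \<eta> \<alpha> s} \<in> {j \<in> {1..d}. \<bar>\<eta> j\<bar> \<ge> lambda_o d \<eta> \<alpha> s}"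
    by (intro Max_in) auto
  with True show ?thesis by (simp add: j1_def)
qed (simp add: j1_def)

lemma threshold_estimator_in_estimators:
  "threshold_estimator d \<eta> \<sigma> \<alpha> \<tau> s \<in> estimators d"
proof -
  have comp: "(\<lambda>y. \<eta> j * y j) \<in> borel_measurable (sample_space d)" if "j \<in> {1..d}" for j
    using that by (intro borel_measurable_times borel_measurable_const measurable_component_singleton)
  have 1: "(\<lambda>y. \<eta> j * y j) \<in> borel_measurable (sample_space d)" if "j \<in> {1..j1 d \<eta> \<alpha> s}" for j
    using that j1_le[of d \<eta> \<alpha> s] by (intro comp) auto
  have 2: "(\<lambda>y. \<eta> j * y j * (if \<bar>\<eta> j * y j\<bar> > \<sigma> * \<tau> * lambda_o d \<eta> \<alpha> s then 1 else 0))
      \<in> borel_measurable (sample_space d)" if "j \<in> {j1 d \<eta> \<alpha> s<..d}" for j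
  proof -
    have [measurable]: "(\<lambda>y. \<eta> j * y j) \<in> borel_measurable (sample_space d)"
      using that by (intro comp) auto
    show ?thesis by measurable
  qed
  show ?thesis
    unfolding threshold_estimator_def[abs_def]
    by (intro borel_measurable_add borel_measurable_sum 1 2)
qed

lemma prob_space_observation_law:
  assumes "Q \<in> product_noise_class d \<alpha> \<tau>"
  shows "prob_space (observation_law d \<sigma> \<theta> Q)"
proof -
  from assms obtain P where Q: "Q = PiM {1..d} P" and P: "\<And>j. j \<in> {1..d} \<Longrightarrow> P j \<in> noise_class \<alpha> \<tau>"
    by (auto simp: product_noise_class_def)
  have "prob_space Q"
    unfolding Q using P by (intro prob_space_PiM) (auto simp: noise_class_def)
  moreover have s: "sets Q = sets (sample_space d)"
    unfolding Q using P by (intro sets_PiM_cong) (auto simp: noise_class_def)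
  have "(\<lambda>\<xi>. \<lambda>j\<in>{1..d}. \<theta> j + \<sigma> * \<xi> j) \<in> measurable (sample_space d) (sample_space d)"
    by (intro measurable_restrict borel_measurable_add borel_measurable_times
        borel_measurable_const measurable_component_singleton)
  then have "(\<lambda>\<xi>. \<lambda>j\<in>{1..d}. \<theta> j + \<sigma> * \<xi> j) \<in> measurable Q (sample_space d)"
    by (simp add: measurable_cong_sets[OF s refl])
  ultimately show ?thesis
    unfolding observation_law_def by (intro prob_space.prob_space_distr)
qed

end

theory Submission imports Defs begin

text \<open>
  Lower bound. All the noise can have the single density proportional to \<open>exp (- c |x|\<^sup>\<alpha>)\<close>. Shifting it
  by \<open>v\<close> costs a \<open>\<chi>\<^sup>2\<close>-divergence of order \<open>exp (C c |v|\<^sup>\<alpha>)\<close>, so with \<open>u\<^sub>j = \<lambda> / |\<eta>\<^sub>j|\<close> and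
  \<open>e\<^sub>j = exp (- u\<^sub>j\<^sup>\<alpha>)\<close> a shift of size \<open>\<kappa> (1 + u\<^sub>j)\<close> costs \<open>O(1 / e\<^sub>j)\<close> when \<open>\<kappa>\<close> is small. Let the
  coordinates of \<open>\<theta>\<close> be independent, \<open>\<theta>\<^sub>j = \<sigma> sgn \<eta>\<^sub>j \<kappa> (1 + u\<^sub>j)\<close> with probability
  \<open>p\<^sub>j = |\<eta>\<^sub>j| e\<^sub>j / \<nu>\<close> and \<open>0\<close> otherwise. Then \<open>\<Sum> p\<^sub>j\<^sup>2 / e\<^sub>j = 1\<close>, so the mixture stays at bounded
  \<open>\<chi>\<^sup>2\<close>-divergence from \<open>\<theta> = 0\<close>, while the equation for \<open>\<beta>\<close> gives \<open>\<Sum> p\<^sub>j \<le> s / 2\<close>, with equality if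
  \<open>\<lambda> > 0\<close>, so that the prior mean of \<open>L(\<theta>)\<close> is \<open>\<sigma> \<kappa> (\<nu> + \<lambda> s / 2)\<close>.

  Upper bound. The coordinates with \<open>|\<eta>\<^sub>j| \<ge> \<lambda>\<close> or \<open>\<theta>\<^sub>j = 0\<close> contribute odd functions of the noise, which
  are centred and orthogonal, with second moments \<open>O(\<sigma>\<^sup>2 \<eta>\<^sub>j\<^sup>2 e\<^sub>j)\<close>. Each of the remaining at most \<open>s\<close>
  coordinates contributes an error of size \<open>O(\<sigma> \<lambda>)\<close>.
\<close>

section \<open>Exponential-power noise\<close>

text \<open>For \<open>x \<le> 1\<close> the product is at most 1. For larger \<open>x\<close>,
  \<open>x ^ n\<close> is dominated by \<open>(x powr \<alpha>) ^ m\<close> with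
  \<open>m \<ge> n / \<alpha>\<close>, and the exponential absorbs that power through
  \<open>(1 + t / m) ^ m \<le> exp t\<close>.\<close>

lemma power_exp_powr_bounded:
  fixes \<alpha> c :: real
  assumes \<alpha>: "\<alpha> > 0" and c: "c > 0"
  shows "\<exists>K>0. \<forall>x\<ge>0. x ^ n * exp (- c * x powr \<alpha>) \<le> K"
proof -
  \<comment> \<open>The ceiling gives \<open>n \<le> m * \<alpha>\<close>; \<open>Suc\<close> keeps
    \<open>m\<close> positive, since it is a divisor below.\<close>
  define m where "m = Suc (nat \<lceil>real n / \<alpha>\<rceil>)"
  have m: "real n \<le> real m * \<alpha>"
  proof -
    have "real n / \<alpha> \<le> real m" unfolding m_def by linarith
    then show ?thesis using \<alpha> by (simp add: field_simps)
  qed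
  have mpos: "m > 0" by (simp add: m_def)
  have "x ^ n * exp (- c * x powr \<alpha>) \<le> 1 + (real m / c) ^ m" if x: "x \<ge> 0" for x :: real
  proof (cases "x \<le> 1")
    case True
    have "x ^ n * exp (- c * x powr \<alpha>) \<le> 1 * 1"
      using x True c by (intro mult_mono power_le_one) auto
    also have "\<dots> \<le> 1 + (real m / c) ^ m" using c by simp
    finally show ?thesis .
  next
    case False
    define t where "t = c * x powr \<alpha>"
    have t: "t > 0" using False c by (simp add: t_def)
    have "x ^ n = x powr real n" using False by (simp add: powr_realpow)
    also have "\<dots> \<le> x powr (real m * \<alpha>)" using False m by (intro powr_mono) auto
    also have "\<dots> = (x powr \<alpha>) ^ m"
      using False by (simp add: powr_powr[symmetric] powr_realpow mult.commute)
    also have "\<dots> = (real m / c) ^ m * (t / real m) ^ m"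
      using c mpos by (simp add: t_def power_mult_distrib[symmetric])
    also have "\<dots> \<le> (real m / c) ^ m * exp t"
    proof -
      have "(t / real m) ^ m \<le> (1 + t / real m) ^ m" using t by (intro power_mono) auto
      also have "\<dots> \<le> exp t" using t mpos by (intro exp_ge_one_plus_x_over_n_power_n) auto
      finally show ?thesis using c by (intro mult_left_mono) auto
    qed
    finally have "x ^ n * exp (- t) \<le> (real m / c) ^ m * exp t * exp (- t)"
      by (intro mult_right_mono) auto
    then have "x ^ n * exp (- t) \<le> (real m / c) ^ m"
      by (simp add: mult.assoc exp_add[symmetric])
    then show ?thesis by (simp add: t_def)
  qed
  moreover have "1 + (real m / c) ^ m > 0" using c by (intro add_pos_nonneg) auto
  ultimately show ?thesis by blast
qed

text \<open>Multiplying by \<open>1 + x^2\<close> leaves the exponents \<open>n\<close> and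
  \<open>n + 2\<close>, both covered by the preceding bound. The majorant is integrable over the
  line and summable over the integers; the first serves the densities, the second the fourth moment
  of the noise class.\<close>

lemma power_exp_powr_le:
  fixes \<alpha> c :: real
  assumes "\<alpha> > 0" and "c > 0"
  shows "\<exists>K>0. \<forall>x. \<bar>x\<bar> ^ n * exp (- c * \<bar>x\<bar> powr \<alpha>) \<le> K * inverse (1 + x\<^sup>2)"
proof -
  obtain K1 where K1: "K1 > 0" "\<And>x. x \<ge> 0 \<Longrightarrow> x ^ n * exp (- c * x powr \<alpha>) \<le> K1"
    using power_exp_powr_bounded[OF assms] by blast
  obtain K2 where K2: "K2 > 0" "\<And>x. x \<ge> 0 \<Longrightarrow> x ^ (n + 2) * exp (- c * x powr \<alpha>) \<le> K2"
    using power_exp_powr_bounded[OF assms] by blast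
  have "\<bar>x\<bar> ^ n * exp (- c * \<bar>x\<bar> powr \<alpha>) \<le> (K1 + K2) * inverse (1 + x\<^sup>2)" for x :: real
  proof -
    have "\<bar>x\<bar> ^ n * exp (- c * \<bar>x\<bar> powr \<alpha>) * (1 + x\<^sup>2)
        = \<bar>x\<bar> ^ n * exp (- c * \<bar>x\<bar> powr \<alpha>) + \<bar>x\<bar> ^ (n + 2) * exp (- c * \<bar>x\<bar> powr \<alpha>)"
      by (simp add: algebra_simps power_add power2_eq_square)
    also have "\<dots> \<le> K1 + K2" by (intro add_mono K1 K2) auto
    finally show ?thesis
      by (simp add: field_simps add_pos_nonneg)
  qed
  with K1 K2 show ?thesis by (intro exI[of _ "K1 + K2"]) auto
qed

lemma integrable_power_exp_powr:
  fixes \<alpha> c :: real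
  assumes "\<alpha> > 0" and "c > 0"
  shows "integrable lborel (\<lambda>x::real. \<bar>x\<bar> ^ n * exp (- c * \<bar>x\<bar> powr \<alpha>))"
proof -
  obtain K where K: "K > 0" "\<And>x. \<bar>x\<bar> ^ n * exp (- c * \<bar>x\<bar> powr \<alpha>) \<le> K * inverse (1 + x\<^sup>2)"
    using power_exp_powr_le[OF assms] by blast
  have "integrable lborel (\<lambda>x::real. inverse (1 + x\<^sup>2))"
    using integrable_inverse_1_plus_square by (simp add: set_integrable_def)
  then have "integrable lborel (\<lambda>x::real. K * inverse (1 + x\<^sup>2))" by simp
  then show ?thesis
  proof (rule Bochner_Integration.integrable_bound)
    show "AE x in lborel. norm (\<bar>x\<bar> ^ n * exp (- c * \<bar>x\<bar> powr \<alpha>)) \<le> norm (K * inverse (1 + x\<^sup>2))"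
    proof (intro AE_I2)
      fix x :: real
      have "norm (\<bar>x\<bar> ^ n * exp (- c * \<bar>x\<bar> powr \<alpha>)) = \<bar>x\<bar> ^ n * exp (- c * \<bar>x\<bar> powr \<alpha>)" by simp
      also have "\<dots> \<le> K * inverse (1 + x\<^sup>2)" by (rule K)
      also have "\<dots> \<le> norm (K * inverse (1 + x\<^sup>2))" unfolding real_norm_def by (rule abs_ge_self)
      finally show "norm (\<bar>x\<bar> ^ n * exp (- c * \<bar>x\<bar> powr \<alpha>)) \<le> norm (K * inverse (1 + x\<^sup>2))" .
    qed
  qed measurable
qed

text \<open>The integrand vanishes at most at 0, so a zero integral would make the complement of a
  point a Lebesgue null set.\<close>

lemma integral_power_exp_powr_pos:
  fixes \<alpha> c :: real
  assumes "\<alpha> > 0" and "c > 0"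
  shows "(\<integral>x. \<bar>x\<bar> ^ n * exp (- c * \<bar>x\<bar> powr \<alpha>) \<partial>lborel) > 0"
proof -
  let ?f = "\<lambda>x::real. \<bar>x\<bar> ^ n * exp (- c * \<bar>x\<bar> powr \<alpha>)"
  have "(\<integral>x. ?f x \<partial>lborel) \<noteq> 0"
  proof
    assume "(\<integral>x. ?f x \<partial>lborel) = 0"
    then have "AE x in lborel. ?f x = 0"
      by (subst (asm) integral_nonneg_eq_0_iff_AE) (use integrable_power_exp_powr[OF assms] in auto)
    then have "AE x in lborel. (x::real) \<in> {0}" by eventually_elim auto
    then have "emeasure lborel (UNIV - {0::real}) = 0"
      by (subst (asm) AE_iff_measurable[OF _ refl]) (auto simp: Compl_eq_Diff_UNIV[symmetric] Compl_eq)
    moreover have "emeasure lborel (UNIV - {0::real}) = emeasure lborel (UNIV :: real set)"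
      by (subst emeasure_Diff) auto
    ultimately show False by simp
  qed
  moreover have "(\<integral>x. ?f x \<partial>lborel) \<ge> 0" by (intro integral_nonneg_AE) auto
  ultimately show ?thesis by linarith
qed

text \<open>By scaling. If \<open>Z\<close> and \<open>M\<close> are the mass and second moment of
  \<open>exp (- |x|^\<alpha>)\<close> and \<open>b = sqrt (M / Z)\<close>, then
  \<open>b / Z * exp (- |b x|^\<alpha>)\<close> has mass 1 and second moment
  \<open>(M / Z) / b^2 = 1\<close>. Hence \<open>a = b / Z\<close> and
  \<open>c = b powr \<alpha>\<close>.\<close>

lemma exp_powr_density_exists:
  fixes \<alpha> :: real
  assumes \<alpha>: "\<alpha> > 0"
  shows "\<exists>a>0. \<exists>c>0. (\<integral>x. a * exp (- c * \<bar>x\<bar> powr \<alpha>) \<partial>lborel) = 1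
    \<and> (\<integral>x. x\<^sup>2 * (a * exp (- c * \<bar>x\<bar> powr \<alpha>)) \<partial>lborel) = 1"
proof -
  define h where "h n x = \<bar>x\<bar> ^ n * exp (- 1 * \<bar>x\<bar> powr \<alpha>)" for n and x :: real
  define Z M where "Z = (\<integral>x. h 0 x \<partial>lborel)" and "M = (\<integral>x. h 2 x \<partial>lborel)"
  have Z: "Z > 0" and M: "M > 0"
    using integral_power_exp_powr_pos[OF \<alpha>, of 1 0] integral_power_exp_powr_pos[OF \<alpha>, of 1 2]
    by (simp_all add: Z_def M_def h_def)
  define b where "b = sqrt (M / Z)"
  have b: "b > 0" "b\<^sup>2 = M / Z" using Z M by (auto simp: b_def)
  have eq: "(b / Z) * exp (- (b powr \<alpha>) * \<bar>x\<bar> powr \<alpha>) = (b / Z) * h 0 (b * x)" for x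
    using b by (simp add: h_def powr_mult abs_mult)
  have eq2: "x\<^sup>2 * ((b / Z) * exp (- (b powr \<alpha>) * \<bar>x\<bar> powr \<alpha>)) = (b / Z) * (h 2 (b * x) / b\<^sup>2)" for x
    using b M Z by (simp add: h_def powr_mult abs_mult power_mult_distrib)
  have s: "(\<integral>x. h n (b * x) \<partial>lborel) = (\<integral>x. h n x \<partial>lborel) / b" for n
    using lborel_integral_real_affine[of b "h n" 0] b by simp
  have "(\<integral>x. (b / Z) * exp (- (b powr \<alpha>) * \<bar>x\<bar> powr \<alpha>) \<partial>lborel) = 1"
    unfolding eq using b Z by (simp add: s Z_def[symmetric])
  moreover have "(\<integral>x. x\<^sup>2 * ((b / Z) * exp (- (b powr \<alpha>) * \<bar>x\<bar> powr \<alpha>)) \<partial>lborel) = 1"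
  proof -
    have "(\<integral>x. (b / Z) * (h 2 (b * x) / b\<^sup>2) \<partial>lborel) = b / Z * ((M / b) / b\<^sup>2)"
      by (simp only: integral_mult_right_zero integral_divide_zero s M_def)
    also have "\<dots> = 1" unfolding b(2) using b(1) Z M by simp
    finally show ?thesis unfolding eq2 .
  qed
  moreover have "b / Z > 0" "b powr \<alpha> > 0" using b Z by auto
  ultimately show ?thesis by blast
qed

text \<open>Let \<open>(1 + e) powr \<alpha> = 3 / 2\<close>. Either \<open>v \<le> e * u\<close>,
  and the first term suffices, or \<open>u < v / e\<close>, and the second does. What matters about
  \<open>3 / 2\<close> is that it is below 2: the density times the squared likelihood ratio
  contains \<open>exp (c |x|^\<alpha> - 2 c |x - v|^\<alpha>)\<close>, which has to stay
  integrable.\<close>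

lemma powr_add_le:
  fixes \<alpha> :: real
  assumes \<alpha>: "\<alpha> > 0"
  shows "\<exists>C>0. \<forall>u\<ge>0. \<forall>v\<ge>0. (u + v) powr \<alpha> \<le> 3 / 2 * u powr \<alpha> + C * v powr \<alpha>"
proof -
  define e :: real where "e = (3 / 2) powr (1 / \<alpha>) - 1"
  have "(1::real) < (3 / 2) powr (1 / \<alpha>)" using \<alpha> by (intro gr_one_powr) auto
  then have e: "e > 0" by (simp add: e_def)
  have e1: "(1 + e) powr \<alpha> = 3 / 2" using \<alpha> by (simp add: e_def powr_powr)
  have e2: "1 / e + 1 > 0" using e by (intro add_pos_pos) auto
  define C where "C = (1 / e + 1) powr \<alpha>"
  have C: "C > 0" using e2 by (simp add: C_def)
  have "(u + v) powr \<alpha> \<le> 3 / 2 * u powr \<alpha> + C * v powr \<alpha>" if uv: "u \<ge> 0" "v \<ge> 0" for u v :: real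
  proof (cases "v \<le> e * u")
    case True
    then have "(u + v) powr \<alpha> \<le> ((1 + e) * u) powr \<alpha>"
      using uv \<alpha> by (intro powr_mono2) (auto simp: algebra_simps)
    also have "\<dots> = 3 / 2 * u powr \<alpha>" using uv e by (simp add: powr_mult e1)
    also have "\<dots> \<le> 3 / 2 * u powr \<alpha> + C * v powr \<alpha>" using C by simp
    finally show ?thesis .
  next
    case False
    then have "(u + v) powr \<alpha> \<le> ((1 / e + 1) * v) powr \<alpha>"
      using uv \<alpha> e by (intro powr_mono2) (auto simp: field_simps)
    also have "\<dots> = C * v powr \<alpha>" using uv e2 by (simp add: powr_mult C_def)
    also have "\<dots> \<le> 3 / 2 * u powr \<alpha> + C * v powr \<alpha>" by simp
    finally show ?thesis .
  qed
  with C show ?thesis by blast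
qed

text \<open>The noise class prescribes the prefactor 2, while the tail estimate yields some larger
  \<open>A\<close>. For an exponent \<open>e\<close> in (0,1] one has
  \<open>min 1 z \<le> z powr e\<close> when \<open>z > 0\<close>; with
  \<open>z = A * exp (- y)\<close> and \<open>e = ln 2 / ln A\<close> the factor \<open>A\<close>
  becomes 2 and only the rate in \<open>y\<close> suffers.\<close>

lemma mult_exp_neg_le:
  fixes A y :: real
  assumes A: "A \<ge> 2" and x: "x \<le> 1" "x \<le> A * exp (- y)"
  shows "x \<le> 2 * exp (- (ln 2 / ln A * y))"
proof -
  define e where "e = ln 2 / ln A"
  have lA: "ln A \<ge> ln 2" "ln A > 0" using A by auto
  have e: "e > 0" "e \<le> 1" using lA by (auto simp: e_def)
  show ?thesis
  proof (cases "A * exp (- y) \<le> 1")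
    case True
    have "A * exp (- y) = exp (ln A - y)" using A by (simp add: exp_diff exp_minus field_simps)
    then have l: "ln A - y \<le> 0" using True by simp
    have "x \<le> exp (ln A - y)" using x \<open>A * exp (- y) = _\<close> by simp
    also have "ln A - y \<le> e * (ln A - y)" using l e mult_right_mono_neg[of e 1 "ln A - y"] by simp
    also have "e * (ln A - y) = ln 2 - e * y" using lA by (simp add: e_def right_diff_distrib)
    finally show ?thesis by (simp add: e_def exp_diff exp_minus field_simps)
  next
    case False
    have "A * exp (- y) = exp (ln A - y)" using A by (simp add: exp_diff exp_minus field_simps)
    then have "ln A - y > 0" using False by simp
    then have "e * (ln A - y) > 0" using e by simp
    moreover have "e * (ln A - y) = ln 2 - e * y" using lA by (simp add: e_def right_diff_distrib)
    ultimately have "1 \<le> exp (ln 2 - e * y)" by simp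
    then have "1 \<le> 2 * exp (- (e * y))" by (simp add: exp_diff exp_minus field_simps)
    then show ?thesis using x by (simp add: e_def)
  qed
qed

section \<open>The exponential-power law as a member of the noise class\<close>

definition exp_power_noise :: "real \<Rightarrow> real \<Rightarrow> real \<Rightarrow> real measure" where
  "exp_power_noise \<alpha> a c = density lborel (\<lambda>x. ennreal (a * exp (- c * \<bar>x\<bar> powr \<alpha>)))"

lemma sets_exp_power_noise [simp, measurable_cong]: "sets (exp_power_noise \<alpha> a c) = sets borel"
  by (simp add: exp_power_noise_def)

lemma space_exp_power_noise [simp]: "space (exp_power_noise \<alpha> a c) = UNIV"
  by (simp add: exp_power_noise_def)

lemma nn_integral_exp_power_noise:
  assumes "f \<in> borel_measurable borel"
  shows "(\<integral>\<^sup>+x. f x \<partial>exp_power_noise \<alpha> a c)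
    = (\<integral>\<^sup>+x. ennreal (a * exp (- c * \<bar>x\<bar> powr \<alpha>)) * f x \<partial>lborel)"
  using assms unfolding exp_power_noise_def by (subst nn_integral_density) auto

lemma prob_space_exp_power_noise:
  assumes "\<alpha> > 0" "a > 0" "c > 0"
    and "(\<integral>x. a * exp (- c * \<bar>x\<bar> powr \<alpha>) \<partial>lborel) = 1"
  shows "prob_space (exp_power_noise \<alpha> a c)"
proof
  have "emeasure (exp_power_noise \<alpha> a c) UNIV
      = (\<integral>\<^sup>+x. ennreal (a * exp (- c * \<bar>x\<bar> powr \<alpha>)) \<partial>lborel)"
    by (simp add: exp_power_noise_def emeasure_density)
  also have "\<dots> = ennreal (\<integral>x. a * exp (- c * \<bar>x\<bar> powr \<alpha>) \<partial>lborel)"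
    using assms integrable_power_exp_powr[of \<alpha> c 0] by (intro nn_integral_eq_integral) auto
  finally show "emeasure (exp_power_noise \<alpha> a c) (space (exp_power_noise \<alpha> a c)) = 1"
    using assms(4) by simp
qed

lemma distr_uminus_exp_power_noise:
  "distr (exp_power_noise \<alpha> a c) borel uminus = exp_power_noise \<alpha> a c"
proof (rule measure_eqI)
  fix X assume "X \<in> sets (distr (exp_power_noise \<alpha> a c) borel uminus)"
  then have [measurable]: "X \<in> sets borel" by simp
  have "emeasure (distr (exp_power_noise \<alpha> a c) borel uminus) X
      = (\<integral>\<^sup>+x. indicator X (- x) \<partial>exp_power_noise \<alpha> a c)"
    by (subst nn_integral_indicator[symmetric], simp, subst nn_integral_distr) auto
  also have "\<dots> = (\<integral>\<^sup>+x. ennreal (a * exp (- c * \<bar>x\<bar> powr \<alpha>)) * indicator X (- x) \<partial>lborel)"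
    by (subst nn_integral_exp_power_noise) auto
  also have "\<dots> = (\<integral>\<^sup>+x. ennreal (a * exp (- c * \<bar>x\<bar> powr \<alpha>)) * indicator X x \<partial>lborel)"
    by (subst (2) nn_integral_real_affine[where c = "-1" and t = 0]) auto
  also have "\<dots> = emeasure (exp_power_noise \<alpha> a c) X"
    by (simp add: exp_power_noise_def emeasure_density)
  finally show "emeasure (distr (exp_power_noise \<alpha> a c) borel uminus) X
      = emeasure (exp_power_noise \<alpha> a c) X" .
qed simp

text \<open>Half of the exponent is spent on the tail: for \<open>|x| \<ge> t\<close>,
  \<open>exp (- c |x|^\<alpha>)\<close> is at most
  \<open>exp (- c/2 t^\<alpha>) * exp (- c/2 |x|^\<alpha>)\<close>, and the second factor is still
  integrable.\<close>

lemma exp_power_noise_tail: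
  fixes \<alpha> a c t :: real
  assumes \<alpha>: "\<alpha> > 0" and c: "c > 0" and a: "a > 0" and t: "t \<ge> 0"
    and total: "(\<integral>x. a * exp (- c * \<bar>x\<bar> powr \<alpha>) \<partial>lborel) = 1"
  shows "measure (exp_power_noise \<alpha> a c) {w. t \<le> \<bar>w\<bar>}
    \<le> (\<integral>x. a * exp (- (c / 2) * \<bar>x\<bar> powr \<alpha>) \<partial>lborel) * exp (- (c / 2) * t powr \<alpha>)"
proof -
  interpret prob_space "exp_power_noise \<alpha> a c"
    by (rule prob_space_exp_power_noise) (use assms in auto)
  let ?B = "\<integral>x. a * exp (- (c / 2) * \<bar>x\<bar> powr \<alpha>) \<partial>lborel"
  have B: "(\<integral>\<^sup>+x. ennreal (a * exp (- (c / 2) * \<bar>x\<bar> powr \<alpha>)) \<partial>lborel) = ennreal ?B"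
    using a c \<alpha> integrable_power_exp_powr[of \<alpha> "c / 2" 0] by (intro nn_integral_eq_integral) auto
  have "emeasure (exp_power_noise \<alpha> a c) {w. t \<le> \<bar>w\<bar>}
      = (\<integral>\<^sup>+x. indicator {w. t \<le> \<bar>w\<bar>} x \<partial>exp_power_noise \<alpha> a c)"
    by (rule nn_integral_indicator[symmetric]) simp
  also have "\<dots> = (\<integral>\<^sup>+x. ennreal (a * exp (- c * \<bar>x\<bar> powr \<alpha>)) * indicator {w. t \<le> \<bar>w\<bar>} x \<partial>lborel)"
    by (rule nn_integral_exp_power_noise) measurable
  also have "\<dots> \<le> (\<integral>\<^sup>+x. ennreal (exp (- (c / 2) * t powr \<alpha>)) *
      ennreal (a * exp (- (c / 2) * \<bar>x\<bar> powr \<alpha>)) \<partial>lborel)"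
  proof (intro nn_integral_mono)
    fix x :: real
    show "ennreal (a * exp (- c * \<bar>x\<bar> powr \<alpha>)) * indicator {w. t \<le> \<bar>w\<bar>} x
        \<le> ennreal (exp (- (c / 2) * t powr \<alpha>)) * ennreal (a * exp (- (c / 2) * \<bar>x\<bar> powr \<alpha>))"
    proof (cases "t \<le> \<bar>x\<bar>")
      case True
      then have "t powr \<alpha> \<le> \<bar>x\<bar> powr \<alpha>" using t \<alpha> by (intro powr_mono2) auto
      then have "c * t powr \<alpha> \<le> c * \<bar>x\<bar> powr \<alpha>" using c by simp
      then have "exp (- c * \<bar>x\<bar> powr \<alpha>) \<le> exp (- (c / 2) * t powr \<alpha>) * exp (- (c / 2) * \<bar>x\<bar> powr \<alpha>)"
        by (simp add: exp_add[symmetric])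
      then have "a * exp (- c * \<bar>x\<bar> powr \<alpha>)
          \<le> exp (- (c / 2) * t powr \<alpha>) * (a * exp (- (c / 2) * \<bar>x\<bar> powr \<alpha>))"
        using a by (simp add: mult.left_commute)
      then show ?thesis using True a by (simp add: ennreal_mult'[symmetric] ennreal_leI)
    qed simp
  qed
  also have "\<dots> = ennreal (exp (- (c / 2) * t powr \<alpha>)) * ennreal ?B"
    by (subst nn_integral_cmult) (simp_all only: B, measurable)
  finally have "ennreal (prob {w. t \<le> \<bar>w\<bar>}) \<le> ennreal (exp (- (c / 2) * t powr \<alpha>) * ?B)"
    by (simp add: emeasure_eq_measure ennreal_mult')
  moreover have "?B \<ge> 0" using a by (intro integral_nonneg_AE) auto
  ultimately show ?thesis by (simp add: mult.commute)
qed

lemma exp_power_noise_in_noise_class: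
  fixes \<alpha> :: real
  assumes \<alpha>: "\<alpha> > 0" and a: "a > 0" and c: "c > 0"
    and total: "(\<integral>x. a * exp (- c * \<bar>x\<bar> powr \<alpha>) \<partial>lborel) = 1"
    and var: "(\<integral>x. x\<^sup>2 * (a * exp (- c * \<bar>x\<bar> powr \<alpha>)) \<partial>lborel) = 1"
  shows "\<exists>\<tau>\<^sub>0>0. \<forall>\<tau>\<ge>\<tau>\<^sub>0. exp_power_noise \<alpha> a c \<in> noise_class \<alpha> \<tau>"
proof -
  let ?P = "exp_power_noise \<alpha> a c"
  interpret prob_space ?P
    by (rule prob_space_exp_power_noise) (use assms in auto)
  \<comment> \<open>The maximum with 2 ensures \<open>ln 2 / ln A \<le> 1\<close>, as the
    interpolation of the prefactor requires.\<close>
  define A where "A = max 2 (\<integral>x. a * exp (- (c / 2) * \<bar>x\<bar> powr \<alpha>) \<partial>lborel)"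
  define e where "e = ln 2 / ln A"
  have A: "A \<ge> 2" by (simp add: A_def)
  then have e: "e > 0" by (simp add: e_def)
  \<comment> \<open>Chosen so that \<open>2 * (t / \<tau>0) powr \<alpha>\<close> equals
    \<open>e * (c / 2) * t powr \<alpha>\<close>, the rate left after the prefactor has become 2. A
    larger \<open>\<tau>\<close> only weakens the tail condition.\<close>
  define \<tau>0 where "\<tau>0 = (4 / (e * c)) powr (1 / \<alpha>)"
  have \<tau>0: "\<tau>0 > 0" "\<tau>0 powr \<alpha> = 4 / (e * c)"
    using e c \<alpha> by (auto simp: \<tau>0_def powr_powr)
  have int: "integrable ?P (\<lambda>w. w\<^sup>2)"
    unfolding exp_power_noise_def using a c \<alpha> integrable_power_exp_powr[of \<alpha> c 2]
    by (subst integrable_density) (auto simp: mult_ac)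
  have "(\<integral>w. w\<^sup>2 \<partial>?P) = 1"
    unfolding exp_power_noise_def using a var
    by (subst integral_density) (auto simp: mult_ac)
  moreover have "measure ?P {w. \<bar>w\<bar> \<ge> t} \<le> 2 * exp (- 2 * (t / \<tau>) powr \<alpha>)"
    if \<tau>: "\<tau> \<ge> \<tau>0" and t: "t \<ge> 0" for \<tau> t
  proof -
    define y where "y = c / 2 * t powr \<alpha>"
    have "measure ?P {w. t \<le> \<bar>w\<bar>}
        \<le> (\<integral>x. a * exp (- (c / 2) * \<bar>x\<bar> powr \<alpha>) \<partial>lborel) * exp (- y)"
      using exp_power_noise_tail[OF \<alpha> c a t total] by (simp add: y_def)
    also have "\<dots> \<le> A * exp (- y)" by (intro mult_right_mono) (auto simp: A_def)
    finally have "measure ?P {w. t \<le> \<bar>w\<bar>} \<le> 2 * exp (- (e * y))"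
      unfolding e_def by (intro mult_exp_neg_le A) auto
    also have "2 * (t / \<tau>) powr \<alpha> \<le> e * y"
    proof -
      have "2 * (t / \<tau>) powr \<alpha> \<le> 2 * (t / \<tau>0) powr \<alpha>"
        using \<tau> \<tau>0 t \<alpha> by (intro mult_left_mono powr_mono2 divide_left_mono) auto
      also have "\<dots> = e * y" using \<tau>0 t e c by (simp add: powr_divide y_def)
      finally show ?thesis .
    qed
    then have "2 * exp (- (e * y)) \<le> 2 * exp (- 2 * (t / \<tau>) powr \<alpha>)" by simp
    finally show ?thesis .
  qed
  ultimately have "\<forall>\<tau>\<ge>\<tau>0. ?P \<in> noise_class \<alpha> \<tau>"
    using int by (auto simp: noise_class_def prob_space_axioms distr_uminus_exp_power_noise)
  with \<tau>0 show ?thesis by blast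
qed

section \<open>Likelihood ratios of shifted noise\<close>

text \<open>The Radon-Nikodym derivative of the law of \<open>v + x\<close> with respect to that of
  \<open>x\<close> under exponential-power noise; the normalising factor \<open>a\<close>
  cancels.\<close>

definition shift_ratio :: "real \<Rightarrow> real \<Rightarrow> real \<Rightarrow> real \<Rightarrow> real" where
  "shift_ratio \<alpha> c v x = exp (c * \<bar>x\<bar> powr \<alpha> - c * \<bar>x - v\<bar> powr \<alpha>)"

lemma shift_ratio_pos: "shift_ratio \<alpha> c v x > 0"
  by (simp add: shift_ratio_def)

lemma shift_ratio_measurable [measurable]: "shift_ratio \<alpha> c v \<in> borel_measurable borel"
  unfolding shift_ratio_def by measurable

lemma distr_shift_exp_power_noise:
  assumes a: "a > 0"
  shows "distr (exp_power_noise \<alpha> a c) borel (\<lambda>x. v + x)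
    = density (exp_power_noise \<alpha> a c) (\<lambda>x. ennreal (shift_ratio \<alpha> c v x))"
proof (rule measure_eqI)
  fix X assume "X \<in> sets (distr (exp_power_noise \<alpha> a c) borel (\<lambda>x. v + x))"
  then have [measurable]: "X \<in> sets borel" by simp
  have "emeasure (distr (exp_power_noise \<alpha> a c) borel (\<lambda>x. v + x)) X
      = (\<integral>\<^sup>+x. indicator X (v + x) \<partial>exp_power_noise \<alpha> a c)"
    by (subst nn_integral_indicator[symmetric], simp, subst nn_integral_distr) auto
  also have "\<dots> = (\<integral>\<^sup>+x. ennreal (a * exp (- c * \<bar>x\<bar> powr \<alpha>)) * indicator X (v + x) \<partial>lborel)"
    by (subst nn_integral_exp_power_noise) auto
  also have "\<dots> = (\<integral>\<^sup>+x. ennreal (a * exp (- c * \<bar>x - v\<bar> powr \<alpha>)) * indicator X x \<partial>lborel)"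
    by (subst (2) nn_integral_real_affine[where c = 1 and t = v]) auto
  also have "\<dots> = (\<integral>\<^sup>+x. ennreal (a * exp (- c * \<bar>x\<bar> powr \<alpha>)) *
      (ennreal (shift_ratio \<alpha> c v x) * indicator X x) \<partial>lborel)"
  proof (intro nn_integral_cong)
    fix x :: real
    have "a * exp (- c * \<bar>x - v\<bar> powr \<alpha>) = a * exp (- c * \<bar>x\<bar> powr \<alpha>) * shift_ratio \<alpha> c v x"
      by (simp add: shift_ratio_def mult.assoc exp_add[symmetric])
    then show "ennreal (a * exp (- c * \<bar>x - v\<bar> powr \<alpha>)) * indicator X x =
      ennreal (a * exp (- c * \<bar>x\<bar> powr \<alpha>)) * (ennreal (shift_ratio \<alpha> c v x) * indicator X x)"
      using a by (simp add: ennreal_mult' mult.assoc)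
  qed
  also have "\<dots> = (\<integral>\<^sup>+x. ennreal (shift_ratio \<alpha> c v x) * indicator X x \<partial>exp_power_noise \<alpha> a c)"
    by (subst nn_integral_exp_power_noise) auto
  also have "\<dots> = emeasure (density (exp_power_noise \<alpha> a c) (\<lambda>x. ennreal (shift_ratio \<alpha> c v x))) X"
    by (subst emeasure_density) auto
  finally show "emeasure (distr (exp_power_noise \<alpha> a c) borel (\<lambda>x. v + x)) X
      = emeasure (density (exp_power_noise \<alpha> a c) (\<lambda>x. ennreal (shift_ratio \<alpha> c v x))) X" .
qed simp

text \<open>This is one plus the chi-square divergence of a shift. Applying \<open>C\<close> to
  \<open>|x| \<le> |x - v| + |v|\<close> turns the exponent
  \<open>c |x|^\<alpha> - 2 c |x - v|^\<alpha>\<close> into at most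
  \<open>C c |v|^\<alpha> - c/2 |x - v|^\<alpha>\<close>, and translation invariance removes
  \<open>v\<close> from the remaining integral.\<close>

lemma nn_integral_shift_ratio_square_le:
  fixes \<alpha> a c C v :: real
  assumes \<alpha>: "\<alpha> > 0" and a: "a > 0" and c: "c > 0"
    and C: "\<And>u v. u \<ge> 0 \<Longrightarrow> v \<ge> 0 \<Longrightarrow> (u + v) powr \<alpha> \<le> 3 / 2 * u powr \<alpha> + C * v powr \<alpha>"
  shows "(\<integral>\<^sup>+x. ennreal ((shift_ratio \<alpha> c v x)\<^sup>2) \<partial>exp_power_noise \<alpha> a c)
    \<le> ennreal ((\<integral>x. a * exp (- (c / 2) * \<bar>x\<bar> powr \<alpha>) \<partial>lborel) * exp (C * c * \<bar>v\<bar> powr \<alpha>))"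
proof -
  let ?B = "\<integral>x. a * exp (- (c / 2) * \<bar>x\<bar> powr \<alpha>) \<partial>lborel"
  have B: "(\<integral>\<^sup>+x. ennreal (a * exp (- (c / 2) * \<bar>x\<bar> powr \<alpha>)) \<partial>lborel) = ennreal ?B"
    using a c \<alpha> integrable_power_exp_powr[of \<alpha> "c / 2" 0] by (intro nn_integral_eq_integral) auto
  have "(\<integral>\<^sup>+x. ennreal ((shift_ratio \<alpha> c v x)\<^sup>2) \<partial>exp_power_noise \<alpha> a c)
      = (\<integral>\<^sup>+x. ennreal (a * exp (- c * \<bar>x\<bar> powr \<alpha>)) * ennreal ((shift_ratio \<alpha> c v x)\<^sup>2) \<partial>lborel)"
    by (subst nn_integral_exp_power_noise) auto
  also have "\<dots> \<le> (\<integral>\<^sup>+x. ennreal (exp (C * c * \<bar>v\<bar> powr \<alpha>)) *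
      ennreal (a * exp (- (c / 2) * \<bar>x - v\<bar> powr \<alpha>)) \<partial>lborel)"
  proof (intro nn_integral_mono)
    fix x :: real
    have "\<bar>x\<bar> powr \<alpha> \<le> (\<bar>x - v\<bar> + \<bar>v\<bar>) powr \<alpha>" using \<alpha> by (intro powr_mono2) auto
    also have "\<dots> \<le> 3 / 2 * \<bar>x - v\<bar> powr \<alpha> + C * \<bar>v\<bar> powr \<alpha>" by (intro C) auto
    finally have "c * \<bar>x\<bar> powr \<alpha> \<le> c * (3 / 2 * \<bar>x - v\<bar> powr \<alpha> + C * \<bar>v\<bar> powr \<alpha>)"
      using c by simp
    then have "exp (- c * \<bar>x\<bar> powr \<alpha>) * (shift_ratio \<alpha> c v x)\<^sup>2
        \<le> exp (C * c * \<bar>v\<bar> powr \<alpha>) * exp (- (c / 2) * \<bar>x - v\<bar> powr \<alpha>)"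
      by (simp add: shift_ratio_def power2_eq_square exp_add[symmetric] algebra_simps)
    then have "a * (exp (- c * \<bar>x\<bar> powr \<alpha>) * (shift_ratio \<alpha> c v x)\<^sup>2)
        \<le> a * (exp (C * c * \<bar>v\<bar> powr \<alpha>) * exp (- (c / 2) * \<bar>x - v\<bar> powr \<alpha>))"
      using a by simp
    then show "ennreal (a * exp (- c * \<bar>x\<bar> powr \<alpha>)) * ennreal ((shift_ratio \<alpha> c v x)\<^sup>2)
        \<le> ennreal (exp (C * c * \<bar>v\<bar> powr \<alpha>)) * ennreal (a * exp (- (c / 2) * \<bar>x - v\<bar> powr \<alpha>))"
      using a by (simp add: ennreal_mult'[symmetric] ennreal_leI mult_ac)
  qed
  also have "\<dots> = ennreal (exp (C * c * \<bar>v\<bar> powr \<alpha>)) *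
      (\<integral>\<^sup>+x. ennreal (a * exp (- (c / 2) * \<bar>x - v\<bar> powr \<alpha>)) \<partial>lborel)"
    by (rule nn_integral_cmult) measurable
  also have "(\<integral>\<^sup>+x. ennreal (a * exp (- (c / 2) * \<bar>x - v\<bar> powr \<alpha>)) \<partial>lborel) = ennreal ?B"
    by (subst nn_integral_real_affine[where c = 1 and t = v]) (use B in simp_all)
  finally show ?thesis using a by (simp add: ennreal_mult'[symmetric] mult.commute)
qed

section \<open>Product measures\<close>

text \<open>The locale \<open>product_prob_space\<close> asks for a probability measure at every
  index of the type, whereas only those in \<open>I\<close> are controlled. A point mass elsewhere
  fills the gap without changing the product over \<open>I\<close>.\<close>

lemma product_prob_space_extension:
  assumes "\<And>i. i \<in> I \<Longrightarrow> prob_space (M i)"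
  obtains M' where "product_prob_space M'" "\<And>i. i \<in> I \<Longrightarrow> M' i = M i" "PiM I M' = PiM I M"
proof -
  define M' where "M' i = (if i \<in> I then M i else return (count_space UNIV) undefined)" for i
  have "product_prob_space M'"
    by (rule product_prob_spaceI) (auto simp: M'_def intro!: prob_space_return assms)
  moreover have "PiM I M' = PiM I M" by (intro PiM_cong) (auto simp: M'_def)
  ultimately show thesis using that[of M'] by (auto simp: M'_def)
qed

text \<open>Both sides agree on rectangles, which determine a finite product. The restriction to
  \<open>I\<close> is there because points of a product space are extensional functions.\<close>

lemma distr_PiM_coordinatewise:
  assumes fin: "finite I"
    and M: "\<And>i. i \<in> I \<Longrightarrow> prob_space (M i)"
    and f: "\<And>i. i \<in> I \<Longrightarrow> f i \<in> measurable (M i) (M' i)"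
  shows "distr (PiM I M) (PiM I M') (\<lambda>x. \<lambda>i\<in>I. f i (x i)) = PiM I (\<lambda>i. distr (M i) (M' i) (f i))"
proof -
  let ?N = "\<lambda>i. distr (M i) (M' i) (f i)"
  have pN: "prob_space (?N i)" if "i \<in> I" for i
    using prob_space.prob_space_distr[OF M[OF that] f[OF that]] .
  obtain P where P: "product_prob_space P" "\<And>i. i \<in> I \<Longrightarrow> P i = M i" "PiM I P = PiM I M"
    using product_prob_space_extension[of I M] M by blast
  obtain N where N: "product_prob_space N" "\<And>i. i \<in> I \<Longrightarrow> N i = ?N i" "PiM I N = PiM I ?N"
    using product_prob_space_extension[of I ?N] pN by blast
  interpret P: product_prob_space P by (rule P)
  interpret N: product_prob_space N by (rule N)
  let ?F = "\<lambda>x. \<lambda>i\<in>I. f i (x i)"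
  have meas: "?F \<in> measurable (PiM I P) (PiM I M')"
  proof (rule measurable_restrict)
    fix i assume i: "i \<in> I"
    show "(\<lambda>x. f i (x i)) \<in> measurable (PiM I P) (M' i)"
      using f[OF i] P(2)[OF i] by (intro measurable_compose[OF measurable_component_singleton[OF i]]) simp
  qed
  have sets: "sets (PiM I M') = sets (PiM I N)"
    by (intro sets_PiM_cong) (auto simp: N)
  have "distr (PiM I P) (PiM I M') ?F = PiM I N"
  proof (rule N.PiM_eqI[OF fin])
    show "sets (distr (PiM I P) (PiM I M') ?F) = sets (PiM I N)" by (simp add: sets)
  next
    fix A assume A: "\<And>i. i \<in> I \<Longrightarrow> A i \<in> sets (N i)"
    have A': "A i \<in> sets (M' i)" if "i \<in> I" for i using A[OF that] N(2)[OF that] by simp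
    have sp: "f i x \<in> space (M' i)" if "i \<in> I" "x \<in> space (P i)" for i x
      using measurable_space[OF f] P(2) that by auto
    have "emeasure (distr (PiM I P) (PiM I M') ?F) (Pi\<^sub>E I A)
        = emeasure (PiM I P) (?F -` Pi\<^sub>E I A \<inter> space (PiM I P))"
      by (intro emeasure_distr meas sets_PiM_I_finite fin A')
    also have "?F -` Pi\<^sub>E I A \<inter> space (PiM I P) = Pi\<^sub>E I (\<lambda>i. f i -` A i \<inter> space (P i))"
      by (auto simp: space_PiM PiE_def Pi_def extensional_def)
    also have "emeasure (PiM I P) \<dots> = (\<Prod>i\<in>I. emeasure (P i) (f i -` A i \<inter> space (P i)))"
      using A' f P(2) by (intro P.emeasure_PiM fin) (auto intro!: measurable_sets)
    also have "\<dots> = (\<Prod>i\<in>I. emeasure (N i) (A i))"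
    proof (intro prod.cong refl)
      fix i assume i: "i \<in> I"
      show "emeasure (P i) (f i -` A i \<inter> space (P i)) = emeasure (N i) (A i)"
        using emeasure_distr[OF f[OF i] A'[OF i]] by (simp add: P(2)[OF i] N(2)[OF i])
    qed
    finally show "emeasure (distr (PiM I P) (PiM I M') ?F) (Pi\<^sub>E I A) = (\<Prod>i\<in>I. emeasure (N i) (A i))" .
  qed
  then show ?thesis by (simp add: P N)
qed

text \<open>On a rectangle the indicator factors over the coordinates, so the integral of the
  product density does too, and rectangles determine the measure. Unit mass of every factor makes
  the right side a product of probability measures.\<close>

lemma density_PiM:
  fixes g :: "'i \<Rightarrow> 'a \<Rightarrow> ennreal"
  assumes fin: "finite I"
    and M: "\<And>i. i \<in> I \<Longrightarrow> prob_space (M i)"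
    and g: "\<And>i. i \<in> I \<Longrightarrow> g i \<in> borel_measurable (M i)"
    and gM: "\<And>i. i \<in> I \<Longrightarrow> prob_space (density (M i) (g i))"
  shows "density (PiM I M) (\<lambda>x. \<Prod>i\<in>I. g i (x i)) = PiM I (\<lambda>i. density (M i) (g i))"
proof -
  let ?N = "\<lambda>i. density (M i) (g i)"
  obtain P where P: "product_prob_space P" "\<And>i. i \<in> I \<Longrightarrow> P i = M i" "PiM I P = PiM I M"
    using product_prob_space_extension[of I M] M by blast
  obtain N where N: "product_prob_space N" "\<And>i. i \<in> I \<Longrightarrow> N i = ?N i" "PiM I N = PiM I ?N"
    using product_prob_space_extension[of I ?N] gM by blast
  interpret P: product_prob_space P by (rule P)
  interpret N: product_prob_space N by (rule N)
  have gP: "g i \<in> borel_measurable (P i)" if "i \<in> I" for i using g[OF that] P(2)[OF that] by simp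
  have meas: "(\<lambda>x. \<Prod>i\<in>I. g i (x i)) \<in> borel_measurable (PiM I P)"
  proof (rule borel_measurable_prod_ennreal)
    fix i assume i: "i \<in> I"
    show "(\<lambda>x. g i (x i)) \<in> borel_measurable (PiM I P)"
      using gP[OF i] by (rule measurable_compose[OF measurable_component_singleton[OF i]])
  qed
  have "density (PiM I P) (\<lambda>x. \<Prod>i\<in>I. g i (x i)) = PiM I N"
  proof (rule N.PiM_eqI[OF fin])
    show "sets (density (PiM I P) (\<lambda>x. \<Prod>i\<in>I. g i (x i))) = sets (PiM I N)"
      by (simp, intro sets_PiM_cong) (auto simp: N P)
  next
    fix A assume A: "\<And>i. i \<in> I \<Longrightarrow> A i \<in> sets (N i)"
    have A': "A i \<in> sets (P i)" if "i \<in> I" for i using A[OF that] N(2)[OF that] P(2)[OF that] by simp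
    have "emeasure (density (PiM I P) (\<lambda>x. \<Prod>i\<in>I. g i (x i))) (Pi\<^sub>E I A)
        = (\<integral>\<^sup>+x. (\<Prod>i\<in>I. g i (x i)) * indicator (Pi\<^sub>E I A) x \<partial>PiM I P)"
      by (intro emeasure_density meas sets_PiM_I_finite fin A')
    also have "\<dots> = (\<integral>\<^sup>+x. (\<Prod>i\<in>I. g i (x i) * indicator (A i) (x i)) \<partial>PiM I P)"
    proof (intro nn_integral_cong)
      fix x assume x: "x \<in> space (PiM I P)"
      have "indicator (Pi\<^sub>E I A) x = (\<Prod>i\<in>I. indicator (A i) (x i) :: ennreal)"
      proof (cases "x \<in> Pi\<^sub>E I A")
        case False
        with x obtain i where "i \<in> I" "x i \<notin> A i" by (auto simp: space_PiM PiE_def)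
        then have "(\<Prod>i\<in>I. indicator (A i) (x i) :: ennreal) = 0"
          using fin by (intro prod_zero bexI[of _ i]) auto
        then show ?thesis using False by simp
      qed (auto simp: PiE_def Pi_def)
      then show "(\<Prod>i\<in>I. g i (x i)) * indicator (Pi\<^sub>E I A) x
          = (\<Prod>i\<in>I. g i (x i) * indicator (A i) (x i))"
        by (simp add: prod.distrib)
    qed
    also have "\<dots> = (\<Prod>i\<in>I. \<integral>\<^sup>+x. g i x * indicator (A i) x \<partial>P i)"
      using gP A' by (intro P.product_nn_integral_prod fin borel_measurable_times_ennreal) auto
    also have "\<dots> = (\<Prod>i\<in>I. emeasure (N i) (A i))"
    proof (intro prod.cong refl)
      fix i assume i: "i \<in> I"
      show "(\<integral>\<^sup>+x. g i x * indicator (A i) x \<partial>P i) = emeasure (N i) (A i)"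
        using emeasure_density[OF gP[OF i] A'[OF i]] by (simp add: P(2)[OF i] N(2)[OF i])
    qed
    finally show "emeasure (density (PiM I P) (\<lambda>x. \<Prod>i\<in>I. g i (x i))) (Pi\<^sub>E I A)
      = (\<Prod>i\<in>I. emeasure (N i) (A i))" .
  qed
  then show ?thesis by (simp add: P N)
qed

text \<open>An odd function of a symmetric variable has mean zero, so by independence the cross
  terms of the expanded square vanish and only the individual second moments remain.\<close>

lemma nn_integral_PiM_odd_sum_square_le:
  fixes h :: "'i \<Rightarrow> real \<Rightarrow> real"
  assumes fin: "finite I" and J: "J \<subseteq> I"
    and P: "\<And>i. i \<in> I \<Longrightarrow> prob_space (P i)"
    and sets: "\<And>i. i \<in> I \<Longrightarrow> sets (P i) = sets borel"
    and sym: "\<And>i. i \<in> I \<Longrightarrow> distr (P i) borel uminus = P i"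
    and h: "\<And>i. i \<in> J \<Longrightarrow> h i \<in> borel_measurable borel"
    and odd: "\<And>i x. i \<in> J \<Longrightarrow> h i (- x) = - h i x"
    and sq: "\<And>i. i \<in> J \<Longrightarrow> (\<integral>\<^sup>+x. ennreal ((h i x)\<^sup>2) \<partial>P i) \<le> ennreal (b i)"
    and b: "\<And>i. i \<in> J \<Longrightarrow> b i \<ge> 0"
  shows "(\<integral>\<^sup>+x. ennreal ((\<Sum>i\<in>J. h i (x i))\<^sup>2) \<partial>PiM I P) \<le> ennreal (\<Sum>i\<in>J. b i)"
proof -
  obtain M where M: "product_prob_space M" "\<And>i. i \<in> I \<Longrightarrow> M i = P i" "PiM I M = PiM I P"
    using product_prob_space_extension[of I P] P by blast
  interpret M: product_prob_space M by (rule M)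
  interpret PI: prob_space "PiM I M" by (rule M.P.prob_space_axioms)
  have hM: "h i \<in> borel_measurable (M i)" if "i \<in> J" for i
    using h[OF that] sets[of i] M(2)[of i] J that by (subst measurable_cong_sets[where N = borel]) auto
  have sqi: "integrable (M i) (\<lambda>x. (h i x)\<^sup>2)" if i: "i \<in> J" for i
  proof (rule integrableI_bounded)
    have "(\<integral>\<^sup>+x. ennreal (norm ((h i x)\<^sup>2)) \<partial>M i) \<le> ennreal (b i)"
      using sq[OF i] M(2)[of i] J i by auto
    then show "(\<integral>\<^sup>+x. ennreal (norm ((h i x)\<^sup>2)) \<partial>M i) < \<infinity>"
      by (rule le_less_trans) simp
  qed (use hM[OF i] in measurable)
  have inti: "integrable (M i) (h i)" if i: "i \<in> J" for i
    by (rule M.M.square_integrable_imp_integrable[OF hM[OF i] sqi[OF i]])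
  have zero: "(\<integral>x. h i x \<partial>M i) = 0" if i: "i \<in> J" for i
  proof -
    have Pi: "M i = P i" "sets (P i) = sets borel" "distr (P i) borel uminus = P i" using i J M sets sym by auto
    have "(\<integral>x. h i x \<partial>P i) = (\<integral>x. h i x \<partial>distr (P i) borel uminus)" by (simp add: Pi)
    also have "\<dots> = (\<integral>x. h i (- x) \<partial>P i)"
      using Pi h[OF i] by (intro integral_distr) (auto simp: measurable_cong_sets[OF Pi(2)])
    also have "\<dots> = - (\<integral>x. h i x \<partial>P i)" by (simp add: odd[OF i])
    finally show ?thesis by (simp add: Pi)
  qed
  have finJ: "finite J" using fin J finite_subset by blast
  have prod: "integrable (PiM I M) (\<lambda>x. h i (x i) * h j (x j)) \<and>
      (\<integral>x. h i (x i) * h j (x j) \<partial>PiM I M) = (if i = j then \<integral>x. (h i x)\<^sup>2 \<partial>M i else 0)"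
    if i: "i \<in> J" and j: "j \<in> J" for i j
  proof -
    \<comment> \<open>Writes \<open>h i (x i) * h j (x j)\<close> as a product over all coordinates
      so that the integral factors; for \<open>i = j\<close> the two factors merge into a
      square.\<close>
    define g where "g k = (if k = i \<and> k = j then (\<lambda>x. (h i x)\<^sup>2) else if k = i then h i
        else if k = j then h j else (\<lambda>_. 1))" for k
    have gi: "integrable (M k) (g k)" for k
      using sqi inti i j by (auto simp: g_def)
    have eq: "(\<Prod>k\<in>I. g k (x k)) = h i (x i) * h j (x j)" for x
    proof -
      have "(\<Prod>k\<in>I. g k (x k)) = (\<Prod>k\<in>{i, j}. g k (x k))"
        using fin i j J by (intro prod.mono_neutral_right) (auto simp: g_def)
      then show ?thesis by (cases "i = j") (auto simp: g_def power2_eq_square)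
    qed
    have "(\<Prod>k\<in>I. \<integral>x. g k x \<partial>M k) = (\<Prod>k\<in>{i, j}. \<integral>x. g k x \<partial>M k)"
      using fin i j J by (intro prod.mono_neutral_right) (auto simp: g_def M.M.prob_space)
    also have "\<dots> = (if i = j then \<integral>x. (h i x)\<^sup>2 \<partial>M i else 0)"
      using zero[OF i] zero[OF j] by (cases "i = j") (auto simp: g_def)
    finally show ?thesis
      using M.product_integrable_prod[OF fin gi] M.product_integral_prod[OF fin gi] by (simp add: eq)
  qed
  have expand: "(\<Sum>i\<in>J. h i (x i))\<^sup>2 = (\<Sum>i\<in>J. \<Sum>j\<in>J. h i (x i) * h j (x j))" for x
    by (simp add: power2_eq_square sum_product)
  have int: "integrable (PiM I M) (\<lambda>x. (\<Sum>i\<in>J. h i (x i))\<^sup>2)"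
    unfolding expand using prod by (intro Bochner_Integration.integrable_sum) auto
  have "(\<integral>x. (\<Sum>i\<in>J. h i (x i))\<^sup>2 \<partial>PiM I M) = (\<Sum>i\<in>J. \<Sum>j\<in>J. if i = j then \<integral>x. (h i x)\<^sup>2 \<partial>M i else 0)"
    unfolding expand using prod
    by (subst Bochner_Integration.integral_sum) (auto intro!: sum.cong Bochner_Integration.integrable_sum)
  also have "\<dots> = (\<Sum>i\<in>J. \<integral>x. (h i x)\<^sup>2 \<partial>M i)" using finJ by simp
  also have "\<dots> \<le> (\<Sum>i\<in>J. b i)"
  proof (intro sum_mono)
    fix i assume i: "i \<in> J"
    have "ennreal (\<integral>x. (h i x)\<^sup>2 \<partial>M i) = (\<integral>\<^sup>+x. ennreal ((h i x)\<^sup>2) \<partial>M i)"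
      using sqi[OF i] by (intro nn_integral_eq_integral[symmetric]) auto
    also have "\<dots> \<le> ennreal (b i)" using sq[OF i] M(2)[of i] J i by auto
    finally show "(\<integral>x. (h i x)\<^sup>2 \<partial>M i) \<le> b i" using b[OF i] by simp
  qed
  finally have le: "(\<integral>x. (\<Sum>i\<in>J. h i (x i))\<^sup>2 \<partial>PiM I M) \<le> (\<Sum>i\<in>J. b i)" .
  have "(\<integral>\<^sup>+x. ennreal ((\<Sum>i\<in>J. h i (x i))\<^sup>2) \<partial>PiM I M) = ennreal (\<integral>x. (\<Sum>i\<in>J. h i (x i))\<^sup>2 \<partial>PiM I M)"
    using int by (intro nn_integral_eq_integral) auto
  then show ?thesis using le by (simp add: M(3) ennreal_leI)
qed

section \<open>Sparse Bernoulli priors and fuzzy hypotheses\<close>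

text \<open>The probability that a random subset of \<open>I\<close>, containing each
  \<open>i\<close> independently with probability \<open>p i\<close>, equals
  \<open>S\<close>.\<close>

definition bernoulli_weight :: "'i set \<Rightarrow> ('i \<Rightarrow> real) \<Rightarrow> 'i set \<Rightarrow> real" where
  "bernoulli_weight I p S = (\<Prod>i\<in>S. p i) * (\<Prod>i\<in>I - S. 1 - p i)"

lemma bernoulli_weight_nonneg:
  assumes "S \<subseteq> I" and "\<And>i. i \<in> I \<Longrightarrow> 0 \<le> p i \<and> p i \<le> 1"
  shows "bernoulli_weight I p S \<ge> 0"
  unfolding bernoulli_weight_def using assms by (intro mult_nonneg_nonneg prod_nonneg) auto

text \<open>Expansion of a product of binomials over subsets. With likelihood ratios for
  \<open>r\<close> it turns the mixture over random supports into a product of one-dimensional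
  mixtures; with \<open>r = 1\<close> it gives total mass one.\<close>

lemma sum_bernoulli_weight_prod:
  fixes p r :: "'i \<Rightarrow> real"
  assumes "finite I"
  shows "(\<Sum>S\<in>Pow I. bernoulli_weight I p S * (\<Prod>i\<in>S. r i)) = (\<Prod>i\<in>I. 1 - p i + p i * r i)"
proof -
  have "(\<Prod>i\<in>I. 1 - p i + p i * r i) = (\<Prod>i\<in>I. p i * r i + (1 - p i))"
    by (intro prod.cong) auto
  also have "\<dots> = (\<Sum>S\<in>Pow I. (\<Prod>i\<in>S. p i * r i) * (\<Prod>i\<in>I - S. 1 - p i))"
    by (rule prod_add[OF assms])
  also have "\<dots> = (\<Sum>S\<in>Pow I. bernoulli_weight I p S * (\<Prod>i\<in>S. r i))"
    by (simp add: bernoulli_weight_def prod.distrib mult_ac)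
  finally show ?thesis ..
qed

text \<open>Replacing \<open>1 - p i\<close> by 0 for \<open>i\<close> in \<open>J\<close> removes
  exactly the sets that miss a point of \<open>J\<close>, after which the binomial expansion
  collapses to a product over \<open>J\<close>. The cases \<open>|J| \<le> 2\<close> supply the
  first and second moments of the random set.\<close>

lemma sum_bernoulli_weight_superset:
  fixes p :: "'i \<Rightarrow> real"
  assumes I: "finite I" and J: "J \<subseteq> I"
  shows "(\<Sum>S\<in>Pow I. bernoulli_weight I p S * (if J \<subseteq> S then 1 else 0)) = (\<Prod>i\<in>J. p i)"
proof -
  define q where "q i = (if i \<in> J then 0 else 1 - p i)" for i
  have "(\<Sum>S\<in>Pow I. bernoulli_weight I p S * (if J \<subseteq> S then 1 else 0))
      = (\<Sum>S\<in>Pow I. (\<Prod>i\<in>S. p i) * (\<Prod>i\<in>I - S. q i))"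
  proof (intro sum.cong refl)
    fix S assume S: "S \<in> Pow I"
    show "bernoulli_weight I p S * (if J \<subseteq> S then 1 else 0) = (\<Prod>i\<in>S. p i) * (\<Prod>i\<in>I - S. q i)"
    proof (cases "J \<subseteq> S")
      case True
      then have "(\<Prod>i\<in>I - S. q i) = (\<Prod>i\<in>I - S. 1 - p i)" by (intro prod.cong) (auto simp: q_def)
      with True show ?thesis by (simp add: bernoulli_weight_def)
    next
      case False
      then obtain i where "i \<in> J" "i \<notin> S" by blast
      then have "(\<Prod>i\<in>I - S. q i) = 0" using I J by (intro prod_zero) (auto simp: q_def)
      with False show ?thesis by simp
    qed
  qed
  also have "\<dots> = (\<Prod>i\<in>I. p i + q i)" by (rule prod_add[OF I, symmetric])
  also have "\<dots> = (\<Prod>i\<in>J. p i + q i)"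
    using I J by (intro prod.mono_neutral_right) (auto simp: q_def)
  also have "\<dots> = (\<Prod>i\<in>J. p i)" by (intro prod.cong) (auto simp: q_def)
  finally show ?thesis .
qed

text \<open>The cardinality constraint costs at most half of the mean because \<open>1 - (|S| - 1) / s\<close> lies
  below the indicator of \<open>|S| \<le> s\<close> whenever \<open>S\<close> is nonempty, and has mean linear in the pairwise
  products \<open>p i * p j\<close>.\<close>

lemma sum_bernoulli_weight_sparse_ge:
  fixes p l :: "'i \<Rightarrow> real" and s :: nat
  assumes I: "finite I" and p: "\<And>i. i \<in> I \<Longrightarrow> 0 \<le> p i \<and> p i \<le> 1"
    and l: "\<And>i. i \<in> I \<Longrightarrow> l i \<ge> 0" and s: "s > 0" and sum: "(\<Sum>i\<in>I. p i) \<le> s / 2"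
  shows "(\<Sum>i\<in>I. l i * p i) / 2
    \<le> (\<Sum>S\<in>{S \<in> Pow I. card S \<le> s}. bernoulli_weight I p S * (\<Sum>i\<in>S. l i))"
proof -
  let ?w = "bernoulli_weight I p"
  let ?ind = "\<lambda>P. if P then 1 else (0 :: real)"
  define L where "L S = (\<Sum>i\<in>S. l i)" for S
  have L: "L S \<ge> 0" if "S \<subseteq> I" for S using that l by (auto simp: L_def intro!: sum_nonneg)
  have Lind: "L S = (\<Sum>i\<in>I. l i * ?ind (i \<in> S))" if "S \<subseteq> I" for S
  proof -
    have "(\<Sum>i\<in>I. l i * ?ind (i \<in> S)) = (\<Sum>i\<in>S. l i * ?ind (i \<in> S))"
      using that I by (intro sum.mono_neutral_right) auto
    then show ?thesis by (simp add: L_def)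
  qed
  have cind: "real (card S) = (\<Sum>j\<in>I. ?ind (j \<in> S))" if "S \<subseteq> I" for S
  proof -
    have "(\<Sum>j\<in>I. ?ind (j \<in> S)) = (\<Sum>j\<in>S. ?ind (j \<in> S))"
      using that I by (intro sum.mono_neutral_right) auto
    then show ?thesis by simp
  qed
  have e1: "(\<Sum>S\<in>Pow I. ?w S * ?ind (i \<in> S)) = p i" if "i \<in> I" for i
    using sum_bernoulli_weight_superset[of I "{i}" p] I that by simp
  \<comment> \<open>For \<open>i = j\<close> the pair is a singleton with probability
    \<open>p i\<close> rather than its square; this is the source of the summand 1 in
    \<open>1 + s / 2\<close> below.\<close>
  have e2: "(\<Sum>S\<in>Pow I. ?w S * ?ind (i \<in> S \<and> j \<in> S)) = (if i = j then p i else p i * p j)"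
    if "i \<in> I" "j \<in> I" for i j
    using sum_bernoulli_weight_superset[of I "{i, j}" p] I that by auto
  have m1: "(\<Sum>S\<in>Pow I. ?w S * L S) = (\<Sum>i\<in>I. l i * p i)"
  proof -
    have "(\<Sum>S\<in>Pow I. ?w S * L S) = (\<Sum>S\<in>Pow I. \<Sum>i\<in>I. l i * (?w S * ?ind (i \<in> S)))"
      by (intro sum.cong refl) (simp add: Lind sum_distrib_left mult_ac)
    also have "\<dots> = (\<Sum>i\<in>I. l i * (\<Sum>S\<in>Pow I. ?w S * ?ind (i \<in> S)))"
      by (subst sum.swap) (simp add: sum_distrib_left)
    finally show ?thesis by (simp add: e1)
  qed
  have m2: "(\<Sum>S\<in>Pow I. ?w S * (L S * card S)) \<le> (\<Sum>i\<in>I. l i * p i) * (1 + s / 2)"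
  proof -
    have "(\<Sum>S\<in>Pow I. ?w S * (L S * card S))
        = (\<Sum>S\<in>Pow I. \<Sum>i\<in>I. \<Sum>j\<in>I. l i * (?w S * ?ind (i \<in> S \<and> j \<in> S)))"
      by (intro sum.cong refl)
        (auto simp: Lind cind sum_product sum_distrib_left mult_ac intro!: sum.cong)
    also have "\<dots> = (\<Sum>i\<in>I. \<Sum>j\<in>I. l i * (\<Sum>S\<in>Pow I. ?w S * ?ind (i \<in> S \<and> j \<in> S)))"
      by (subst sum.swap, intro sum.cong refl, subst sum.swap) (simp add: sum_distrib_left)
    also have "\<dots> = (\<Sum>i\<in>I. \<Sum>j\<in>I. l i * (if i = j then p i else p i * p j))"
      by (intro sum.cong refl) (simp only: e2)
    also have "\<dots> \<le> (\<Sum>i\<in>I. l i * p i * (1 + s / 2))"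
    proof (intro sum_mono)
      fix i assume i: "i \<in> I"
      have "(\<Sum>j\<in>I. l i * (if i = j then p i else p i * p j))
          \<le> (\<Sum>j\<in>I. l i * p i * (?ind (i = j) + p j))"
        using p l i by (intro sum_mono) (auto simp: algebra_simps)
      also have "\<dots> = l i * p i * (1 + (\<Sum>j\<in>I. p j))"
        using I i by (simp add: sum_distrib_left[symmetric] sum.distrib)
      also have "\<dots> \<le> l i * p i * (1 + s / 2)"
        using p l i sum by (intro mult_left_mono) auto
      finally show "(\<Sum>j\<in>I. l i * (if i = j then p i else p i * p j)) \<le> l i * p i * (1 + s / 2)" .
    qed
    finally show ?thesis by (simp add: sum_distrib_right)
  qed
  have "(\<Sum>S\<in>Pow I. ?w S * (L S * (1 - (real (card S) - 1) / s)))
      = (\<Sum>S\<in>Pow I. ?w S * L S * (1 + 1 / s) - ?w S * (L S * card S) / s)"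
    using s by (intro sum.cong refl) (simp add: field_simps)
  also have "\<dots> = (\<Sum>S\<in>Pow I. ?w S * L S) * (1 + 1 / s) - (\<Sum>S\<in>Pow I. ?w S * (L S * card S)) / s"
    by (simp add: sum_subtractf sum_distrib_right sum_divide_distrib)
  also have "\<dots> \<ge> (\<Sum>i\<in>I. l i * p i) * (1 + 1 / s) - (\<Sum>i\<in>I. l i * p i) * (1 + s / 2) / s"
    using m2 s by (simp add: m1 divide_right_mono)
  \<comment> \<open>The coefficient is \<open>1 + 1/s - 1/s - 1/2 = 1/2\<close>.\<close>
  also have "(\<Sum>i\<in>I. l i * p i) * (1 + 1 / s) - (\<Sum>i\<in>I. l i * p i) * (1 + s / 2) / s
      = (\<Sum>i\<in>I. l i * p i) / 2"
    using s by (simp add: field_simps)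
  finally have "(\<Sum>i\<in>I. l i * p i) / 2 \<le> (\<Sum>S\<in>Pow I. ?w S * (L S * (1 - (real (card S) - 1) / s)))" .
  also have "\<dots> \<le> (\<Sum>S\<in>Pow I. ?w S * (L S * ?ind (card S \<le> s)))"
  proof (rule sum_mono)
    fix S assume S: "S \<in> Pow I"
    \<comment> \<open>At the empty set the linear function is \<open>1 + 1/s\<close>, above the
      indicator, but \<open>L\<close> vanishes there. For nonempty \<open>S\<close>, integrality
      gives \<open>card S \<ge> s + 1\<close> as soon as the constraint fails, and there the linear
      function is at most 0.\<close>
    have "L S * (1 - (real (card S) - 1) / s) \<le> L S * ?ind (card S \<le> s)"
    proof (cases "S = {}")
      case False
      have "card S \<ge> 1" using False S I by (simp add: Suc_le_eq card_gt_0_iff finite_subset)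
      moreover have "card S \<le> s \<or> real (card S) \<ge> real s + 1" by linarith
      ultimately have "1 - (real (card S) - 1) / s \<le> ?ind (card S \<le> s)"
        using s by (auto simp: field_simps)
      then show ?thesis using L S by (intro mult_left_mono) auto
    qed (simp add: L_def)
    moreover have "?w S \<ge> 0" using S p by (intro bernoulli_weight_nonneg) auto
    ultimately show "?w S * (L S * (1 - (real (card S) - 1) / s)) \<le> ?w S * (L S * ?ind (card S \<le> s))"
      by (rule mult_left_mono)
  qed
  also have "\<dots> = (\<Sum>S\<in>{S \<in> Pow I. card S \<le> s}. ?w S * L S)"
    using I by (subst sum.inter_filter) (auto intro!: sum.cong)
  finally show ?thesis by (simp add: L_def)
qed

text \<open>Two fuzzy hypotheses: writing \<open>q L = q (L - T) + q T\<close> and using \<open>x y \<le> t x\<^sup>2 / 2 + y\<^sup>2 / (2 t)\<close>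
  for both terms bounds the prior mean of \<open>L\<close> by the risks and the second moment of the mixture
  likelihood ratio.\<close>

lemma fuzzy_hypotheses_bound:
  fixes \<mu> L :: "'i \<Rightarrow> real" and q :: "'i \<Rightarrow> 'a \<Rightarrow> real" and T :: "'a \<Rightarrow> real"
  assumes fin: "finite F" and \<mu>: "\<And>S. S \<in> F \<Longrightarrow> \<mu> S \<ge> 0" and total: "(\<Sum>S\<in>F. \<mu> S) \<le> 1"
    and q: "\<And>S x. S \<in> F \<Longrightarrow> q S x \<ge> 0" and L: "\<And>S. S \<in> F \<Longrightarrow> L S \<ge> 0"
    and [measurable]: "T \<in> borel_measurable M" "\<And>S. S \<in> F \<Longrightarrow> q S \<in> borel_measurable M"
    and q1: "\<And>S. S \<in> F \<Longrightarrow> (\<integral>\<^sup>+x. ennreal (q S x) \<partial>M) = 1"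
    and K: "(\<integral>\<^sup>+x. ennreal ((\<Sum>S\<in>F. \<mu> S * q S x)\<^sup>2) \<partial>M) \<le> ennreal K" "K \<ge> 0"
    and R0: "(\<integral>\<^sup>+x. ennreal ((T x)\<^sup>2) \<partial>M) \<le> ennreal R"
    and R1: "\<And>S. S \<in> F \<Longrightarrow> (\<integral>\<^sup>+x. ennreal (q S x * (T x - L S)\<^sup>2) \<partial>M) \<le> ennreal R"
    and R: "R \<ge> 0"
  shows "(\<Sum>S\<in>F. \<mu> S * L S)\<^sup>2 / (2 * (1 + K)) \<le> R"
proof -
  define \<Delta> where "\<Delta> = (\<Sum>S\<in>F. \<mu> S * L S)"
  have \<Delta>: "\<Delta> \<ge> 0" unfolding \<Delta>_def using \<mu> L by (intro sum_nonneg) auto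
  \<comment> \<open>The estimate is kept for every \<open>t > 0\<close>, since a good value of
    \<open>t\<close> depends on the prior mean \<open>\<Delta>\<close>.\<close>
  have bound: "\<Delta> \<le> t / 2 * (1 + K) + R / t" if t: "t > 0" for t
  proof -
    define Q where "Q x = (\<Sum>S\<in>F. \<mu> S * q S x)" for x
    have Qm [measurable]: "Q \<in> borel_measurable M" unfolding Q_def by measurable
    have am: "u * v \<le> t / 2 * u\<^sup>2 + v\<^sup>2 / (2 * t)" for u v :: real
    proof -
      have "0 \<le> (t * u - v)\<^sup>2 / (2 * t)" using t by simp
      also have "\<dots> = t / 2 * u\<^sup>2 + v\<^sup>2 / (2 * t) - u * v"
        using t by (simp add: power2_eq_square field_simps)
      finally show ?thesis by simp
    qed
    have pt: "(\<Sum>S\<in>F. \<mu> S * L S * q S x)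
        \<le> (\<Sum>S\<in>F. t / 2 * \<mu> S * q S x + \<mu> S / (2 * t) * (q S x * (T x - L S)\<^sup>2))
          + (t / 2 * (Q x)\<^sup>2 + 1 / (2 * t) * (T x)\<^sup>2)" for x
    proof -
      \<comment> \<open>The explicit factor 1 lets \<open>am\<close> be applied with
        \<open>u = 1\<close>, so that \<open>q S x\<close> stays outside as a weight; in the second
        term \<open>u\<close> is the mixture \<open>Q x\<close>.\<close>
      have "(\<Sum>S\<in>F. \<mu> S * L S * q S x) = (\<Sum>S\<in>F. \<mu> S * q S x * (1 * (L S - T x))) + Q x * T x"
        unfolding Q_def sum_distrib_right sum.distrib[symmetric]
        by (intro sum.cong refl) (simp add: algebra_simps)
      also have "\<dots> \<le> (\<Sum>S\<in>F. \<mu> S * q S x * (t / 2 * 1\<^sup>2 + (L S - T x)\<^sup>2 / (2 * t)))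
          + (t / 2 * (Q x)\<^sup>2 + (T x)\<^sup>2 / (2 * t))"
        using \<mu> q by (intro add_mono sum_mono mult_left_mono am) auto
      also have "(\<Sum>S\<in>F. \<mu> S * q S x * (t / 2 * 1\<^sup>2 + (L S - T x)\<^sup>2 / (2 * t)))
          = (\<Sum>S\<in>F. t / 2 * \<mu> S * q S x + \<mu> S / (2 * t) * (q S x * (T x - L S)\<^sup>2))"
        using t by (intro sum.cong refl) (simp add: field_simps power2_eq_square)
      finally show ?thesis by simp
    qed
    have "ennreal \<Delta> = (\<Sum>S\<in>F. ennreal (\<mu> S * L S) * (\<integral>\<^sup>+x. ennreal (q S x) \<partial>M))"
      unfolding \<Delta>_def using \<mu> L by (subst sum_ennreal[symmetric]) (auto simp: q1)
    also have "\<dots> = (\<Sum>S\<in>F. \<integral>\<^sup>+x. ennreal (\<mu> S * L S * q S x) \<partial>M)"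
    proof (intro sum.cong refl)
      fix S assume S[measurable]: "S \<in> F"
      have "(\<integral>\<^sup>+x. ennreal (\<mu> S * L S * q S x) \<partial>M) = (\<integral>\<^sup>+x. ennreal (\<mu> S * L S) * ennreal (q S x) \<partial>M)"
        using S \<mu> L by (simp add: ennreal_mult')
      then show "ennreal (\<mu> S * L S) * (\<integral>\<^sup>+x. ennreal (q S x) \<partial>M) = (\<integral>\<^sup>+x. ennreal (\<mu> S * L S * q S x) \<partial>M)"
        by (simp add: nn_integral_cmult)
    qed
    also have "\<dots> = (\<integral>\<^sup>+x. (\<Sum>S\<in>F. ennreal (\<mu> S * L S * q S x)) \<partial>M)"
      by (rule nn_integral_sum[symmetric]) measurable
    also have "\<dots> = (\<integral>\<^sup>+x. ennreal (\<Sum>S\<in>F. \<mu> S * L S * q S x) \<partial>M)"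
      using \<mu> L q by (intro nn_integral_cong sum_ennreal) auto
    also have "\<dots> \<le> (\<integral>\<^sup>+x. (\<Sum>S\<in>F. ennreal (t / 2 * \<mu> S) * ennreal (q S x)
          + ennreal (\<mu> S / (2 * t)) * ennreal (q S x * (T x - L S)\<^sup>2))
        + (ennreal (t / 2) * ennreal ((Q x)\<^sup>2) + ennreal (1 / (2 * t)) * ennreal ((T x)\<^sup>2)) \<partial>M)"
    proof (intro nn_integral_mono)
      fix x
      have "(\<Sum>S\<in>F. ennreal (t / 2 * \<mu> S) * ennreal (q S x)
          + ennreal (\<mu> S / (2 * t)) * ennreal (q S x * (T x - L S)\<^sup>2))
          = (\<Sum>S\<in>F. ennreal (t / 2 * \<mu> S * q S x + \<mu> S / (2 * t) * (q S x * (T x - L S)\<^sup>2)))"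
        using \<mu> q t by (intro sum.cong refl) (simp add: ennreal_mult'[symmetric] ennreal_plus[symmetric] del: ennreal_plus)
      also have "\<dots> = ennreal (\<Sum>S\<in>F. t / 2 * \<mu> S * q S x + \<mu> S / (2 * t) * (q S x * (T x - L S)\<^sup>2))"
        using \<mu> q t by (intro sum_ennreal) auto
      finally have 1: "(\<Sum>S\<in>F. ennreal (t / 2 * \<mu> S) * ennreal (q S x)
          + ennreal (\<mu> S / (2 * t)) * ennreal (q S x * (T x - L S)\<^sup>2)) = \<dots>" .
      have 2: "ennreal (t / 2) * ennreal ((Q x)\<^sup>2) + ennreal (1 / (2 * t)) * ennreal ((T x)\<^sup>2)
          = ennreal (t / 2 * (Q x)\<^sup>2 + 1 / (2 * t) * (T x)\<^sup>2)"
        using t by (simp add: ennreal_mult'[symmetric] ennreal_plus[symmetric] del: ennreal_plus)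
      show "ennreal (\<Sum>S\<in>F. \<mu> S * L S * q S x) \<le> (\<Sum>S\<in>F. ennreal (t / 2 * \<mu> S) * ennreal (q S x)
          + ennreal (\<mu> S / (2 * t)) * ennreal (q S x * (T x - L S)\<^sup>2))
        + (ennreal (t / 2) * ennreal ((Q x)\<^sup>2) + ennreal (1 / (2 * t)) * ennreal ((T x)\<^sup>2))"
        unfolding 1 2 using \<mu> q t pt[of x]
        by (subst ennreal_plus[symmetric]) (auto intro!: ennreal_leI sum_nonneg add_nonneg_nonneg)
    qed
    also have "\<dots> = (\<Sum>S\<in>F. ennreal (t / 2 * \<mu> S) * (\<integral>\<^sup>+x. ennreal (q S x) \<partial>M)
          + ennreal (\<mu> S / (2 * t)) * (\<integral>\<^sup>+x. ennreal (q S x * (T x - L S)\<^sup>2) \<partial>M))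
        + (ennreal (t / 2) * (\<integral>\<^sup>+x. ennreal ((Q x)\<^sup>2) \<partial>M)
          + ennreal (1 / (2 * t)) * (\<integral>\<^sup>+x. ennreal ((T x)\<^sup>2) \<partial>M))"
      by (simp add: nn_integral_add nn_integral_sum nn_integral_cmult)
    also have "\<dots> \<le> (\<Sum>S\<in>F. ennreal (t / 2 * \<mu> S) * ennreal 1 + ennreal (\<mu> S / (2 * t)) * ennreal R)
        + (ennreal (t / 2) * ennreal K + ennreal (1 / (2 * t)) * ennreal R)"
      using q1 R0 R1 K by (intro add_mono sum_mono mult_left_mono) (auto simp: Q_def)
    also have "\<dots> = ennreal ((\<Sum>S\<in>F. t / 2 * \<mu> S + \<mu> S / (2 * t) * R) + (t / 2 * K + R / (2 * t)))"
    proof -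
      have "(\<Sum>S\<in>F. ennreal (t / 2 * \<mu> S) * ennreal 1 + ennreal (\<mu> S / (2 * t)) * ennreal R)
          = (\<Sum>S\<in>F. ennreal (t / 2 * \<mu> S + \<mu> S / (2 * t) * R))"
        using \<mu> t R by (intro sum.cong refl)
          (simp add: ennreal_mult'[symmetric] ennreal_plus[symmetric] del: ennreal_plus)
      also have "\<dots> = ennreal (\<Sum>S\<in>F. t / 2 * \<mu> S + \<mu> S / (2 * t) * R)"
        using \<mu> t R by (intro sum_ennreal) auto
      moreover have "(\<Sum>S\<in>F. t / 2 * \<mu> S + \<mu> S / (2 * t) * R) \<ge> 0"
        using \<mu> t R by (intro sum_nonneg) auto
      ultimately show ?thesis
        using t K(2) R by (simp add: ennreal_mult'[symmetric] ennreal_plus[symmetric] del: ennreal_plus)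
    qed
    finally have "\<Delta> \<le> (\<Sum>S\<in>F. t / 2 * \<mu> S + \<mu> S / (2 * t) * R) + (t / 2 * K + R / (2 * t))"
      using \<mu> t R K(2) by (subst (asm) ennreal_le_iff) (auto intro!: add_nonneg_nonneg sum_nonneg)
    also have "(\<Sum>S\<in>F. t / 2 * \<mu> S + \<mu> S / (2 * t) * R) = (\<Sum>S\<in>F. \<mu> S) * (t / 2 + R / (2 * t))"
      unfolding sum_distrib_right by (intro sum.cong refl) (simp add: field_simps)
    \<comment> \<open>Here total weight at most one is enough, so the Bernoulli weights cut off at
      cardinality \<open>s\<close> can serve as the prior as they stand.\<close>
    also have "\<dots> \<le> 1 * (t / 2 + R / (2 * t))"
      using total t R by (intro mult_right_mono) auto
    finally have "\<Delta> \<le> 1 * (t / 2 + R / (2 * t)) + (t / 2 * K + R / (2 * t))" by simp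
    moreover have "R / (2 * t) + R / (2 * t) = R / t" using t by (simp add: field_simps)
    ultimately show ?thesis by (simp add: distrib_left)
  qed
  show ?thesis
  proof (cases "\<Delta> = 0")
    case False
    with \<Delta> have D: "\<Delta> > 0" by simp
    \<comment> \<open>With this \<open>t\<close> the term \<open>t / 2 * (1 + K)\<close> consumes
      exactly half of \<open>\<Delta>\<close>; the other half has to be paid by
      \<open>R / t\<close>.\<close>
    define t where "t = \<Delta> / (1 + K)"
    have t: "t > 0" using D K by (simp add: t_def)
    have "\<Delta> \<le> t / 2 * (1 + K) + R / t" by (rule bound[OF t])
    also have "t / 2 * (1 + K) = \<Delta> / 2"
    proof -
      have "1 + K \<noteq> 0" using K(2) by linarith
      then have "t * (1 + K) = \<Delta>" by (rule nonzero_eq_divide_eq[THEN iffD1, OF _ t_def])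
      then show ?thesis by simp
    qed
    finally have "\<Delta> / 2 * t \<le> R" using t by (simp add: field_simps)
    then show ?thesis using K by (simp add: t_def \<Delta>_def power2_eq_square field_simps)
  qed (use R in \<open>simp add: \<Delta>_def[symmetric]\<close>)
qed

section \<open>The lower bound\<close>

lemma loading_vector_pos:
  assumes "loading_vector d \<eta>" "j \<in> {1..d}"
  shows "\<bar>\<eta> j\<bar> > 0"
  using assms by (fastforce simp: loading_vector_def)

lemma lambda_o_nonneg: "lambda_o d \<eta> \<alpha> s \<ge> 0"
  by (simp add: lambda_o_def)

lemma nu_o_pos:
  assumes "loading_vector d \<eta>" "d \<ge> 1"
  shows "nu_o d \<eta> \<alpha> s > 0"
  unfolding nu_o_def using assms loading_vector_pos[OF assms(1)]
  by (auto intro!: sum_pos mult_pos_pos)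

lemma nu_o_square:
  "(nu_o d \<eta> \<alpha> s)\<^sup>2 = (\<Sum>j=1..d. (\<eta> j)\<^sup>2 * exp (- ((lambda_o d \<eta> \<alpha> s / \<bar>\<eta> j\<bar>) powr \<alpha>)))"
  unfolding nu_o_def by (intro real_sqrt_pow2 sum_nonneg) auto

text \<open>This is the defining equation of \<beta>, read at \<open>max \<beta> 0\<close>. For
  nonnegative \<beta> it is the equation itself; for negative \<beta> one has
  \<open>lambda_o = 0\<close>, and the quotient at 0 lies below \<open>s / 2\<close> because the
  quotient decreases.\<close>

lemma weighted_sum_le_nu_o:
  assumes load: "loading_vector d \<eta>" and d: "d \<ge> 1" and \<alpha>: "\<alpha> > 0" and s: "s > 0"
  defines "N \<equiv> \<Sum>j=1..d. \<bar>\<eta> j\<bar> * exp (- ((lambda_o d \<eta> \<alpha> s / \<bar>\<eta> j\<bar>) powr \<alpha>))"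
  shows "N \<le> s / 2 * nu_o d \<eta> \<alpha> s"
    and "lambda_o d \<eta> \<alpha> s > 0 \<Longrightarrow> N = s / 2 * nu_o d \<eta> \<alpha> s"
proof -
  define b where "b = beta_o d \<eta> \<alpha> s"
  define F G where "F x = (\<Sum>j=1..d. \<bar>\<eta> j\<bar> * exp (- x / \<bar>\<eta> j\<bar> powr \<alpha>))"
    and "G x = (\<Sum>j=1..d. (\<eta> j)\<^sup>2 * exp (- x / \<bar>\<eta> j\<bar> powr \<alpha>))" for x
  note pos = loading_vector_pos[OF load]
  have FG: "F x > 0" "G x > 0" for x
    unfolding F_def G_def using d pos by (auto intro!: sum_pos mult_pos_pos)
  have eq: "F b / sqrt (G b) = s / 2"
    unfolding b_def beta_o_def F_def G_def by (rule theI'[OF beta_o_ex1[OF load d \<alpha> s]])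
  have lp: "lambda_o d \<eta> \<alpha> s powr \<alpha> = max b 0"
    using \<alpha> by (simp add: lambda_o_def b_def powr_powr)
  have term_eq: "(lambda_o d \<eta> \<alpha> s / \<bar>\<eta> j\<bar>) powr \<alpha> = max b 0 / \<bar>\<eta> j\<bar> powr \<alpha>" for j
    using lp lambda_o_nonneg[of d \<eta> \<alpha> s] by (simp add: powr_divide)
  have N: "N = F (max b 0)" and nu: "nu_o d \<eta> \<alpha> s = sqrt (G (max b 0))"
    by (simp_all add: N_def nu_o_def F_def G_def term_eq)
  have eqb: "F b = s / 2 * sqrt (G b)" using eq FG[of b] by (simp add: field_simps)
  show "N \<le> s / 2 * nu_o d \<eta> \<alpha> s"
  proof (cases "b \<ge> 0")
    case True
    then show ?thesis using eqb by (simp add: N nu max_def)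
  next
    case False
    \<comment> \<open>\<open>|\<eta> j|\<close> and \<open>1 / |\<eta> j|^\<alpha>\<close> are
      ordered oppositely, the condition under which the quotient decreases.\<close>
    have mono: "(\<bar>\<eta> j\<bar> - \<bar>\<eta> i\<bar>) * (1 / \<bar>\<eta> j\<bar> powr \<alpha> - 1 / \<bar>\<eta> i\<bar> powr \<alpha>) \<le> 0"
      if "i \<in> {1..d}" "j \<in> {1..d}" for i j
    proof (cases "\<bar>\<eta> i\<bar> \<le> \<bar>\<eta> j\<bar>")
      case True
      then have "\<bar>\<eta> i\<bar> powr \<alpha> \<le> \<bar>\<eta> j\<bar> powr \<alpha>" using \<alpha> by (intro powr_mono2) auto
      then show ?thesis using True pos[OF that(1)] pos[OF that(2)]
        by (intro mult_nonneg_nonpos) (auto intro!: frac_le)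
    next
      case False
      then have "\<bar>\<eta> j\<bar> powr \<alpha> \<le> \<bar>\<eta> i\<bar> powr \<alpha>" using \<alpha> by (intro powr_mono2) auto
      then show ?thesis using False pos[OF that(1)] pos[OF that(2)]
        by (intro mult_nonpos_nonneg) (auto intro!: frac_le)
    qed
    have Gabs: "G x = (\<Sum>j=1..d. \<bar>\<eta> j\<bar>\<^sup>2 * exp (- x / \<bar>\<eta> j\<bar> powr \<alpha>))" for x
      by (simp only: G_def power2_abs)
    \<comment> \<open>Monotonicity is available for the squared quotient; square roots are taken at
      the end, both sides being nonnegative.\<close>
    have "(F 0)\<^sup>2 / G 0 < (F b)\<^sup>2 / G b"
      unfolding F_def Gabs
    proof (rule beta_o_quotient_strict_antimono)
      show "b < 0" using False by simp
      show "\<bar>\<eta> j\<bar> powr \<alpha> > 0" if "j \<in> {1..d}" for j using pos[OF that] by simp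
      show "finite {1..d}" "{1..d} \<noteq> {}" using d by simp_all
    qed (fact pos mono)+
    also have "(F b)\<^sup>2 / G b = (F b / sqrt (G b))\<^sup>2" using FG[of b] by (simp add: power_divide)
    also have "\<dots> = (s / 2)\<^sup>2" by (simp only: eq)
    finally have "(F 0)\<^sup>2 \<le> (s / 2)\<^sup>2 * G 0"
      using FG(2)[of 0] by (simp add: pos_divide_less_eq)
    also have "\<dots> = (s / 2 * sqrt (G 0))\<^sup>2"
      using FG(2)[of 0] by (simp only: power_mult_distrib real_sqrt_pow2 less_imp_le)
    finally have "(F 0)\<^sup>2 \<le> (s / 2 * sqrt (G 0))\<^sup>2" .
    moreover have "0 \<le> s / 2 * sqrt (G 0)" using s FG(2)[of 0] by simp
    ultimately have "F 0 \<le> s / 2 * sqrt (G 0)" by (rule power2_le_imp_le)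
    then show ?thesis using False by (simp add: N nu max_def)
  qed
  show "N = s / 2 * nu_o d \<eta> \<alpha> s" if "lambda_o d \<eta> \<alpha> s > 0"
  proof -
    have "b > 0" using that \<alpha> by (auto simp: lambda_o_def b_def max_def split: if_splits)
    then show ?thesis using eqb by (simp add: N nu max_def)
  qed
qed

lemma risk_eq_nn_integral:
  assumes T: "T \<in> estimators d"
    and sets: "\<And>j. j \<in> {1..d} \<Longrightarrow> sets (P j) = sets borel"
  shows "risk d \<eta> \<sigma> T \<theta> (PiM {1..d} P)
    = (\<integral>\<^sup>+\<xi>. ennreal ((T (\<lambda>j\<in>{1..d}. \<theta> j + \<sigma> * \<xi> j) - linear_functional d \<eta> \<theta>)\<^sup>2) \<partial>PiM {1..d} P)"
proof -
  have s: "sets (PiM {1..d} P) = sets (sample_space d)"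
    by (intro sets_PiM_cong) (auto simp: sets)
  have "(\<lambda>\<xi>. \<lambda>j\<in>{1..d}. \<theta> j + \<sigma> * \<xi> j) \<in> measurable (sample_space d) (sample_space d)"
    by (intro measurable_restrict borel_measurable_add borel_measurable_times
        borel_measurable_const measurable_component_singleton)
  then have shift: "(\<lambda>\<xi>. \<lambda>j\<in>{1..d}. \<theta> j + \<sigma> * \<xi> j) \<in> measurable (PiM {1..d} P) (sample_space d)"
    by (simp only: measurable_cong_sets[OF s refl])
  have "(\<lambda>y. ennreal ((T y - linear_functional d \<eta> \<theta>)\<^sup>2)) \<in> borel_measurable (sample_space d)"
    using T by measurable
  then show ?thesis
    unfolding risk_def observation_law_def by (intro nn_integral_distr[OF shift]) (subst measurable_distr_eq1)
qed

section \<open>Likelihood ratios and chi-square bounds on the product space\<close>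

lemma distr_shift_PiM_exp_power_noise:
  assumes \<alpha>: "\<alpha> > 0" and a: "a > 0" and c: "c > 0" and I: "finite I"
    and total: "(\<integral>x. a * exp (- c * \<bar>x\<bar> powr \<alpha>) \<partial>lborel) = 1"
  shows "distr (PiM I (\<lambda>_. exp_power_noise \<alpha> a c)) (PiM I (\<lambda>_. borel)) (\<lambda>x. \<lambda>j\<in>I. v j + x j)
    = density (PiM I (\<lambda>_. exp_power_noise \<alpha> a c)) (\<lambda>x. ennreal (\<Prod>j\<in>I. shift_ratio \<alpha> c (v j) (x j)))"
proof -
  let ?P = "exp_power_noise \<alpha> a c"
  interpret P: prob_space ?P
    by (rule prob_space_exp_power_noise) (use assms in auto)
  have shift: "distr ?P borel (\<lambda>x. v j + x) = density ?P (\<lambda>x. ennreal (shift_ratio \<alpha> c (v j) x))" for j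
    by (rule distr_shift_exp_power_noise[OF a])
  have "distr (PiM I (\<lambda>_. ?P)) (PiM I (\<lambda>_. borel)) (\<lambda>x. \<lambda>j\<in>I. v j + x j)
      = PiM I (\<lambda>j. distr ?P borel (\<lambda>x. v j + x))"
    by (rule distr_PiM_coordinatewise[OF I, where f = "\<lambda>j x. v j + x"])
      (auto simp: P.prob_space_axioms measurable_cong_sets[OF sets_exp_power_noise])
  also have "\<dots> = density (PiM I (\<lambda>_. ?P)) (\<lambda>x. \<Prod>j\<in>I. ennreal (shift_ratio \<alpha> c (v j) (x j)))"
    unfolding shift
  proof (rule density_PiM[OF I, symmetric])
    fix j
    show "prob_space (density ?P (\<lambda>x. ennreal (shift_ratio \<alpha> c (v j) x)))"
      unfolding shift[symmetric]
      by (rule P.prob_space_distr) (simp add: measurable_cong_sets[OF sets_exp_power_noise])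
  qed (auto simp: P.prob_space_axioms measurable_cong_sets[OF sets_exp_power_noise])
  finally show ?thesis by (simp add: prod_ennreal less_imp_le[OF shift_ratio_pos])
qed

text \<open>The integral is the total mass of the shifted law.\<close>

lemma nn_integral_shift_ratio:
  assumes \<alpha>: "\<alpha> > 0" and a: "a > 0" and c: "c > 0"
    and total: "(\<integral>x. a * exp (- c * \<bar>x\<bar> powr \<alpha>) \<partial>lborel) = 1"
  shows "(\<integral>\<^sup>+x. ennreal (shift_ratio \<alpha> c v x) \<partial>exp_power_noise \<alpha> a c) = 1"
proof -
  let ?P = "exp_power_noise \<alpha> a c"
  interpret P: prob_space ?P
    by (rule prob_space_exp_power_noise) (use assms in auto)
  have "prob_space (distr ?P borel (\<lambda>x. v + x))"
    by (rule P.prob_space_distr) (simp add: measurable_cong_sets[OF sets_exp_power_noise])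
  then have "emeasure (density ?P (\<lambda>x. ennreal (shift_ratio \<alpha> c v x))) UNIV = 1"
    unfolding distr_shift_exp_power_noise[OF a] by (auto dest: prob_space.emeasure_space_1)
  then show ?thesis by (subst (asm) emeasure_density) auto
qed

text \<open>The integral factors over coordinates. In each, expanding the square and using that the
  ratio integrates to 1 leaves at most
  \<open>(1 - p)^2 + 2 p (1 - p) + p^2 B = 1 - p^2 + p^2 B\<close>, which is below
  \<open>exp (p^2 B)\<close>.\<close>

lemma nn_integral_mixture_square_le:
  fixes p v B :: "'i \<Rightarrow> real"
  assumes \<alpha>: "\<alpha> > 0" and a: "a > 0" and c: "c > 0" and I: "finite I"
    and total: "(\<integral>x. a * exp (- c * \<bar>x\<bar> powr \<alpha>) \<partial>lborel) = 1"
    and p: "\<And>j. j \<in> I \<Longrightarrow> 0 \<le> p j \<and> p j \<le> 1"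
    and B: "\<And>j. j \<in> I \<Longrightarrow>
      (\<integral>\<^sup>+x. ennreal ((shift_ratio \<alpha> c (v j) x)\<^sup>2) \<partial>exp_power_noise \<alpha> a c) \<le> ennreal (B j)"
    and B0: "\<And>j. j \<in> I \<Longrightarrow> B j \<ge> 0"
  shows "(\<integral>\<^sup>+x. ennreal ((\<Prod>j\<in>I. 1 - p j + p j * shift_ratio \<alpha> c (v j) (x j))\<^sup>2)
      \<partial>PiM I (\<lambda>_. exp_power_noise \<alpha> a c)) \<le> ennreal (exp (\<Sum>j\<in>I. (p j)\<^sup>2 * B j))"
proof -
  let ?P = "exp_power_noise \<alpha> a c"
  interpret P: prob_space ?P
    by (rule prob_space_exp_power_noise) (use assms in auto)
  interpret PP: product_prob_space "\<lambda>_. ?P" by unfold_locales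
  let ?r = "\<lambda>j x. shift_ratio \<alpha> c (v j) x"
  have "(\<integral>\<^sup>+x. ennreal ((\<Prod>j\<in>I. 1 - p j + p j * ?r j (x j))\<^sup>2) \<partial>PiM I (\<lambda>_. ?P))
      = (\<integral>\<^sup>+x. (\<Prod>j\<in>I. ennreal ((1 - p j + p j * ?r j (x j))\<^sup>2)) \<partial>PiM I (\<lambda>_. ?P))"
    by (simp add: prod_ennreal prod_power_distrib)
  also have "\<dots> = (\<Prod>j\<in>I. \<integral>\<^sup>+x. ennreal ((1 - p j + p j * ?r j x)\<^sup>2) \<partial>?P)"
    by (rule PP.product_nn_integral_prod[OF I]) measurable
  also have "\<dots> \<le> (\<Prod>j\<in>I. ennreal (exp ((p j)\<^sup>2 * B j)))"
  proof (intro prod_mono_ennreal)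
    fix j assume j: "j \<in> I"
    note pj = p[OF j]
    have "(\<integral>\<^sup>+x. ennreal ((1 - p j + p j * ?r j x)\<^sup>2) \<partial>?P)
        = (\<integral>\<^sup>+x. ennreal ((1 - p j)\<^sup>2) + (ennreal (2 * p j * (1 - p j)) * ennreal (?r j x)
            + ennreal ((p j)\<^sup>2) * ennreal ((?r j x)\<^sup>2)) \<partial>?P)"
    proof (intro nn_integral_cong)
      fix x
      have "(1 - p j + p j * ?r j x)\<^sup>2 = (1 - p j)\<^sup>2 + (2 * p j * (1 - p j) * ?r j x + (p j)\<^sup>2 * (?r j x)\<^sup>2)"
        by (simp add: power2_eq_square algebra_simps)
      then show "ennreal ((1 - p j + p j * ?r j x)\<^sup>2) = ennreal ((1 - p j)\<^sup>2) +
          (ennreal (2 * p j * (1 - p j)) * ennreal (?r j x) + ennreal ((p j)\<^sup>2) * ennreal ((?r j x)\<^sup>2))"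
        using pj shift_ratio_pos[of \<alpha> c "v j" x]
        by (simp add: ennreal_mult'[symmetric] ennreal_plus[symmetric] del: ennreal_plus)
    qed
    also have "\<dots> = ennreal ((1 - p j)\<^sup>2) + (ennreal (2 * p j * (1 - p j)) * 1
        + ennreal ((p j)\<^sup>2) * (\<integral>\<^sup>+x. ennreal ((?r j x)\<^sup>2) \<partial>?P))"
      using P.emeasure_space_1 nn_integral_shift_ratio[OF \<alpha> a c total, of "v j"]
      by (simp add: nn_integral_add nn_integral_cmult)
    also have "\<dots> \<le> ennreal ((1 - p j)\<^sup>2) + (ennreal (2 * p j * (1 - p j)) * 1
        + ennreal ((p j)\<^sup>2) * ennreal (B j))"
      using B[OF j] by (intro add_mono mult_left_mono) auto
    also have "\<dots> = ennreal ((1 - p j)\<^sup>2 + (2 * p j * (1 - p j) + (p j)\<^sup>2 * B j))"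
      using pj B0[OF j] by (simp add: ennreal_mult'[symmetric] ennreal_plus[symmetric] del: ennreal_plus)
    also have "(1 - p j)\<^sup>2 + (2 * p j * (1 - p j) + (p j)\<^sup>2 * B j) \<le> 1 + (p j)\<^sup>2 * B j"
      by (simp add: power2_eq_square algebra_simps)
    also have "1 + (p j)\<^sup>2 * B j \<le> exp ((p j)\<^sup>2 * B j)" by (rule exp_ge_add_one_self)
    finally show "(\<integral>\<^sup>+x. ennreal ((1 - p j + p j * ?r j x)\<^sup>2) \<partial>?P) \<le> ennreal (exp ((p j)\<^sup>2 * B j))"
      by (simp add: ennreal_leI)
  qed
  also have "\<dots> = ennreal (exp (\<Sum>j\<in>I. (p j)\<^sup>2 * B j))"
    by (simp add: prod_ennreal exp_sum[OF I])
  finally show ?thesis .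
qed

text \<open>The fuzzy-hypotheses bound for the Bernoulli prior cut off at cardinality
  \<open>s\<close>. The definition of \<open>\<kappa>\<close> gives
  \<open>(2 * \<kappa>) powr \<alpha> = 1 / (C * c)\<close>, so a shift
  \<open>\<kappa> * (1 + u)\<close> costs at most \<open>A * exp (1 + u powr \<alpha>)\<close>. The
  constant 32 is 16 from the square of the prior mean, which is at least \<open>\<kappa> / 4\<close>
  times the square root of \<open>Phi_o\<close>, times 2 from the bound.\<close>

lemma exp_power_noise_minimax_bound:
  fixes \<alpha> a c C :: real
  assumes \<alpha>: "\<alpha> > 0" and a: "a > 0" and c: "c > 0" and C: "C > 0"
    and total: "(\<integral>x. a * exp (- c * \<bar>x\<bar> powr \<alpha>) \<partial>lborel) = 1"
    and add: "\<And>u v. u \<ge> 0 \<Longrightarrow> v \<ge> 0 \<Longrightarrow> (u + v) powr \<alpha> \<le> 3 / 2 * u powr \<alpha> + C * v powr \<alpha>"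
  defines "\<kappa> \<equiv> (1 / (C * c)) powr (1 / \<alpha>) / 2"
    and "A \<equiv> \<integral>x. a * exp (- (c / 2) * \<bar>x\<bar> powr \<alpha>) \<partial>lborel"
  assumes load: "loading_vector d \<eta>" and d: "d \<ge> 1" and \<sigma>: "\<sigma> > 0" and s: "s \<ge> 1"
    and T: "T \<in> estimators d" and R: "R \<ge> 0"
    and risk: "\<And>\<theta>. \<theta> \<in> sparse_class d s \<Longrightarrow>
      risk d \<eta> \<sigma> T \<theta> (PiM {1..d} (\<lambda>_. exp_power_noise \<alpha> a c)) \<le> ennreal R"
  shows "\<kappa>\<^sup>2 / (32 * (1 + exp (A * exp 1))) * \<sigma>\<^sup>2 * Phi_o d \<eta> \<alpha> (real s) \<le> R"
proof -
  let ?P = "exp_power_noise \<alpha> a c"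
  let ?M = "PiM {1..d} (\<lambda>_. ?P)"
  define lam \<nu> where "lam = lambda_o d \<eta> \<alpha> (real s)" and "\<nu> = nu_o d \<eta> \<alpha> (real s)"
  define u where "u j = lam / \<bar>\<eta> j\<bar>" for j
  define e where "e j = exp (- (u j powr \<alpha>))" for j
  define p where "p j = \<bar>\<eta> j\<bar> * e j / \<nu>" for j
  \<comment> \<open>The sign makes \<open>\<eta> j * v j = l j\<close> nonnegative, so the selected
    coordinates never cancel in the linear functional.\<close>
  define v where "v j = sgn (\<eta> j) * (\<kappa> * (1 + u j))" for j
  define l where "l j = \<bar>\<eta> j\<bar> * (\<kappa> * (1 + u j))" for j
  interpret P: prob_space ?P
    by (rule prob_space_exp_power_noise) (use assms in auto)
  interpret PP: product_prob_space "\<lambda>_. ?P" by unfold_locales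
  have s0: "real s > 0" using s by simp
  note pos = loading_vector_pos[OF load]
  have lam: "lam \<ge> 0" by (simp add: lam_def lambda_o_nonneg)
  have \<nu>: "\<nu> > 0" unfolding \<nu>_def by (rule nu_o_pos[OF load d])
  have u: "u j \<ge> 0" for j using lam by (simp add: u_def)
  have \<kappa>: "\<kappa> > 0" using C c by (simp add: \<kappa>_def)
  have A: "A \<ge> 0" unfolding A_def using a by (intro integral_nonneg_AE) auto
  have \<nu>2: "\<nu>\<^sup>2 = (\<Sum>j=1..d. (\<eta> j)\<^sup>2 * e j)"
    unfolding \<nu>_def e_def u_def lam_def by (rule nu_o_square)
  have e: "e j > 0" "e j \<le> 1" for j by (simp_all add: e_def)
  have p2: "(p j)\<^sup>2 / e j = (\<eta> j)\<^sup>2 * e j / \<nu>\<^sup>2" for j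
    using e[of j] by (simp add: p_def power_divide power_mult_distrib power2_eq_square[of "e j"])
  have p2sum: "(\<Sum>j=1..d. (p j)\<^sup>2 / e j) = 1"
    unfolding p2 sum_divide_distrib[symmetric] \<nu>2[symmetric] using \<nu> by simp
  have p: "0 \<le> p j \<and> p j \<le> 1" if j: "j \<in> {1..d}" for j
  proof
    show "0 \<le> p j" using \<nu> e[of j] by (simp add: p_def)
    \<comment> \<open>Each \<open>p j\<close> is a probability because its square is below a single
      term of a nonnegative sum equal to 1.\<close>
    have "(p j)\<^sup>2 \<le> (p j)\<^sup>2 / e j" using e[of j] by (simp add: field_simps mult_left_le_one_le)
    also have "\<dots> \<le> (\<Sum>j=1..d. (p j)\<^sup>2 / e j)"
      using j e(1) by (intro member_le_sum divide_nonneg_pos) auto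
    finally show "p j \<le> 1" using p2sum power2_le_imp_le[of "p j" 1] by simp
  qed
  have N: "(\<Sum>j=1..d. \<bar>\<eta> j\<bar> * e j) \<le> s / 2 * \<nu>" "lam > 0 \<Longrightarrow> (\<Sum>j=1..d. \<bar>\<eta> j\<bar> * e j) = s / 2 * \<nu>"
    using weighted_sum_le_nu_o[OF load d \<alpha> s0] by (simp_all add: e_def u_def lam_def \<nu>_def)
  have psum: "(\<Sum>j=1..d. p j) \<le> s / 2"
    using N(1) \<nu> unfolding p_def sum_divide_distrib[symmetric] by (simp add: field_simps)
  have lpsum: "(\<Sum>j=1..d. l j * p j) = \<kappa> * (\<nu> + lam * s / 2)"
  proof -
    have "(\<Sum>j=1..d. l j * p j) = (\<Sum>j=1..d. \<kappa> / \<nu> * ((\<eta> j)\<^sup>2 * e j + lam * (\<bar>\<eta> j\<bar> * e j)))"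
    proof (intro sum.cong refl)
      fix j assume "j \<in> {1..d}"
      then have "\<bar>\<eta> j\<bar> * u j = lam" using pos[of j] by (simp add: u_def)
      then have "l j = \<kappa> * (\<bar>\<eta> j\<bar> + lam)" by (simp add: l_def algebra_simps)
      then have "l j * p j = \<kappa> / \<nu> * ((\<bar>\<eta> j\<bar>)\<^sup>2 * e j + lam * (\<bar>\<eta> j\<bar> * e j))"
        by (simp add: p_def power2_eq_square algebra_simps add_divide_distrib)
      then show "l j * p j = \<kappa> / \<nu> * ((\<eta> j)\<^sup>2 * e j + lam * (\<bar>\<eta> j\<bar> * e j))" by simp
    qed
    also have "\<dots> = \<kappa> / \<nu> * (\<nu>\<^sup>2 + lam * (\<Sum>j=1..d. \<bar>\<eta> j\<bar> * e j))"
      by (simp only: sum_distrib_left[symmetric] sum.distrib \<nu>2)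
    \<comment> \<open>For \<open>lam = 0\<close> both sides vanish, and for \<open>lam > 0\<close>
      the equality case of the \<beta> equation applies.\<close>
    also have "lam * (\<Sum>j=1..d. \<bar>\<eta> j\<bar> * e j) = lam * (s / 2 * \<nu>)"
      using N(2) lam by (cases "lam = 0") auto
    also have "\<kappa> / \<nu> * (\<nu>\<^sup>2 + lam * (s / 2 * \<nu>)) = \<kappa> * (\<nu> + lam * s / 2)"
      using \<nu> by (simp add: field_simps power2_eq_square)
    finally show ?thesis .
  qed
  have chi: "(\<integral>\<^sup>+x. ennreal ((shift_ratio \<alpha> c (v j) x)\<^sup>2) \<partial>?P) \<le> ennreal (A * exp 1 / e j)"
    if j: "j \<in> {1..d}" for j
  proof -
    \<comment> \<open>From \<open>1 + u \<le> 2 * max 1 u\<close>, the powered shift is at most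
      \<open>(1 + u powr \<alpha>) / (C * c)\<close>, so the exponential cost is at most
      \<open>exp 1 / e j\<close>.\<close>
    have "\<bar>v j\<bar> = \<kappa> * (1 + u j)" using pos[OF j] \<kappa> u[of j] by (simp add: v_def abs_mult abs_sgn_eq)
    then have "\<bar>v j\<bar> powr \<alpha> \<le> (2 * \<kappa> * max 1 (u j)) powr \<alpha>"
      using \<kappa> u[of j] \<alpha> by (intro powr_mono2) (auto simp: max_def)
    also have "\<dots> = (2 * \<kappa>) powr \<alpha> * max 1 (u j) powr \<alpha>" using \<kappa> by (simp add: powr_mult)
    also have "(2 * \<kappa>) powr \<alpha> = 1 / (C * c)" using \<alpha> C c by (simp add: \<kappa>_def powr_powr)
    also have "max 1 (u j) powr \<alpha> \<le> 1 + u j powr \<alpha>" by (simp add: max_def)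
    finally have "\<bar>v j\<bar> powr \<alpha> \<le> 1 / (C * c) * (1 + u j powr \<alpha>)"
      using C c by (simp add: mult_left_mono divide_right_mono)
    then have "C * c * \<bar>v j\<bar> powr \<alpha> \<le> C * c * (1 / (C * c) * (1 + u j powr \<alpha>))"
      using C c by (intro mult_left_mono) auto
    also have "\<dots> = 1 + u j powr \<alpha>" using C c by simp
    finally have "exp (C * c * \<bar>v j\<bar> powr \<alpha>) \<le> exp (1 + u j powr \<alpha>)" by simp
    also have "\<dots> = exp 1 / e j" by (simp add: e_def exp_add exp_minus field_simps)
    finally have "A * exp (C * c * \<bar>v j\<bar> powr \<alpha>) \<le> A * (exp 1 / e j)"
      using A by (intro mult_left_mono) auto
    then show ?thesis
      using nn_integral_shift_ratio_square_le[OF \<alpha> a c add, of "v j"] unfolding A_def[symmetric]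
      by (auto intro: order_trans ennreal_leI)
  qed
  \<comment> \<open>The likelihood ratio for support \<open>S\<close>. Coordinates outside
    \<open>S\<close> carry shift 0, hence ratio 1, so that the product runs over all of
    \<open>{1..d}\<close> and the product-space results apply.\<close>
  define q where "q S x = (\<Prod>j=1..d. shift_ratio \<alpha> c (if j \<in> S then v j else 0) (x j))" for S x
  define F where "F = {S \<in> Pow {1..d}. card S \<le> s}"
  define \<mu> where "\<mu> = bernoulli_weight {1..d} p"
  \<comment> \<open>The problem is rescaled to unit noise level; risks are divided by
    \<open>\<sigma>^2\<close> accordingly.\<close>
  define T0 where "T0 x = T (\<lambda>j\<in>{1..d}. \<sigma> * x j) / \<sigma>" for x
  define L where "L S = (\<Sum>j\<in>S. l j)" for S
  have finF: "finite F" by (simp add: F_def)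
  have \<mu>0: "\<mu> S \<ge> 0" if "S \<subseteq> {1..d}" for S
    unfolding \<mu>_def using that p by (rule bernoulli_weight_nonneg)
  have q0: "q S x \<ge> 0" for S x
    unfolding q_def by (intro prod_nonneg less_imp_le[OF shift_ratio_pos] ballI)
  have qS: "q S x = (\<Prod>j\<in>S. shift_ratio \<alpha> c (v j) (x j))" if "S \<subseteq> {1..d}" for S x
    unfolding q_def using that
    by (intro prod.mono_neutral_cong_right) (auto simp: shift_ratio_def)
  have ratio0: "shift_ratio \<alpha> c 0 x = 1" for x by (simp add: shift_ratio_def)
  have qm [measurable]: "q S \<in> borel_measurable ?M" for S unfolding q_def by measurable
  have q1: "(\<integral>\<^sup>+x. ennreal (q S x) \<partial>?M) = 1" for S
  proof -
    have "(\<integral>\<^sup>+x. ennreal (q S x) \<partial>?M)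
        = (\<integral>\<^sup>+x. (\<Prod>j\<in>{1..d}. ennreal (shift_ratio \<alpha> c (if j \<in> S then v j else 0) (x j))) \<partial>?M)"
      by (simp add: q_def prod_ennreal less_imp_le[OF shift_ratio_pos])
    also have "\<dots> = (\<Prod>j\<in>{1..d}. \<integral>\<^sup>+x. ennreal (shift_ratio \<alpha> c (if j \<in> S then v j else 0) x) \<partial>?P)"
      by (rule PP.product_nn_integral_prod) measurable
    also have "\<dots> = 1" by (simp only: nn_integral_shift_ratio[OF \<alpha> a c total] prod.neutral_const)
    finally show ?thesis .
  qed
  have scale: "(\<lambda>x. \<lambda>j\<in>{1..d}. \<sigma> * x j) \<in> measurable (sample_space d) (sample_space d)"
    by (intro measurable_restrict borel_measurable_times borel_measurable_const
        measurable_component_singleton)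
  have T0b [measurable]: "T0 \<in> borel_measurable (sample_space d)"
    unfolding T0_def by (intro borel_measurable_divide measurable_compose[OF scale T] borel_measurable_const)
  have setsM: "sets ?M = sets (sample_space d)" by (intro sets_PiM_cong) auto
  have T0m [measurable]: "T0 \<in> borel_measurable ?M"
    using T0b by (subst measurable_cong_sets[OF setsM refl])
  \<comment> \<open>Change of measure: weighting by \<open>q S\<close> amounts to shifting the noise
    by \<open>w\<close>, and multiplication by \<open>\<sigma>\<close> then gives the observation
    with parameter \<open>\<theta> = \<sigma> w\<close>, which is sparse because
    \<open>card S \<le> s\<close>.\<close>
  have R1: "(\<integral>\<^sup>+x. ennreal (q S x * (T0 x - L S)\<^sup>2) \<partial>?M) \<le> ennreal (R / \<sigma>\<^sup>2)" if S: "S \<in> F" for S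
  proof -
    define w where "w j = (if j \<in> S then v j else 0)" for j
    define \<theta> where "\<theta> = (\<lambda>j\<in>{1..d}. \<sigma> * w j)"
    have SI: "S \<subseteq> {1..d}" and cS: "card S \<le> s" using S by (auto simp: F_def)
    have "{j \<in> {1..d}. \<theta> j \<noteq> 0} \<subseteq> S" by (auto simp: \<theta>_def w_def split: if_splits)
    then have "card {j \<in> {1..d}. \<theta> j \<noteq> 0} \<le> card S"
      using SI finite_subset by (intro card_mono) auto
    then have \<theta>: "\<theta> \<in> sparse_class d s" using cS by (simp add: sparse_class_def \<theta>_def)
    have Lin: "linear_functional d \<eta> \<theta> = \<sigma> * L S"
    proof -
      have "linear_functional d \<eta> \<theta> = (\<Sum>j=1..d. \<sigma> * (if j \<in> S then l j else 0))"
        unfolding linear_functional_def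
        by (intro sum.cong refl)
          (simp add: \<theta>_def w_def v_def l_def linordered_idom_class.abs_sgn mult_ac)
      also have "\<dots> = (\<Sum>j\<in>S. \<sigma> * l j)"
        using SI by (intro sum.mono_neutral_cong_right) auto
      finally show ?thesis by (simp add: L_def sum_distrib_left)
    qed
    have "(\<integral>\<^sup>+x. ennreal (q S x * (T0 x - L S)\<^sup>2) \<partial>?M)
        = (\<integral>\<^sup>+x. ennreal (q S x) * ennreal ((T0 x - L S)\<^sup>2) \<partial>?M)"
      by (simp add: ennreal_mult' q0)
    also have "\<dots> = (\<integral>\<^sup>+x. ennreal ((T0 x - L S)\<^sup>2) \<partial>density ?M (\<lambda>x. ennreal (q S x)))"
      by (rule nn_integral_density[symmetric]) measurable
    also have "density ?M (\<lambda>x. ennreal (q S x)) = distr ?M (sample_space d) (\<lambda>x. \<lambda>j\<in>{1..d}. w j + x j)"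
      unfolding q_def w_def
      by (rule distr_shift_PiM_exp_power_noise[OF \<alpha> a c _ total, symmetric]) simp
    also have "(\<integral>\<^sup>+x. ennreal ((T0 x - L S)\<^sup>2) \<partial>\<dots>)
        = (\<integral>\<^sup>+x. ennreal ((T0 (\<lambda>j\<in>{1..d}. w j + x j) - L S)\<^sup>2) \<partial>?M)"
    proof (rule nn_integral_distr)
      show "(\<lambda>x. \<lambda>j\<in>{1..d}. w j + x j) \<in> measurable ?M (sample_space d)"
        by (subst measurable_cong_sets[OF setsM refl])
          (intro measurable_restrict borel_measurable_add borel_measurable_const
            measurable_component_singleton)
    qed measurable
    also have "\<dots> = (\<integral>\<^sup>+x. ennreal (1 / \<sigma>\<^sup>2) *
        ennreal ((T (\<lambda>j\<in>{1..d}. \<theta> j + \<sigma> * x j) - linear_functional d \<eta> \<theta>)\<^sup>2) \<partial>?M)"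
    proof (intro nn_integral_cong)
      fix x
      have "(\<lambda>j\<in>{1..d}. \<sigma> * (\<lambda>j\<in>{1..d}. w j + x j) j) = (\<lambda>j\<in>{1..d}. \<theta> j + \<sigma> * x j)"
        by (intro restrict_ext) (simp add: \<theta>_def algebra_simps)
      then have "T0 (\<lambda>j\<in>{1..d}. w j + x j) - L S
          = (T (\<lambda>j\<in>{1..d}. \<theta> j + \<sigma> * x j) - linear_functional d \<eta> \<theta>) / \<sigma>"
        unfolding T0_def Lin using \<sigma> by (simp add: diff_divide_distrib)
      then show "ennreal ((T0 (\<lambda>j\<in>{1..d}. w j + x j) - L S)\<^sup>2) = ennreal (1 / \<sigma>\<^sup>2) *
          ennreal ((T (\<lambda>j\<in>{1..d}. \<theta> j + \<sigma> * x j) - linear_functional d \<eta> \<theta>)\<^sup>2)"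
        by (simp add: power_divide ennreal_mult'[symmetric])
    qed
    also have "\<dots> = ennreal (1 / \<sigma>\<^sup>2) * risk d \<eta> \<sigma> T \<theta> ?M"
    proof -
      have sh: "(\<lambda>x. \<lambda>j\<in>{1..d}. \<theta> j + \<sigma> * x j) \<in> measurable ?M (sample_space d)"
        by (subst measurable_cong_sets[OF setsM refl])
          (intro measurable_restrict borel_measurable_add borel_measurable_times borel_measurable_const
            measurable_component_singleton)
      have [measurable]: "(\<lambda>x. T (\<lambda>j\<in>{1..d}. \<theta> j + \<sigma> * x j)) \<in> borel_measurable ?M"
        by (rule measurable_compose[OF sh T])
      show ?thesis
        by (subst risk_eq_nn_integral[OF T], simp) (rule nn_integral_cmult, measurable)
    qed
    also have "\<dots> \<le> ennreal (1 / \<sigma>\<^sup>2) * ennreal R" by (intro mult_left_mono risk \<theta>) auto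
    also have "\<dots> = ennreal (R / \<sigma>\<^sup>2)" by (simp add: ennreal_mult'[symmetric])
    finally show ?thesis .
  qed
  have "(\<Sum>S\<in>F. \<mu> S * L S)\<^sup>2 / (2 * (1 + exp (A * exp 1))) \<le> R / \<sigma>\<^sup>2"
  proof (rule fuzzy_hypotheses_bound[OF finF, where M = ?M and q = q and T = T0])
    have "(\<Sum>S\<in>F. \<mu> S) \<le> (\<Sum>S\<in>Pow {1..d}. \<mu> S)"
      using \<mu>0 by (intro sum_mono2) (auto simp: F_def)
    also have "\<dots> = 1"
      using sum_bernoulli_weight_prod[of "{1..d}" p "\<lambda>_. 1"] by (simp add: \<mu>_def)
    finally show "(\<Sum>S\<in>F. \<mu> S) \<le> 1" .
    show "L S \<ge> 0" if "S \<in> F" for S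
      unfolding L_def l_def using \<kappa> u by (intro sum_nonneg mult_nonneg_nonneg) auto
    \<comment> \<open>All terms are nonnegative, so the cut-off mixture lies below the full one, and
      only the full one factors over coordinates.\<close>
    have "(\<integral>\<^sup>+x. ennreal ((\<Sum>S\<in>F. \<mu> S * q S x)\<^sup>2) \<partial>?M)
        \<le> (\<integral>\<^sup>+x. ennreal ((\<Prod>j=1..d. 1 - p j + p j * shift_ratio \<alpha> c (v j) (x j))\<^sup>2) \<partial>?M)"
    proof (intro nn_integral_mono ennreal_leI power_mono)
      fix x
      have "(\<Sum>S\<in>F. \<mu> S * q S x) \<le> (\<Sum>S\<in>Pow {1..d}. \<mu> S * q S x)"
        using \<mu>0 q0 by (intro sum_mono2) (auto simp: F_def)
      also have "\<dots> = (\<Sum>S\<in>Pow {1..d}. \<mu> S * (\<Prod>j\<in>S. shift_ratio \<alpha> c (v j) (x j)))"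
        by (intro sum.cong refl) (simp add: qS)
      also have "\<dots> = (\<Prod>j=1..d. 1 - p j + p j * shift_ratio \<alpha> c (v j) (x j))"
        unfolding \<mu>_def by (rule sum_bernoulli_weight_prod) simp
      finally show "(\<Sum>S\<in>F. \<mu> S * q S x) \<le> (\<Prod>j=1..d. 1 - p j + p j * shift_ratio \<alpha> c (v j) (x j))" .
      show "(\<Sum>S\<in>F. \<mu> S * q S x) \<ge> 0"
        using \<mu>0 q0 by (intro sum_nonneg mult_nonneg_nonneg) (auto simp: F_def)
    qed
    also have "\<dots> \<le> ennreal (exp (\<Sum>j=1..d. (p j)\<^sup>2 * (A * exp 1 / e j)))"
      using A e(1) by (intro nn_integral_mixture_square_le[OF \<alpha> a c _ total] p chi divide_nonneg_pos
          mult_nonneg_nonneg) auto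
    also have "(\<Sum>j=1..d. (p j)\<^sup>2 * (A * exp 1 / e j)) = A * exp 1"
    proof -
      have "(\<Sum>j=1..d. (p j)\<^sup>2 * (A * exp 1 / e j)) = (\<Sum>j=1..d. A * exp 1 * ((p j)\<^sup>2 / e j))"
        by (intro sum.cong refl) simp
      then show ?thesis by (simp only: sum_distrib_left[symmetric] p2sum)
    qed
    finally show "(\<integral>\<^sup>+x. ennreal ((\<Sum>S\<in>F. \<mu> S * q S x)\<^sup>2) \<partial>?M) \<le> ennreal (exp (A * exp 1))" .
    \<comment> \<open>The empty support is the null hypothesis \<open>\<theta> = 0\<close>: its
      likelihood ratio is 1 and its functional is 0.\<close>
    have "{} \<in> F" by (simp add: F_def)
    from R1[OF this] show "(\<integral>\<^sup>+x. ennreal ((T0 x)\<^sup>2) \<partial>?M) \<le> ennreal (R / \<sigma>\<^sup>2)"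
      by (simp add: q_def L_def ratio0)
    show "T0 \<in> borel_measurable ?M" "\<And>S. q S \<in> borel_measurable ?M" by (rule T0m qm)+
  qed (use \<mu>0 q0 q1 R1 R in \<open>auto simp: F_def\<close>)
  moreover have "(\<kappa> * (lam * s + \<nu>) / 4)\<^sup>2 \<le> (\<Sum>S\<in>F. \<mu> S * L S)\<^sup>2"
  proof (rule power_mono)
    \<comment> \<open>The factor 4 combines the \<open>s / 2\<close> in the prior mean with the half
      lost to the cardinality constraint.\<close>
    have "\<kappa> * (lam * s + \<nu>) / 4 \<le> \<kappa> * (\<nu> + lam * s / 2) / 2"
      using \<kappa> \<nu> lam s by (simp add: field_simps)
    also have "\<dots> \<le> (\<Sum>S\<in>F. \<mu> S * L S)"
      unfolding F_def \<mu>_def L_def lpsum[symmetric]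
      using p psum s \<kappa> u by (intro sum_bernoulli_weight_sparse_ge) (auto simp: l_def)
    finally show "\<kappa> * (lam * s + \<nu>) / 4 \<le> (\<Sum>S\<in>F. \<mu> S * L S)" .
    show "0 \<le> \<kappa> * (lam * s + \<nu>) / 4" using \<kappa> \<nu> lam by simp
  qed
  moreover have K: "1 + exp (A * exp 1) > 0" by (intro add_pos_pos) auto
  ultimately have "(\<kappa> * (lam * s + \<nu>) / 4)\<^sup>2 / (2 * (1 + exp (A * exp 1))) \<le> R / \<sigma>\<^sup>2"
    by (meson divide_right_mono order_trans less_imp_le mult_pos_pos zero_less_numeral)
  then have "(\<kappa> * (lam * s + \<nu>) / 4)\<^sup>2 / (2 * (1 + exp (A * exp 1))) * \<sigma>\<^sup>2 \<le> R"
    using \<sigma> by (simp add: pos_le_divide_eq)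
  moreover have "(\<kappa> * (lam * s + \<nu>) / 4)\<^sup>2 / (2 * (1 + exp (A * exp 1))) * \<sigma>\<^sup>2
      = \<kappa>\<^sup>2 / (32 * (1 + exp (A * exp 1))) * \<sigma>\<^sup>2 * (lam * s + \<nu>)\<^sup>2"
    by (simp add: power_mult_distrib power_divide)
  ultimately show ?thesis by (simp add: Phi_o_def lam_def \<nu>_def)
qed

section \<open>The upper bound\<close>

lemma noise_class_tail:
  assumes "P \<in> noise_class \<alpha> \<tau>" "t \<ge> 0"
  shows "emeasure P {w. t \<le> \<bar>w\<bar>} \<le> ennreal (2 * exp (- 2 * (t / \<tau>) powr \<alpha>))"
proof -
  have "prob_space P" using assms by (simp add: noise_class_def)
  then interpret prob_space P .
  show ?thesis using assms by (simp add: noise_class_def emeasure_eq_measure ennreal_leI)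
qed

text \<open>Since \<open>x ^ 4\<close> is at most \<open>(k + 1) ^ 4\<close> for \<open>k\<close>
  the integer part of \<open>|x|\<close>, the moment is bounded by a series of tail probabilities.
  Only the tail condition enters, so the bound is uniform over the class.\<close>

lemma noise_class_fourth_moment:
  fixes \<alpha> \<tau> :: real
  assumes \<alpha>: "\<alpha> > 0" and \<tau>: "\<tau> > 0"
  shows "\<exists>K\<ge>0. \<forall>P\<in>noise_class \<alpha> \<tau>. (\<integral>\<^sup>+x. ennreal (x ^ 4) \<partial>P) \<le> ennreal K"
proof -
  define c where "c = 2 / \<tau> powr \<alpha>"
  have c: "c > 0" using \<tau> by (simp add: c_def)
  define f where "f k = (real k + 1) ^ 4 * (2 * exp (- 2 * (real k / \<tau>) powr \<alpha>))" for k
  have f0: "f k \<ge> 0" for k by (simp add: f_def)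
  have e: "exp (- 2 * (real k / \<tau>) powr \<alpha>) = exp (- c * \<bar>real k\<bar> powr \<alpha>)" for k
    using \<tau> by (simp add: c_def powr_divide)
  obtain K0 where K0: "K0 > 0" "\<And>x. \<bar>x\<bar> ^ 0 * exp (- c * \<bar>x\<bar> powr \<alpha>) \<le> K0 * inverse (1 + x\<^sup>2)"
    using power_exp_powr_le[OF \<alpha> c] by blast
  obtain K4 where K4: "K4 > 0" "\<And>x. \<bar>x\<bar> ^ 4 * exp (- c * \<bar>x\<bar> powr \<alpha>) \<le> K4 * inverse (1 + x\<^sup>2)"
    using power_exp_powr_le[OF \<alpha> c] by blast
  have "summable f"
  proof (rule summable_comparison_test')
    show "summable (\<lambda>k. 32 * (K0 + K4) * inverse (real k ^ 2))"
      using inverse_power_summable[of 2, where ?'a = real] by (intro summable_mult) simp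
    fix k :: nat assume k: "1 \<le> k"
    have "(real k + 1) ^ 4 \<le> (2 * real k) ^ 4" using k by (intro power_mono) auto
    also have "\<dots> \<le> 16 * (\<bar>real k\<bar> ^ 0 + \<bar>real k\<bar> ^ 4)" by simp
    finally have "f k \<le> 16 * (\<bar>real k\<bar> ^ 0 + \<bar>real k\<bar> ^ 4) * (2 * exp (- c * \<bar>real k\<bar> powr \<alpha>))"
      unfolding f_def e by (intro mult_right_mono) auto
    also have "\<dots> = 32 * (\<bar>real k\<bar> ^ 0 * exp (- c * \<bar>real k\<bar> powr \<alpha>)
        + \<bar>real k\<bar> ^ 4 * exp (- c * \<bar>real k\<bar> powr \<alpha>))"
      by (simp add: algebra_simps)
    also have "\<dots> \<le> 32 * (K0 * inverse (1 + (real k)\<^sup>2) + K4 * inverse (1 + (real k)\<^sup>2))"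
      by (intro mult_left_mono add_mono K0 K4) auto
    also have "\<dots> = 32 * (K0 + K4) * inverse (1 + (real k)\<^sup>2)" by (simp add: algebra_simps)
    also have "\<dots> \<le> 32 * (K0 + K4) * inverse (real k ^ 2)"
      using k K0 K4 by (intro mult_left_mono le_imp_inverse_le) auto
    finally show "norm (f k) \<le> 32 * (K0 + K4) * inverse (real k ^ 2)" using f0[of k] by simp
  qed
  then have sumf: "(\<Sum>k. ennreal (f k)) = ennreal (suminf f)"
    by (intro suminf_ennreal2 f0)
  have "(\<integral>\<^sup>+x. ennreal (x ^ 4) \<partial>P) \<le> ennreal (suminf f)" if P: "P \<in> noise_class \<alpha> \<tau>" for P
  proof -
    have setsP[measurable_cong]: "sets P = sets borel" using P by (simp add: noise_class_def)
    have "(\<integral>\<^sup>+x. ennreal (x ^ 4) \<partial>P)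
        \<le> (\<integral>\<^sup>+x. (\<Sum>k. ennreal ((real k + 1) ^ 4) * indicator {w. real k \<le> \<bar>w\<bar>} x) \<partial>P)"
    proof (intro nn_integral_mono)
      fix x :: real
      define k where "k = nat \<lfloor>\<bar>x\<bar>\<rfloor>"
      have k: "real k \<le> \<bar>x\<bar>" "\<bar>x\<bar> \<le> real k + 1" unfolding k_def by linarith+
      have "x ^ 4 = \<bar>x\<bar> ^ 4" by simp
      also have "\<dots> \<le> (real k + 1) ^ 4" using k by (intro power_mono) auto
      finally have "ennreal (x ^ 4) \<le> ennreal ((real k + 1) ^ 4) * indicator {w. real k \<le> \<bar>w\<bar>} x"
        using k by (simp add: ennreal_leI)
      \<comment> \<open>The single term at the integer part of \<open>|x|\<close> already bounds
        \<open>x ^ 4\<close>; the remaining terms of the series are nonnegative.\<close>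
      also have "\<dots> = (\<Sum>i\<in>{k}. ennreal ((real i + 1) ^ 4) * indicator {w. real i \<le> \<bar>w\<bar>} x)"
        by (simp only: sum.insert finite.emptyI empty_iff not_False_eq_True sum.empty add_0_right)
      also have "\<dots> \<le> (\<Sum>k. ennreal ((real k + 1) ^ 4) * indicator {w. real k \<le> \<bar>w\<bar>} x)"
        by (intro sum_le_suminf) auto
      finally show "ennreal (x ^ 4) \<le> (\<Sum>k. ennreal ((real k + 1) ^ 4) * indicator {w. real k \<le> \<bar>w\<bar>} x)" .
    qed
    also have "\<dots> = (\<Sum>k. \<integral>\<^sup>+x. ennreal ((real k + 1) ^ 4) * indicator {w. real k \<le> \<bar>w\<bar>} x \<partial>P)"
      by (rule nn_integral_suminf) measurable
    also have "\<dots> = (\<Sum>k. ennreal ((real k + 1) ^ 4) * emeasure P {w. real k \<le> \<bar>w\<bar>})"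
      by (intro suminf_cong nn_integral_cmult_indicator) measurable
    also have "\<dots> \<le> (\<Sum>k. ennreal (f k))"
    proof (intro suminf_le)
      fix k
      have "ennreal ((real k + 1) ^ 4) * emeasure P {w. real k \<le> \<bar>w\<bar>}
          \<le> ennreal ((real k + 1) ^ 4) * ennreal (2 * exp (- 2 * (real k / \<tau>) powr \<alpha>))"
        by (intro mult_left_mono noise_class_tail P) auto
      also have "\<dots> = ennreal (f k)" by (simp add: f_def ennreal_mult'[symmetric])
      finally show "ennreal ((real k + 1) ^ 4) * emeasure P {w. real k \<le> \<bar>w\<bar>} \<le> ennreal (f k)" .
    qed auto
    finally show ?thesis by (simp only: sumf)
  qed
  moreover have "suminf f \<ge> 0" using \<open>summable f\<close> f0 by (rule suminf_nonneg)
  ultimately show ?thesis by blast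
qed

text \<open>With \<open>e = exp (- u^\<alpha>)\<close>, use
  \<open>x^2 \<le> e/2 * x^4 + 1 / (2 e)\<close> on the event \<open>|x| > \<tau> u\<close>. The
  factor 2 in the exponent of the tail condition makes the probability of that event at most
  \<open>2 e^2\<close>, so both terms are of order \<open>e\<close>.\<close>

lemma noise_class_truncated_second_moment:
  fixes \<alpha> \<tau> u K :: real
  assumes P: "P \<in> noise_class \<alpha> \<tau>" and \<tau>: "\<tau> > 0" and u: "u \<ge> 0"
    and K: "(\<integral>\<^sup>+x. ennreal (x ^ 4) \<partial>P) \<le> ennreal K" "K \<ge> 0"
  shows "(\<integral>\<^sup>+x. ennreal (if \<bar>x\<bar> > \<tau> * u then x\<^sup>2 else 0) \<partial>P) \<le> ennreal ((K / 2 + 1) * exp (- (u powr \<alpha>)))"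
proof -
  define e where "e = exp (- (u powr \<alpha>))"
  have e: "e > 0" by (simp add: e_def)
  have setsP[measurable_cong]: "sets P = sets borel" using P by (simp add: noise_class_def)
  have "(\<integral>\<^sup>+x. ennreal (if \<bar>x\<bar> > \<tau> * u then x\<^sup>2 else 0) \<partial>P)
      \<le> (\<integral>\<^sup>+x. ennreal (e / 2) * ennreal (x ^ 4)
          + ennreal (1 / (2 * e)) * indicator {w. \<tau> * u \<le> \<bar>w\<bar>} x \<partial>P)"
  proof (intro nn_integral_mono)
    fix x :: real
    show "ennreal (if \<bar>x\<bar> > \<tau> * u then x\<^sup>2 else 0) \<le> ennreal (e / 2) * ennreal (x ^ 4)
        + ennreal (1 / (2 * e)) * indicator {w. \<tau> * u \<le> \<bar>w\<bar>} x"
    proof (cases "\<bar>x\<bar> > \<tau> * u")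
      case True
      have "0 \<le> (e * x\<^sup>2 - 1)\<^sup>2 / (2 * e)" using e by simp
      also have "\<dots> = e / 2 * x ^ 4 + 1 / (2 * e) - x\<^sup>2"
        using e by (simp add: field_simps power2_eq_square power4_eq_xxxx)
      finally have "x\<^sup>2 \<le> e / 2 * x ^ 4 + 1 / (2 * e)" by simp
      then have "ennreal (x\<^sup>2) \<le> ennreal (e / 2 * x ^ 4 + 1 / (2 * e))" by (rule ennreal_leI)
      also have "\<dots> = ennreal (e / 2) * ennreal (x ^ 4) + ennreal (1 / (2 * e))"
        using e by (simp add: ennreal_mult'[symmetric] ennreal_plus[symmetric] del: ennreal_plus)
      finally show ?thesis using True by simp
    qed simp
  qed
  also have "\<dots> = ennreal (e / 2) * (\<integral>\<^sup>+x. ennreal (x ^ 4) \<partial>P)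
      + ennreal (1 / (2 * e)) * emeasure P {w. \<tau> * u \<le> \<bar>w\<bar>}"
    by (subst nn_integral_add) (measurable, simp add: nn_integral_cmult nn_integral_cmult_indicator)
  also have "\<dots> \<le> ennreal (e / 2) * ennreal K + ennreal (1 / (2 * e)) * ennreal (2 * exp (- 2 * (\<tau> * u / \<tau>) powr \<alpha>))"
    using \<tau> u by (intro add_mono mult_left_mono K noise_class_tail P) auto
  also have "exp (- 2 * (\<tau> * u / \<tau>) powr \<alpha>) = e * e"
    using \<tau> by (simp add: e_def exp_add[symmetric])
  also have "ennreal (e / 2) * ennreal K + ennreal (1 / (2 * e)) * ennreal (2 * (e * e))
      = ennreal ((K / 2 + 1) * e)"
    using e K(2) by (simp add: ennreal_mult'[symmetric] ennreal_plus[symmetric] field_simps del: ennreal_plus)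
  finally show ?thesis by (simp add: e_def)
qed

section \<open>Form and risk of the thresholding estimator\<close>

text \<open>As \<open>|\<eta> j|\<close> is nonincreasing, the indices with
  \<open>|\<eta> j|\<close> at least \<open>lambda_o\<close> form an initial segment, which is
  determined by its maximum.\<close>

lemma le_j1_iff:
  assumes load: "loading_vector d \<eta>" and j: "j \<in> {1..d}"
  shows "j \<le> j1 d \<eta> \<alpha> s \<longleftrightarrow> lambda_o d \<eta> \<alpha> s \<le> \<bar>\<eta> j\<bar>"
proof
  let ?A = "{j \<in> {1..d}. \<bar>\<eta> j\<bar> \<ge> lambda_o d \<eta> \<alpha> s}"
  assume le: "j \<le> j1 d \<eta> \<alpha> s"
  then have "\<exists>j\<in>{1..d}. \<bar>\<eta> j\<bar> \<ge> lambda_o d \<eta> \<alpha> s" using j by (auto simp: j1_def split: if_splits)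
  then have "j1 d \<eta> \<alpha> s = Max ?A" and "?A \<noteq> {}" by (auto simp: j1_def)
  moreover from this have "Max ?A \<in> ?A" by (intro Max_in) auto
  ultimately have "j1 d \<eta> \<alpha> s \<in> ?A" by simp
  moreover from this le load j have "\<bar>\<eta> (j1 d \<eta> \<alpha> s)\<bar> \<le> \<bar>\<eta> j\<bar>"
    by (auto simp: loading_vector_def)
  ultimately show "lambda_o d \<eta> \<alpha> s \<le> \<bar>\<eta> j\<bar>" by simp
next
  let ?A = "{j \<in> {1..d}. \<bar>\<eta> j\<bar> \<ge> lambda_o d \<eta> \<alpha> s}"
  assume le: "lambda_o d \<eta> \<alpha> s \<le> \<bar>\<eta> j\<bar>"
  then have "j \<in> ?A" using j by simp
  then have "j \<le> Max ?A" by (intro Max_ge) auto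
  moreover have "j1 d \<eta> \<alpha> s = Max ?A" using le j by (auto simp: j1_def)
  ultimately show "j \<le> j1 d \<eta> \<alpha> s" by simp
qed

text \<open>Replaces the index cut \<open>j1\<close> by a condition on each coordinate alone, so the
  estimation error becomes a sum of functions of single noise variables.\<close>

lemma threshold_estimator_eq_sum:
  assumes "loading_vector d \<eta>"
  shows "threshold_estimator d \<eta> \<sigma> \<alpha> \<tau> s y = (\<Sum>j=1..d.
    if lambda_o d \<eta> \<alpha> s \<le> \<bar>\<eta> j\<bar> \<or> \<bar>\<eta> j * y j\<bar> > \<sigma> * \<tau> * lambda_o d \<eta> \<alpha> s then \<eta> j * y j else 0)"
proof -
  let ?g = "\<lambda>j. if lambda_o d \<eta> \<alpha> s \<le> \<bar>\<eta> j\<bar> \<or> \<bar>\<eta> j * y j\<bar> > \<sigma> * \<tau> * lambda_o d \<eta> \<alpha> s then \<eta> j * y j else 0"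
  have sets: "{1..d} = {1..j1 d \<eta> \<alpha> s} \<union> {j1 d \<eta> \<alpha> s<..d}" using j1_le[of d \<eta> \<alpha> s] by auto
  have "(\<Sum>j\<in>{1..j1 d \<eta> \<alpha> s}. \<eta> j * y j) = (\<Sum>j\<in>{1..j1 d \<eta> \<alpha> s}. ?g j)"
  proof (intro sum.cong refl)
    fix j assume "j \<in> {1..j1 d \<eta> \<alpha> s}"
    then have "j \<in> {1..d}" "j \<le> j1 d \<eta> \<alpha> s" using j1_le[of d \<eta> \<alpha> s] by auto
    then show "\<eta> j * y j = ?g j" using le_j1_iff[OF assms] by auto
  qed
  moreover have "(\<Sum>j\<in>{j1 d \<eta> \<alpha> s<..d}. \<eta> j * y j * (if \<bar>\<eta> j * y j\<bar> > \<sigma> * \<tau> * lambda_o d \<eta> \<alpha> s then 1 else 0))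
      = (\<Sum>j\<in>{j1 d \<eta> \<alpha> s<..d}. ?g j)"
  proof (intro sum.cong refl)
    fix j assume "j \<in> {j1 d \<eta> \<alpha> s<..d}"
    then have "j \<in> {1..d}" "\<not> j \<le> j1 d \<eta> \<alpha> s" by auto
    then show "\<eta> j * y j * (if \<bar>\<eta> j * y j\<bar> > \<sigma> * \<tau> * lambda_o d \<eta> \<alpha> s then 1 else 0) = ?g j"
      using le_j1_iff[OF assms, of j \<alpha> s] by auto
  qed
  ultimately show ?thesis
    unfolding threshold_estimator_def sets by (subst sum.union_disjoint) auto
qed

text \<open>The error splits into an odd part over \<open>J\<close> and at most \<open>s\<close>
  biased terms. The constant reflects \<open>(x + y)^2 \<le> 2 x^2 + 2 y^2\<close>, with
  \<open>D\<close> for the odd part and, after Cauchy-Schwarz, \<open>2 (1 + \<tau>^2)\<close> for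
  the biased terms.\<close>

lemma threshold_estimator_risk_le:
  fixes \<alpha> \<tau> K :: real
  assumes \<alpha>: "\<alpha> > 0" and \<tau>: "\<tau> > 0" and K: "K \<ge> 0"
    and moment: "\<And>P. P \<in> noise_class \<alpha> \<tau> \<Longrightarrow> (\<integral>\<^sup>+x. ennreal (x ^ 4) \<partial>P) \<le> ennreal K"
    and load: "loading_vector d \<eta>" and d: "d \<ge> 1" and \<sigma>: "\<sigma> > 0"
    and \<theta>: "\<theta> \<in> sparse_class d s" and Q: "Q \<in> product_noise_class d \<alpha> \<tau>"
  shows "risk d \<eta> \<sigma> (threshold_estimator d \<eta> \<sigma> \<alpha> \<tau> (real s)) \<theta> Q
    \<le> ennreal ((2 * (exp 1 + K / 2 + 1) + 4 * (1 + \<tau>\<^sup>2)) * \<sigma>\<^sup>2 * Phi_o d \<eta> \<alpha> (real s))"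
proof -
  obtain P where QP: "Q = PiM {1..d} P" and P: "\<And>j. j \<in> {1..d} \<Longrightarrow> P j \<in> noise_class \<alpha> \<tau>"
    using Q by (auto simp: product_noise_class_def)
  define lam \<nu> where "lam = lambda_o d \<eta> \<alpha> (real s)" and "\<nu> = nu_o d \<eta> \<alpha> (real s)"
  define e where "e j = exp (- ((lam / \<bar>\<eta> j\<bar>) powr \<alpha>))" for j
  \<comment> \<open>The summand \<open>exp 1\<close> serves the coordinates kept without
    thresholding, where \<open>e j \<ge> exp (- 1)\<close>; the summand \<open>K / 2 + 1\<close>
    serves the thresholded ones.\<close>
  define D where "D = exp 1 + K / 2 + 1"
  define h where "h j x = (if lam \<le> \<bar>\<eta> j\<bar> \<or> \<bar>\<eta> j * (\<sigma> * x)\<bar> > \<sigma> * \<tau> * lam then \<eta> j * (\<sigma> * x) else 0)" for j x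
  define J where "J = {j \<in> {1..d}. lam \<le> \<bar>\<eta> j\<bar> \<or> \<theta> j = 0}"
  define err where "err j x = (if lam \<le> \<bar>\<eta> j\<bar> \<or> \<bar>\<eta> j * (\<theta> j + \<sigma> * x)\<bar> > \<sigma> * \<tau> * lam
    then \<eta> j * (\<theta> j + \<sigma> * x) else 0) - \<eta> j * \<theta> j" for j x
  have lam: "lam \<ge> 0" by (simp add: lam_def lambda_o_nonneg)
  have \<nu>: "\<nu> > 0" unfolding \<nu>_def by (rule nu_o_pos[OF load d])
  have \<nu>2: "\<nu>\<^sup>2 = (\<Sum>j=1..d. (\<eta> j)\<^sup>2 * e j)"
    unfolding \<nu>_def e_def lam_def by (rule nu_o_square)
  have D: "D \<ge> 0" using K by (simp add: D_def)
  have JI: "J \<subseteq> {1..d}" by (auto simp: J_def)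
  note pos = loading_vector_pos[OF load]
  have nc: "prob_space (P j)" "sets (P j) = sets borel" "distr (P j) borel uminus = P j"
    "integrable (P j) (\<lambda>w. w\<^sup>2)" "(\<integral>w. w\<^sup>2 \<partial>P j) = 1" if "j \<in> {1..d}" for j
    using P[OF that] by (auto simp: noise_class_def)
  have var: "(\<integral>\<^sup>+x. ennreal (x\<^sup>2) \<partial>P j) = 1" if "j \<in> {1..d}" for j
    using nn_integral_eq_integral[OF nc(4)[OF that]] nc(5)[OF that] by simp
  have setsM: "sets (PiM {1..d} P) = sets (sample_space d)"
    by (intro sets_PiM_cong) (auto simp: nc)
  have comp: "(\<lambda>\<xi>. f (\<xi> j)) \<in> borel_measurable (PiM {1..d} P)"
    if j: "j \<in> {1..d}" and f: "f \<in> borel_measurable borel" for j and f :: "real \<Rightarrow> real"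
  proof -
    have "(\<lambda>\<xi>. \<xi> j) \<in> borel_measurable (sample_space d)"
      using j by (rule measurable_component_singleton)
    then have "(\<lambda>\<xi>. \<xi> j) \<in> borel_measurable (PiM {1..d} P)"
      by (simp only: measurable_cong_sets[OF setsM refl])
    then show ?thesis using f by (rule measurable_compose)
  qed
  have cardS: "card ({1..d} - J) \<le> s"
  proof -
    have "card ({1..d} - J) \<le> card {j \<in> {1..d}. \<theta> j \<noteq> 0}" by (intro card_mono) (auto simp: J_def)
    also have "\<dots> \<le> s" using \<theta> by (simp add: sparse_class_def)
    finally show ?thesis .
  qed
  \<comment> \<open>On \<open>J\<close> either \<open>\<theta> j = 0\<close>, or the coordinate is
    always kept and \<open>\<theta> j\<close> cancels; in both cases the error is an odd function of
    the noise.\<close>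
  have errJ: "err j x = h j x" if "j \<in> J" for j x
    using that by (auto simp: J_def err_def h_def algebra_simps)
  have err_big: "(err j x)\<^sup>2 \<le> 2 * \<sigma>\<^sup>2 * lam\<^sup>2 * (x\<^sup>2 + \<tau>\<^sup>2)" if j: "j \<in> {1..d} - J" for j x
  proof -
    have \<eta>: "\<bar>\<eta> j\<bar> < lam" using j by (auto simp: J_def)
    \<comment> \<open>\<open>z\<close> is 0 if the coordinate is kept. If it is discarded,
      \<open>z\<close> is the discarded term \<open>\<eta> j * y j\<close>, whose size is at most
      the threshold.\<close>
    define z where "z = \<eta> j * (\<sigma> * x) - err j x"
    have z: "\<bar>z\<bar> \<le> \<sigma> * \<tau> * lam"
      using \<eta> \<sigma> \<tau> lam by (auto simp: z_def err_def algebra_simps)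
    have "(err j x)\<^sup>2 = (\<eta> j * (\<sigma> * x) - z)\<^sup>2" by (simp add: z_def)
    also have "\<dots> \<le> 2 * (\<eta> j * (\<sigma> * x))\<^sup>2 + 2 * z\<^sup>2"
      using zero_le_power2[of "\<eta> j * (\<sigma> * x) + z"] by (simp add: power2_eq_square algebra_simps)
    also have "(\<eta> j * (\<sigma> * x))\<^sup>2 \<le> \<sigma>\<^sup>2 * lam\<^sup>2 * x\<^sup>2"
    proof -
      have "(\<eta> j)\<^sup>2 \<le> lam\<^sup>2" using \<eta> by (simp add: abs_le_square_iff[symmetric])
      then have "(\<eta> j)\<^sup>2 * (\<sigma>\<^sup>2 * x\<^sup>2) \<le> lam\<^sup>2 * (\<sigma>\<^sup>2 * x\<^sup>2)" by (rule mult_right_mono) simp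
      then show ?thesis by (simp add: power_mult_distrib mult_ac)
    qed
    also have "z\<^sup>2 \<le> (\<sigma> * \<tau> * lam)\<^sup>2"
      using z \<sigma> \<tau> lam by (simp add: abs_le_square_iff[symmetric])
    finally show ?thesis by (simp add: power_mult_distrib algebra_simps)
  qed
  have sqh: "(\<integral>\<^sup>+x. ennreal ((h j x)\<^sup>2) \<partial>P j) \<le> ennreal (\<sigma>\<^sup>2 * (\<eta> j)\<^sup>2 * (D * e j))" if j: "j \<in> {1..d}" for j
  proof (cases "lam \<le> \<bar>\<eta> j\<bar>")
    case True
    have [measurable_cong]: "sets (P j) = sets borel" by (rule nc[OF j])
    have "(\<integral>\<^sup>+x. ennreal ((h j x)\<^sup>2) \<partial>P j) = (\<integral>\<^sup>+x. ennreal (\<sigma>\<^sup>2 * (\<eta> j)\<^sup>2) * ennreal (x\<^sup>2) \<partial>P j)"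
      using True by (intro nn_integral_cong) (simp add: h_def power_mult_distrib ennreal_mult'[symmetric] mult_ac)
    also have "\<dots> = ennreal (\<sigma>\<^sup>2 * (\<eta> j)\<^sup>2) * (\<integral>\<^sup>+x. ennreal (x\<^sup>2) \<partial>P j)"
      by (rule nn_integral_cmult) measurable
    also have "\<dots> = ennreal (\<sigma>\<^sup>2 * (\<eta> j)\<^sup>2 * 1)" by (simp add: var[OF j])
    also have "\<dots> \<le> ennreal (\<sigma>\<^sup>2 * (\<eta> j)\<^sup>2 * (D * e j))"
    proof (intro ennreal_leI mult_left_mono)
      \<comment> \<open>Here \<open>lam / |\<eta> j| \<le> 1\<close>, so the weight
        \<open>e j\<close> is bounded below and the full variance is of the allowed order.\<close>
      have "(lam / \<bar>\<eta> j\<bar>) powr \<alpha> \<le> 1 powr \<alpha>" using True lam pos[OF j] \<alpha> by (intro powr_mono2) auto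
      then have "exp (- 1) \<le> e j" by (simp add: e_def)
      then have "exp 1 * exp (- 1) \<le> D * e j" using K by (intro mult_mono) (auto simp: D_def)
      then show "1 \<le> D * e j" by (simp add: exp_add[symmetric])
    qed auto
    finally show ?thesis .
  next
    case False
    have [measurable_cong]: "sets (P j) = sets borel" by (rule nc[OF j])
    have "(\<integral>\<^sup>+x. ennreal ((h j x)\<^sup>2) \<partial>P j) = (\<integral>\<^sup>+x. ennreal (\<sigma>\<^sup>2 * (\<eta> j)\<^sup>2) *
        ennreal (if \<bar>x\<bar> > \<tau> * (lam / \<bar>\<eta> j\<bar>) then x\<^sup>2 else 0) \<partial>P j)"
    proof (intro nn_integral_cong)
      fix x :: real
      have "\<bar>\<eta> j * (\<sigma> * x)\<bar> > \<sigma> * \<tau> * lam \<longleftrightarrow> \<sigma> * (\<bar>\<eta> j\<bar> * \<bar>x\<bar>) > \<sigma> * (\<tau> * lam)"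
        using \<sigma> by (simp add: abs_mult mult_ac)
      also have "\<dots> \<longleftrightarrow> \<bar>x\<bar> > \<tau> * (lam / \<bar>\<eta> j\<bar>)"
        using \<sigma> pos[OF j] by (simp add: pos_divide_less_eq mult_ac)
      finally show "ennreal ((h j x)\<^sup>2) = ennreal (\<sigma>\<^sup>2 * (\<eta> j)\<^sup>2) *
          ennreal (if \<bar>x\<bar> > \<tau> * (lam / \<bar>\<eta> j\<bar>) then x\<^sup>2 else 0)"
        using False by (simp add: h_def power_mult_distrib ennreal_mult'[symmetric] mult_ac)
    qed
    also have "\<dots> = ennreal (\<sigma>\<^sup>2 * (\<eta> j)\<^sup>2) *
        (\<integral>\<^sup>+x. ennreal (if \<bar>x\<bar> > \<tau> * (lam / \<bar>\<eta> j\<bar>) then x\<^sup>2 else 0) \<partial>P j)"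
      by (rule nn_integral_cmult) measurable
    also have "\<dots> \<le> ennreal (\<sigma>\<^sup>2 * (\<eta> j)\<^sup>2) * ennreal ((K / 2 + 1) * e j)"
      unfolding e_def using lam
      by (intro mult_left_mono noise_class_truncated_second_moment[OF P[OF j] \<tau> _ moment[OF P[OF j]] K]) auto
    also have "\<dots> \<le> ennreal (\<sigma>\<^sup>2 * (\<eta> j)\<^sup>2) * ennreal (D * e j)"
      by (intro mult_left_mono ennreal_leI mult_right_mono) (auto simp: D_def e_def)
    also have "\<dots> = ennreal (\<sigma>\<^sup>2 * (\<eta> j)\<^sup>2 * (D * e j))" by (simp add: ennreal_mult'[symmetric])
    finally show ?thesis .
  qed
  have hm: "h j \<in> borel_measurable borel" for j unfolding h_def by measurable
  have hm': "(\<lambda>\<xi>. \<Sum>j\<in>J. h j (\<xi> j)) \<in> borel_measurable (PiM {1..d} P)"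
    using JI by (intro borel_measurable_sum comp hm) auto
  have odd_part: "(\<integral>\<^sup>+\<xi>. ennreal ((\<Sum>j\<in>J. h j (\<xi> j))\<^sup>2) \<partial>PiM {1..d} P) \<le> ennreal (D * \<sigma>\<^sup>2 * \<nu>\<^sup>2)"
  proof -
    have "(\<integral>\<^sup>+\<xi>. ennreal ((\<Sum>j\<in>J. h j (\<xi> j))\<^sup>2) \<partial>PiM {1..d} P)
        \<le> ennreal (\<Sum>j\<in>J. \<sigma>\<^sup>2 * (\<eta> j)\<^sup>2 * (D * e j))"
    proof (rule nn_integral_PiM_odd_sum_square_le)
      show "h j (- x) = - h j x" for j x by (simp add: h_def)
    qed (use JI nc hm sqh D in \<open>auto simp: e_def\<close>)
    also have "\<dots> \<le> ennreal (\<Sum>j\<in>{1..d}. \<sigma>\<^sup>2 * (\<eta> j)\<^sup>2 * (D * e j))"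
      using JI D by (intro ennreal_leI sum_mono2) (auto simp: e_def)
    also have "(\<Sum>j\<in>{1..d}. \<sigma>\<^sup>2 * (\<eta> j)\<^sup>2 * (D * e j)) = D * \<sigma>\<^sup>2 * \<nu>\<^sup>2"
      unfolding \<nu>2 sum_distrib_left by (intro sum.cong refl) (simp add: mult_ac)
    finally show ?thesis .
  qed
  \<comment> \<open>A pointwise bound for the sum of squared errors outside \<open>J\<close>; it
    depends on the noise but not on the size of \<open>\<theta>\<close>.\<close>
  define B where "B \<xi> = (\<Sum>j\<in>{1..d} - J. 2 * \<sigma>\<^sup>2 * lam\<^sup>2 * ((\<xi> j)\<^sup>2 + \<tau>\<^sup>2))" for \<xi> :: "nat \<Rightarrow> real"
  have B0: "B \<xi> \<ge> 0" for \<xi> unfolding B_def by (intro sum_nonneg) auto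
  have Bm: "B \<in> borel_measurable (PiM {1..d} P)"
    unfolding B_def by (intro borel_measurable_sum comp[where f = "\<lambda>x. 2 * \<sigma>\<^sup>2 * lam\<^sup>2 * (x\<^sup>2 + \<tau>\<^sup>2)"]) auto
  have signal_part: "(\<integral>\<^sup>+\<xi>. ennreal (B \<xi>) \<partial>PiM {1..d} P) \<le> ennreal (s * (2 * \<sigma>\<^sup>2 * lam\<^sup>2 * (1 + \<tau>\<^sup>2)))"
  proof -
    have comp_int: "(\<integral>\<^sup>+\<xi>. ennreal (2 * \<sigma>\<^sup>2 * lam\<^sup>2 * ((\<xi> j)\<^sup>2 + \<tau>\<^sup>2)) \<partial>PiM {1..d} P)
        = ennreal (2 * \<sigma>\<^sup>2 * lam\<^sup>2 * (1 + \<tau>\<^sup>2))" if j: "j \<in> {1..d}" for j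
    proof -
      have [measurable_cong]: "sets (P j) = sets borel" by (rule nc[OF j])
      interpret Pj: prob_space "P j" by (rule nc[OF j])
      have "(\<integral>\<^sup>+\<xi>. ennreal (2 * \<sigma>\<^sup>2 * lam\<^sup>2 * ((\<xi> j)\<^sup>2 + \<tau>\<^sup>2)) \<partial>PiM {1..d} P)
          = (\<integral>\<^sup>+x. ennreal (2 * \<sigma>\<^sup>2 * lam\<^sup>2 * (x\<^sup>2 + \<tau>\<^sup>2)) \<partial>distr (PiM {1..d} P) (P j) (\<lambda>\<xi>. \<xi> j))"
        using j by (subst nn_integral_distr) (auto intro!: measurable_component_singleton)
      also have "\<dots> = (\<integral>\<^sup>+x. ennreal (2 * \<sigma>\<^sup>2 * lam\<^sup>2 * (x\<^sup>2 + \<tau>\<^sup>2)) \<partial>P j)"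
        using nc(1) j by (subst distr_PiM_component) auto
      also have "\<dots> = (\<integral>\<^sup>+x. ennreal (2 * \<sigma>\<^sup>2 * lam\<^sup>2) * (ennreal (x\<^sup>2) + ennreal (\<tau>\<^sup>2)) \<partial>P j)"
        by (intro nn_integral_cong) (simp add: ennreal_mult'[symmetric] ennreal_plus[symmetric] del: ennreal_plus)
      also have "\<dots> = ennreal (2 * \<sigma>\<^sup>2 * lam\<^sup>2) * (1 + ennreal (\<tau>\<^sup>2))"
        using var[OF j] Pj.emeasure_space_1 by (simp add: nn_integral_cmult nn_integral_add)
      also have "\<dots> = ennreal (2 * \<sigma>\<^sup>2 * lam\<^sup>2 * (1 + \<tau>\<^sup>2))"
        by (simp add: ennreal_mult'[symmetric] ennreal_plus[symmetric] ennreal_1[symmetric] del: ennreal_plus ennreal_1)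
      finally show ?thesis .
    qed
    have "(\<integral>\<^sup>+\<xi>. ennreal (B \<xi>) \<partial>PiM {1..d} P)
        = (\<integral>\<^sup>+\<xi>. (\<Sum>j\<in>{1..d} - J. ennreal (2 * \<sigma>\<^sup>2 * lam\<^sup>2 * ((\<xi> j)\<^sup>2 + \<tau>\<^sup>2))) \<partial>PiM {1..d} P)"
      unfolding B_def by (intro nn_integral_cong sum_ennreal[symmetric]) auto
    also have "\<dots> = (\<Sum>j\<in>{1..d} - J. \<integral>\<^sup>+\<xi>. ennreal (2 * \<sigma>\<^sup>2 * lam\<^sup>2 * ((\<xi> j)\<^sup>2 + \<tau>\<^sup>2)) \<partial>PiM {1..d} P)"
    proof (rule nn_integral_sum)
      fix j assume "j \<in> {1..d} - J"
      then show "(\<lambda>\<xi>. ennreal (2 * \<sigma>\<^sup>2 * lam\<^sup>2 * ((\<xi> j)\<^sup>2 + \<tau>\<^sup>2))) \<in> borel_measurable (PiM {1..d} P)"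
        using comp[of j "\<lambda>x. 2 * \<sigma>\<^sup>2 * lam\<^sup>2 * (x\<^sup>2 + \<tau>\<^sup>2)"] by auto
    qed
    also have "\<dots> = (\<Sum>j\<in>{1..d} - J. ennreal (2 * \<sigma>\<^sup>2 * lam\<^sup>2 * (1 + \<tau>\<^sup>2)))"
      by (intro sum.cong refl comp_int) auto
    also have "\<dots> = ennreal (\<Sum>j\<in>{1..d} - J. 2 * \<sigma>\<^sup>2 * lam\<^sup>2 * (1 + \<tau>\<^sup>2))"
      by (intro sum_ennreal) auto
    also have "(\<Sum>j\<in>{1..d} - J. 2 * \<sigma>\<^sup>2 * lam\<^sup>2 * (1 + \<tau>\<^sup>2))
        = card ({1..d} - J) * (2 * \<sigma>\<^sup>2 * lam\<^sup>2 * (1 + \<tau>\<^sup>2))" by simp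
    also have "ennreal \<dots> \<le> ennreal (s * (2 * \<sigma>\<^sup>2 * lam\<^sup>2 * (1 + \<tau>\<^sup>2)))"
      using cardS by (intro ennreal_leI mult_right_mono) auto
    finally show ?thesis .
  qed
  have pt: "(threshold_estimator d \<eta> \<sigma> \<alpha> \<tau> (real s) (\<lambda>j\<in>{1..d}. \<theta> j + \<sigma> * \<xi> j) - linear_functional d \<eta> \<theta>)\<^sup>2
      \<le> 2 * (\<Sum>j\<in>J. h j (\<xi> j))\<^sup>2 + 2 * real s * B \<xi>" for \<xi>
  proof -
    have "threshold_estimator d \<eta> \<sigma> \<alpha> \<tau> (real s) (\<lambda>j\<in>{1..d}. \<theta> j + \<sigma> * \<xi> j) - linear_functional d \<eta> \<theta>
        = (\<Sum>j=1..d. err j (\<xi> j))"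
      unfolding threshold_estimator_eq_sum[OF load] linear_functional_def sum_subtractf[symmetric]
      by (intro sum.cong refl) (simp add: err_def lam_def)
    also have "\<dots> = (\<Sum>j\<in>J. h j (\<xi> j)) + (\<Sum>j\<in>{1..d} - J. err j (\<xi> j))" (is "_ = ?x + ?y")
      using JI by (subst sum.subset_diff[of J]) (auto simp: errJ)
    finally have "(threshold_estimator d \<eta> \<sigma> \<alpha> \<tau> (real s) (\<lambda>j\<in>{1..d}. \<theta> j + \<sigma> * \<xi> j) - linear_functional d \<eta> \<theta>)\<^sup>2
        = (?x + ?y)\<^sup>2" by simp
    also have "\<dots> \<le> 2 * ?x\<^sup>2 + 2 * ?y\<^sup>2"
      using zero_le_power2[of "?x - ?y"] by (simp add: power2_eq_square algebra_simps)
    \<comment> \<open>Biases need not cancel, so Cauchy-Schwarz is used against the constant 1. It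
      costs the number of terms, at most \<open>s\<close>, and leads to the order
      \<open>(lam * s)^2\<close>.\<close>
    also have "?y\<^sup>2 \<le> (\<Sum>j\<in>{1..d} - J. (err j (\<xi> j))\<^sup>2) * (\<Sum>j\<in>{1..d} - J. 1\<^sup>2)"
      using Cauchy_Schwarz_ineq_sum[of "\<lambda>j. err j (\<xi> j)" "\<lambda>_. 1" "{1..d} - J"] by simp
    also have "\<dots> \<le> B \<xi> * s"
      unfolding B_def using cardS by (intro mult_mono sum_mono err_big) (auto intro!: sum_nonneg)
    finally show ?thesis by (simp add: mult_ac)
  qed
  have "risk d \<eta> \<sigma> (threshold_estimator d \<eta> \<sigma> \<alpha> \<tau> (real s)) \<theta> Q
      = (\<integral>\<^sup>+\<xi>. ennreal ((threshold_estimator d \<eta> \<sigma> \<alpha> \<tau> (real s) (\<lambda>j\<in>{1..d}. \<theta> j + \<sigma> * \<xi> j)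
        - linear_functional d \<eta> \<theta>)\<^sup>2) \<partial>PiM {1..d} P)"
    unfolding QP by (rule risk_eq_nn_integral[OF threshold_estimator_in_estimators nc(2)])
  also have "\<dots> \<le> (\<integral>\<^sup>+\<xi>. ennreal 2 * ennreal ((\<Sum>j\<in>J. h j (\<xi> j))\<^sup>2) + ennreal (2 * real s) * ennreal (B \<xi>)
      \<partial>PiM {1..d} P)"
  proof (intro nn_integral_mono)
    fix \<xi>
    have "ennreal 2 * ennreal ((\<Sum>j\<in>J. h j (\<xi> j))\<^sup>2) + ennreal (2 * real s) * ennreal (B \<xi>)
        = ennreal (2 * (\<Sum>j\<in>J. h j (\<xi> j))\<^sup>2 + 2 * real s * B \<xi>)"
      using B0[of \<xi>] by (subst (1 2) ennreal_mult'[symmetric]) (auto simp: ennreal_plus)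
    then show "ennreal ((threshold_estimator d \<eta> \<sigma> \<alpha> \<tau> (real s) (\<lambda>j\<in>{1..d}. \<theta> j + \<sigma> * \<xi> j)
        - linear_functional d \<eta> \<theta>)\<^sup>2)
        \<le> ennreal 2 * ennreal ((\<Sum>j\<in>J. h j (\<xi> j))\<^sup>2) + ennreal (2 * real s) * ennreal (B \<xi>)"
      using pt[of \<xi>] by (simp only: ennreal_leI)
  qed
  also have "\<dots> = ennreal 2 * (\<integral>\<^sup>+\<xi>. ennreal ((\<Sum>j\<in>J. h j (\<xi> j))\<^sup>2) \<partial>PiM {1..d} P)
      + ennreal (2 * real s) * (\<integral>\<^sup>+\<xi>. ennreal (B \<xi>) \<partial>PiM {1..d} P)"
  proof -
    have "(\<lambda>\<xi>. ennreal ((\<Sum>j\<in>J. h j (\<xi> j))\<^sup>2)) \<in> borel_measurable (PiM {1..d} P)"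
      and "(\<lambda>\<xi>. ennreal (B \<xi>)) \<in> borel_measurable (PiM {1..d} P)"
      using hm' Bm by measurable
    then show ?thesis by (subst nn_integral_add) (auto simp only: nn_integral_cmult intro!: borel_measurable_times_ennreal borel_measurable_const)
  qed
  also have "\<dots> \<le> ennreal 2 * ennreal (D * \<sigma>\<^sup>2 * \<nu>\<^sup>2)
      + ennreal (2 * real s) * ennreal (s * (2 * \<sigma>\<^sup>2 * lam\<^sup>2 * (1 + \<tau>\<^sup>2)))"
    by (intro add_mono mult_left_mono odd_part signal_part) auto
  also have "\<dots> = ennreal (2 * D * \<sigma>\<^sup>2 * \<nu>\<^sup>2 + 4 * (1 + \<tau>\<^sup>2) * \<sigma>\<^sup>2 * (lam * s)\<^sup>2)"
  proof -
    have "ennreal 2 * ennreal (D * \<sigma>\<^sup>2 * \<nu>\<^sup>2) + ennreal (2 * real s) * ennreal (s * (2 * \<sigma>\<^sup>2 * lam\<^sup>2 * (1 + \<tau>\<^sup>2)))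
        = ennreal (2 * (D * \<sigma>\<^sup>2 * \<nu>\<^sup>2) + 2 * real s * (s * (2 * \<sigma>\<^sup>2 * lam\<^sup>2 * (1 + \<tau>\<^sup>2))))"
      using D by (subst (1 2) ennreal_mult'[symmetric]) (auto simp: ennreal_plus)
    also have "2 * (D * \<sigma>\<^sup>2 * \<nu>\<^sup>2) + 2 * real s * (s * (2 * \<sigma>\<^sup>2 * lam\<^sup>2 * (1 + \<tau>\<^sup>2)))
        = 2 * D * \<sigma>\<^sup>2 * \<nu>\<^sup>2 + 4 * (1 + \<tau>\<^sup>2) * \<sigma>\<^sup>2 * (lam * s)\<^sup>2"
      by (simp add: power2_eq_square algebra_simps)
    finally show ?thesis .
  qed
  also have "\<dots> \<le> ennreal ((2 * D + 4 * (1 + \<tau>\<^sup>2)) * \<sigma>\<^sup>2 * (lam * s + \<nu>)\<^sup>2)"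
  proof (intro ennreal_leI)
    have "\<nu>\<^sup>2 \<le> (lam * s + \<nu>)\<^sup>2" "(lam * s)\<^sup>2 \<le> (lam * s + \<nu>)\<^sup>2"
      using lam \<nu> by (auto intro!: power_mono)
    then have "2 * D * \<sigma>\<^sup>2 * \<nu>\<^sup>2 + 4 * (1 + \<tau>\<^sup>2) * \<sigma>\<^sup>2 * (lam * s)\<^sup>2
        \<le> 2 * D * \<sigma>\<^sup>2 * (lam * s + \<nu>)\<^sup>2 + 4 * (1 + \<tau>\<^sup>2) * \<sigma>\<^sup>2 * (lam * s + \<nu>)\<^sup>2"
      using D by (intro add_mono mult_left_mono) auto
    then show "2 * D * \<sigma>\<^sup>2 * \<nu>\<^sup>2 + 4 * (1 + \<tau>\<^sup>2) * \<sigma>\<^sup>2 * (lam * s)\<^sup>2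
        \<le> (2 * D + 4 * (1 + \<tau>\<^sup>2)) * \<sigma>\<^sup>2 * (lam * s + \<nu>)\<^sup>2"
      by (simp add: algebra_simps)
  qed
  finally show ?thesis by (simp only: D_def Phi_o_def lam_def \<nu>_def)
qed

theorem theorem1:
  fixes \<alpha> :: real
  assumes "\<alpha> > 0"
  shows
    "(\<exists>c>0. \<exists>\<tau>\<^sub>\<alpha>>0. \<forall>\<tau>\<ge>\<tau>\<^sub>\<alpha>. \<forall>d\<ge>1. \<forall>\<eta>. loading_vector d \<eta> \<longrightarrow>
        (\<forall>\<sigma>>0. \<forall>s\<in>{1..d}.
           (INF T\<in>estimators d. max_risk d \<eta> \<sigma> \<alpha> \<tau> s T)
             \<ge> ennreal (c * \<sigma>\<^sup>2 * Phi_o d \<eta> \<alpha> (real s))))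
     \<and> (\<forall>\<tau>>0. \<exists>C>0. \<forall>d\<ge>1. \<forall>\<eta>. loading_vector d \<eta> \<longrightarrow>
        (\<forall>\<sigma>>0. \<forall>s\<in>{1..d}.
           max_risk d \<eta> \<sigma> \<alpha> \<tau> s (threshold_estimator d \<eta> \<sigma> \<alpha> \<tau> (real s))
             \<le> ennreal (C * \<sigma>\<^sup>2 * Phi_o d \<eta> \<alpha> (real s))))"
proof (intro conjI allI impI)
  obtain a c where a: "a > 0" and c: "c > 0"
    and total: "(\<integral>x. a * exp (- c * \<bar>x\<bar> powr \<alpha>) \<partial>lborel) = 1"
    and var: "(\<integral>x. x\<^sup>2 * (a * exp (- c * \<bar>x\<bar> powr \<alpha>)) \<partial>lborel) = 1"
    using exp_powr_density_exists[OF assms] by blast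
  obtain C where C: "C > 0"
    and add: "\<And>u v. u \<ge> 0 \<Longrightarrow> v \<ge> 0 \<Longrightarrow> (u + v) powr \<alpha> \<le> 3 / 2 * u powr \<alpha> + C * v powr \<alpha>"
    using powr_add_le[OF assms] by blast
  obtain \<tau>0 where \<tau>0: "\<tau>0 > 0" and noise: "\<And>\<tau>. \<tau> \<ge> \<tau>0 \<Longrightarrow> exp_power_noise \<alpha> a c \<in> noise_class \<alpha> \<tau>"
    using exp_power_noise_in_noise_class[OF assms a c total var] by blast
  define \<kappa> where "\<kappa> = (1 / (C * c)) powr (1 / \<alpha>) / 2"
  define A where "A = (\<integral>x. a * exp (- (c / 2) * \<bar>x\<bar> powr \<alpha>) \<partial>lborel)"
  define c0 where "c0 = \<kappa>\<^sup>2 / (32 * (1 + exp (A * exp 1)))"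
  have "\<kappa> > 0" using C c by (simp add: \<kappa>_def)
  then have c0: "c0 > 0" by (simp add: c0_def add_pos_pos)
  have lower: "ennreal (c0 * \<sigma>\<^sup>2 * Phi_o d \<eta> \<alpha> (real s)) \<le> max_risk d \<eta> \<sigma> \<alpha> \<tau> s T"
    if "\<tau> \<ge> \<tau>0" "d \<ge> 1" "loading_vector d \<eta>" "\<sigma> > 0" "s \<in> {1..d}" "T \<in> estimators d"
    for \<tau> d \<eta> \<sigma> s T
  proof (cases "max_risk d \<eta> \<sigma> \<alpha> \<tau> s T = \<infinity>")
    case False
    \<comment> \<open>The minimax bound takes a real number as risk bound; an infinite maximal risk
      satisfies the inequality trivially.\<close>
    define R where "R = enn2real (max_risk d \<eta> \<sigma> \<alpha> \<tau> s T)"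
    have R: "max_risk d \<eta> \<sigma> \<alpha> \<tau> s T = ennreal R" "R \<ge> 0"
      using False by (simp_all add: R_def less_top)
    \<comment> \<open>One and the same noise law is admissible for every
      \<open>\<tau> \<ge> \<tau>0\<close>, which is why \<open>c0\<close> does not depend on
      \<open>\<tau>\<close>.\<close>
    have Q: "PiM {1..d} (\<lambda>_. exp_power_noise \<alpha> a c) \<in> product_noise_class d \<alpha> \<tau>"
      using noise[OF that(1)] by (auto simp: product_noise_class_def)
    have "c0 * \<sigma>\<^sup>2 * Phi_o d \<eta> \<alpha> (real s) \<le> R"
      unfolding c0_def \<kappa>_def A_def
    proof (rule exp_power_noise_minimax_bound[OF assms a c C total add])
      fix \<theta> assume "\<theta> \<in> sparse_class d s"
      then show "risk d \<eta> \<sigma> T \<theta> (PiM {1..d} (\<lambda>_. exp_power_noise \<alpha> a c)) \<le> ennreal R"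
        unfolding R(1)[symmetric] max_risk_def using Q by (intro SUP_upper2) auto
    qed (use that R in auto)
    then show ?thesis using R by (simp add: ennreal_leI)
  qed simp
  show "\<exists>c>0. \<exists>\<tau>\<^sub>\<alpha>>0. \<forall>\<tau>\<ge>\<tau>\<^sub>\<alpha>. \<forall>d\<ge>1. \<forall>\<eta>. loading_vector d \<eta> \<longrightarrow>
      (\<forall>\<sigma>>0. \<forall>s\<in>{1..d}. (INF T\<in>estimators d. max_risk d \<eta> \<sigma> \<alpha> \<tau> s T)
        \<ge> ennreal (c * \<sigma>\<^sup>2 * Phi_o d \<eta> \<alpha> (real s)))"
    using c0 \<tau>0 by (intro exI[of _ c0] exI[of _ \<tau>0] conjI allI impI ballI INF_greatest lower)
next
  fix \<tau> :: real
  assume \<tau>: "\<tau> > 0"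
  obtain K where K: "K \<ge> 0" "\<And>P. P \<in> noise_class \<alpha> \<tau> \<Longrightarrow> (\<integral>\<^sup>+x. ennreal (x ^ 4) \<partial>P) \<le> ennreal K"
    using noise_class_fourth_moment[OF assms \<tau>] by blast
  define C where "C = 2 * (exp 1 + K / 2 + 1) + 4 * (1 + \<tau>\<^sup>2)"
  have C: "C > 0" using K by (simp add: C_def add_pos_nonneg add_nonneg_pos)
  have "max_risk d \<eta> \<sigma> \<alpha> \<tau> s (threshold_estimator d \<eta> \<sigma> \<alpha> \<tau> (real s))
      \<le> ennreal (C * \<sigma>\<^sup>2 * Phi_o d \<eta> \<alpha> (real s))"
    if "d \<ge> 1" "loading_vector d \<eta>" "\<sigma> > 0" for d \<eta> \<sigma> s
    unfolding max_risk_def C_def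
    by (intro SUP_least threshold_estimator_risk_le[OF assms \<tau> K(1) K(2)] that)
  then show "\<exists>C>0. \<forall>d\<ge>1. \<forall>\<eta>. loading_vector d \<eta> \<longrightarrow> (\<forall>\<sigma>>0. \<forall>s\<in>{1..d}.
      max_risk d \<eta> \<sigma> \<alpha> \<tau> s (threshold_estimator d \<eta> \<sigma> \<alpha> \<tau> (real s))
        \<le> ennreal (C * \<sigma>\<^sup>2 * Phi_o d \<eta> \<alpha> (real s)))"
    using C by blast
qed

end
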